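(* Let $\Omega\subset\mathbb{R}^N$ be a bounded open set, let $p,q\in\mathbb{R}$ and $s_i,t_i\in\mathbb{R}$ ($i=1,\dots,N$) satisfy $0<s_i\le t_i<1<p\le q<\infty$ for all $i$, and let $a:\mathbb{R}^N\times\mathbb{R}^N\to\mathbb{R}$ be measurable with $0\le a(x,y)\le \|a\|_{L^\infty}<\infty$. Put $\bar s=\left(\frac1N\sum_{i=1}^N\frac1{s_i}\right)^{-1}$, $s^+=\max_i s_i$, $t^+=\max_i t_i$, and assume $\bar s p<N$ and $p<p^*_{\bar s}:=\frac{Np}{N-\bar s p}$. Assume moreover that $$\max\left\{\frac{1}{1-t^+},\,1+s^+p\right\}\le q\le p^*_{\bar s}.$$ Let $u\in A(\mathbb{R}^N,\mathbb{R})\cap L^{q-1}_{\vec s,p}(\mathbb{R})$ be a weak solution of $\mathcal{L}u=0$ in $\Omega$, and assume that for every rectangle $M_\rho(x_0)\subset\Omega$ with $0<\rho\le 1$, $$\sup_{x\in M_\rho(x_0)}\sum_{i=1}^N\int_{|x_i+h-x_{0,i}|<\rho^{s^+/s_i}}|u(x+he_i)|^q\,dh<\infty .$$ Then $u$ is locally bounded in $\Omega$, i.e. $u\in L^\infty_{\mathrm{loc}}(\Omega)$.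
   Context: Here $e_1,\dots,e_N$ is the standard basis of $\mathbb{R}^N$. Functions are Borel measurable (a Borel representative of each a.e.-equivalence class is fixed), and pointwise expressions such as $u(x+he_i)$ are understood in the almost-everywhere sense. Rectangles: $M_\rho(x_0)=\prod_{i=1}^N\left(x_{0,i}-\rho^{s^+/s_i},\,x_{0,i}+\rho^{s^+/s_i}\right)$ for $\rho>0$, $x_0=(x_{0,1},\dots,x_{0,N})\in\mathbb{R}^N$. The operator: $$\mathcal{L}u(x)=\sum_{i=1}^N \mathrm{P.V.}\int_{\mathbb{R}}\Big[s_i(1-s_i)\frac{|u(x)-u(x+he_i)|^{p-2}(u(x)-u(x+he_i))}{|h|^{1+s_ip}}+t_i(1-t_i)a(x,x+he_i)\frac{|u(x)-u(x+he_i)|^{q-2}(u(x)-u(x+he_i))}{|h|^{1+t_iq}}\Big]dh.$$ Set $H_i(x,h,\tau)=s_i(1-s_i)\frac{\tau^p}{|h|^{s_ip}}+t_i(1-t_i)a(x,x+he_i)\frac{\tau^q}{|h|^{t_iq}}$ for $x\in\mathbb{R}^N$, $h\in\mathbb{R}$, $\tau\ge0$. $A(\mathbb{R}^N,\mathbb{R})$ is the set of $v:\mathbb{R}^N\to\mathbb{R}$ with $v\in L^p(\mathbb{R}^N)$ and $\sum_{i=1}^N\int_{\mathbb{R}^N}\int_{\mathbb{R}}H_i(x,h,|v(x)-v(x+he_i)|)\frac{dh\,dx}{|h|}<\infty$. $L^{q-1}_{\vec s,p}(\mathbb{R})$ is the set of $v:\mathbb{R}^N\to\mathbb{R}$ such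 that for every rectangle $M_\rho(x_0)\subset\Omega$ with $0<\rho\le1$, $$\operatorname*{ess\,sup}_{x\in M_\rho(x_0)}\sum_{i=1}^N\int_{\mathbb{R}}\frac{|v(x+he_i)|^{q-1}}{(1+|h+x_i|)^{1+s_ip}}\,dh<\infty .$$ Weak solution: $u\in A(\mathbb{R}^N,\mathbb{R})$ is a weak solution of $\mathcal{L}u=0$ in $\Omega$ if for every $\eta\in A(\mathbb{R}^N,\mathbb{R})$ with $\eta=0$ a.e. in $\mathbb{R}^N\setminus\Omega$, $$\sum_{i=1}^N\int_{\mathbb{R}^N}\int_{\mathbb{R}}\Big\{s_i(1-s_i)\frac{|u(x)-u(x+he_i)|^{p-2}(u(x)-u(x+he_i))}{|h|^{1+s_ip}}+t_i(1-t_i)a(x,x+he_i)\frac{|u(x)-u(x+he_i)|^{q-2}(u(x)-u(x+he_i))}{|h|^{1+t_iq}}\Big\}(\eta(x)-\eta(x+he_i))\,dh\,dx=0.$$ *)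

theory Defs
  imports "HOL-Analysis.Analysis" "HOL-Probability.Essential_Supremum"
begin

text \<open>
  Functions are Borel measurable representatives. The index type \<open>'n\<close> plays the role of
  \<open>{1, ..., N}\<close>, so \<open>N = CARD('n)\<close> and \<open>axis i 1\<close> is the standard basis vector \<open>e\<^sub>i\<close>.
  The single point \<open>h = 0\<close>, where the kernels below are given by the convention \<open>x / 0 = 0\<close>,
  is a null set for \<open>dh\<close>.
\<close>

definition harmonic_mean :: "('n::finite \<Rightarrow> real) \<Rightarrow> real" where
  "harmonic_mean s = inverse (1 / real CARD('n) * (\<Sum>i\<in>UNIV. 1 / s i))"

abbreviation max_index :: "('n::finite \<Rightarrow> real) \<Rightarrow> real" where
  "max_index s \<equiv> Max (range s)"

definition critical_exponent :: "('n::finite \<Rightarrow> real) \<Rightarrow> real \<Rightarrow> real" where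
  "critical_exponent s p =
     real CARD('n) * p / (real CARD('n) - harmonic_mean s * p)"

definition aniso_rect :: "('n::finite \<Rightarrow> real) \<Rightarrow> real \<Rightarrow> real ^ 'n \<Rightarrow> (real ^ 'n) set" where
  "aniso_rect s \<rho> x\<^sub>0 =
     box (\<chi> i. x\<^sub>0 $ i - \<rho> powr (max_index s / s i)) (\<chi> i. x\<^sub>0 $ i + \<rho> powr (max_index s / s i))"

definition Linf_norm :: "('a::euclidean_space \<Rightarrow> real) \<Rightarrow> ereal" where
  "Linf_norm f = esssup lborel (\<lambda>x. ereal \<bar>f x\<bar>)"

definition in_Lp :: "real \<Rightarrow> ('a::euclidean_space \<Rightarrow> real) \<Rightarrow> bool" where
  "in_Lp p f \<longleftrightarrow> f \<in> borel_measurable borel \<and>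
     (\<integral>\<^sup>+x. ennreal (\<bar>f x\<bar> powr p) \<partial>lborel) < \<infinity>"

definition locally_bounded_on :: "'a::euclidean_space set \<Rightarrow> ('a \<Rightarrow> real) \<Rightarrow> bool" where
  "locally_bounded_on \<Omega> f \<longleftrightarrow> f \<in> borel_measurable borel \<and>
     (\<forall>K. compact K \<and> K \<subseteq> \<Omega> \<longrightarrow> esssup (restrict_space lborel K) (\<lambda>x. ennreal \<bar>f x\<bar>) < \<infinity>)"

definition H_fun :: "real \<Rightarrow> real \<Rightarrow> ('n::finite \<Rightarrow> real) \<Rightarrow> ('n \<Rightarrow> real) \<Rightarrow>
    ((real ^ 'n) \<times> (real ^ 'n) \<Rightarrow> real) \<Rightarrow> 'n \<Rightarrow> real ^ 'n \<Rightarrow> real \<Rightarrow> real \<Rightarrow> real" where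
  "H_fun p q s t a i x h \<tau> =
     s i * (1 - s i) * (\<tau> powr p / \<bar>h\<bar> powr (s i * p)) +
     t i * (1 - t i) * a (x, x + h *\<^sub>R axis i 1) * (\<tau> powr q / \<bar>h\<bar> powr (t i * q))"

definition A_space :: "real \<Rightarrow> real \<Rightarrow> ('n::finite \<Rightarrow> real) \<Rightarrow> ('n \<Rightarrow> real) \<Rightarrow>
    ((real ^ 'n) \<times> (real ^ 'n) \<Rightarrow> real) \<Rightarrow> (real ^ 'n \<Rightarrow> real) set" where
  "A_space p q s t a = {v. in_Lp p v \<and>
     (\<Sum>i\<in>UNIV. \<integral>\<^sup>+x. (\<integral>\<^sup>+h.
        ennreal (H_fun p q s t a i x h \<bar>v x - v (x + h *\<^sub>R axis i 1)\<bar> / \<bar>h\<bar>) \<partial>lborel) \<partial>lborel) < \<infinity>}"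

definition tail_space :: "(real ^ 'n::finite) set \<Rightarrow> real \<Rightarrow> real \<Rightarrow> ('n \<Rightarrow> real) \<Rightarrow>
    (real ^ 'n \<Rightarrow> real) set" where
  "tail_space \<Omega> p q s = {v. v \<in> borel_measurable borel \<and>
     (\<forall>x\<^sub>0 \<rho>. 0 < \<rho> \<and> \<rho> \<le> 1 \<and> aniso_rect s \<rho> x\<^sub>0 \<subseteq> \<Omega> \<longrightarrow>
        esssup (restrict_space lborel (aniso_rect s \<rho> x\<^sub>0))
          (\<lambda>x. \<Sum>i\<in>UNIV. \<integral>\<^sup>+h. ennreal (\<bar>v (x + h *\<^sub>R axis i 1)\<bar> powr (q - 1)
                 / (1 + \<bar>h + x $ i\<bar>) powr (1 + s i * p)) \<partial>lborel) < \<infinity>)}"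

text \<open>The integrand of the operator \<open>\<L>u\<close> in direction \<open>i\<close>, without the principal value.\<close>

definition op_integrand :: "real \<Rightarrow> real \<Rightarrow> ('n::finite \<Rightarrow> real) \<Rightarrow> ('n \<Rightarrow> real) \<Rightarrow>
    ((real ^ 'n) \<times> (real ^ 'n) \<Rightarrow> real) \<Rightarrow> (real ^ 'n \<Rightarrow> real) \<Rightarrow> 'n \<Rightarrow> real ^ 'n \<Rightarrow> real \<Rightarrow> real" where
  "op_integrand p q s t a u i x h =
     (let d = u x - u (x + h *\<^sub>R axis i 1) in
        s i * (1 - s i) * (\<bar>d\<bar> powr (p - 2) * d / \<bar>h\<bar> powr (1 + s i * p)) +
        t i * (1 - t i) * a (x, x + h *\<^sub>R axis i 1) *
          (\<bar>d\<bar> powr (q - 2) * d / \<bar>h\<bar> powr (1 + t i * q)))"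

text \<open>
  For \<open>u\<close> and \<open>\<eta>\<close> in \<open>A_space\<close> and bounded nonnegative \<open>a\<close>, the integrand below is absolutely
  integrable in \<open>(h, x)\<close> by Hoelder's inequality, so the Bochner integrals are genuine ones.
\<close>

definition weak_solution :: "(real ^ 'n::finite) set \<Rightarrow> real \<Rightarrow> real \<Rightarrow> ('n \<Rightarrow> real) \<Rightarrow> ('n \<Rightarrow> real) \<Rightarrow>
    ((real ^ 'n) \<times> (real ^ 'n) \<Rightarrow> real) \<Rightarrow> (real ^ 'n \<Rightarrow> real) \<Rightarrow> bool" where
  "weak_solution \<Omega> p q s t a u \<longleftrightarrow> u \<in> A_space p q s t a \<and>
     (\<forall>\<eta>\<in>A_space p q s t a. (AE x in lborel. x \<notin> \<Omega> \<longrightarrow> \<eta> x = 0) \<longrightarrow>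
        (\<Sum>i\<in>UNIV. LINT x|lborel. (LINT h|lborel.
           op_integrand p q s t a u i x h * (\<eta> x - \<eta> (x + h *\<^sub>R axis i 1)))) = 0)"

end

theory Submission
  imports Defs
begin

text \<open>
  The proof is De Giorgi's iteration, and it needs two ingredients.

  The first is a Sobolev inequality at the critical exponent. Write \<open>E(g)\<close> for the sum over \<open>i\<close> of
  the integrals of \<open>\<bar>g x - g (x + h e\<^sub>i)\<bar>\<^sup>p / \<bar>h\<bar> powr (1 + s\<^sub>i p)\<close>, put
  \<open>\<theta> = p / (\<Sum>\<^sub>i 1 / s\<^sub>i)\<close>, and let \<open>P = p / (1 - \<theta>)\<close>, which is the critical exponent \<open>p\<^sup>*\<close>.
  Then \<open>\<integral> f\<^sup>P \<le> K E(f) powr (P / p)\<close> for nonnegative \<open>f\<close> in \<open>L\<^sup>p\<close> (\<open>aniso_sobolev\<close>). It comes from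
  a statement about one level: if \<open>0 \<le> g \<le> M\<close> lives on a set of measure \<open>\<alpha>\<close>, average the difference
  \<open>g x - g (x + y)\<close> over a box of volume \<open>2 \<alpha>\<close>. Where \<open>g = M\<close> that difference equals \<open>M\<close> for at
  least half of all \<open>y\<close>, whereas telescoping along the axes bounds its \<open>p\<close>-th power by energies; with
  sides \<open>R powr (1 / s\<^sub>i)\<close> all directions contribute the same factor \<open>R\<^sup>p\<close>, a multiple of
  \<open>\<alpha> powr \<theta>\<close> (\<open>level_set_estimate\<close>). Cutting \<open>f\<close> into dyadic slices, whose energies sum to at most
  \<open>E(f)\<close>, turns this into the inequality (\<open>dyadic_sum_bound\<close>).

  The second ingredient is a Caccioppoli inequality. Test the equation with \<open>\<eta> = w \<phi>\<^sup>q\<close>, where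
  \<open>w = (u - k)\<^sup>+\<close> and \<open>\<phi>\<close> is a cut-off supported well inside a ball \<open>B\<close>. A pointwise inequality for
  the values at two points (\<open>pointwise_caccioppoli\<close>), applied to both growths \<open>p\<close> and \<open>q\<close>, bounds
  \<open>E(\<eta>)\<close> by \<open>w\<^sup>p\<close> and \<open>w\<^sup>q\<close> inside \<open>B\<close>, weighted by increments of \<open>\<phi>\<close>, and by the interaction of \<open>\<eta>\<close> with
  the values of \<open>w\<close> outside \<open>B\<close>; the latter takes place at a distance bounded below and is
  controlled by the tail of \<open>u\<close>. The outcome is
  \<open>E(\<eta>) \<le> C L powr (1 + q) \<integral>\<^sub>B (w\<^sup>p + w\<^sup>q + w)\<close>, where \<open>L\<close> is the Lipschitz constant of \<open>\<phi>\<close>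
  (\<open>caccioppoli\<close>). The coefficient \<open>a\<close> enters only through \<open>0 \<le> a \<le> \<Lambda>\<close>, so its lack of symmetry
  is harmless, and \<open>\<eta>\<close> has finite energy because the Sobolev inequality places \<open>u\<close> in
  \<open>L\<^sup>p \<inter> L\<^sup>P\<close>, hence in \<open>L\<^sup>q\<close>.

  Let now \<open>Y\<^sub>j\<close> be the integral of \<open>((u - k\<^sub>j)\<^sup>+)\<^sup>P\<close> over shrinking balls, with levels \<open>k\<^sub>j\<close> increasing
  from \<open>k\<close> to \<open>2 k\<close>. The powers \<open>p\<close>, \<open>q\<close> and \<open>1\<close> do not exceed \<open>P\<close>, so each is absorbed into \<open>Y\<^sub>j\<close>
  at the cost of a factor geometric in \<open>j\<close>, and both ingredients together give
  \<open>Y\<^sub>j\<^sub>+\<^sub>1 \<le> A b\<^sup>j Y\<^sub>j powr (P / p)\<close>. As \<open>P > p\<close>, smallness of \<open>Y\<^sub>0\<close>, which holds for large \<open>k\<close>, forces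
  \<open>Y\<^sub>j \<rightarrow> 0\<close>, that is \<open>u \<le> 2 k\<close> on the limit ball (\<open>locally_bounded_above\<close>). The same applies to
  \<open>- u\<close>, and a compact set is covered by finitely many such balls.
\<close>

section \<open>One-dimensional kernels, translations and averages over boxes\<close>

lemma nn_integral_uminus_real:
  fixes f :: "real \<Rightarrow> ennreal"
  assumes [measurable]: "f \<in> borel_measurable borel"
  shows "(\<integral>\<^sup>+h. f (- h) \<partial>lborel) = (\<integral>\<^sup>+h. f h \<partial>lborel)"
  using nn_integral_real_affine[of f "-1" 0] by simp

lemma nn_integral_translate:
  fixes f :: "'a::euclidean_space \<Rightarrow> ennreal"
  assumes [measurable]: "f \<in> borel_measurable borel"
  shows "(\<integral>\<^sup>+x. f (x + c) \<partial>lborel) = (\<integral>\<^sup>+x. f x \<partial>lborel)"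
proof -
  have "(\<integral>\<^sup>+x. f x \<partial>lborel) = (\<integral>\<^sup>+x. f x \<partial>distr lborel borel ((+) c))"
    by (simp add: lborel_distr_plus)
  also have "\<dots> = (\<integral>\<^sup>+x. f (c + x) \<partial>lborel)"
    by (subst nn_integral_distr) auto
  finally show ?thesis by (simp add: add.commute)
qed

lemma nn_integral_powr_near_0_finite:
  assumes "0 < \<alpha>"
  shows "(\<integral>\<^sup>+h\<in>{0..1}. ennreal (h powr (\<alpha> - 1)) \<partial>lborel) < \<infinity>"
proof -
  have "((\<lambda>x. x powr (\<alpha> - 1)) has_integral (1 powr \<alpha> / \<alpha>)) {0..1}"
    using has_integral_powr_from_0[of "\<alpha> - 1" 1] assms by simp
  from nn_integral_has_integral_lebesgue'[OF _ this]
  show ?thesis by (simp add: nn_integral_completion)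
qed

lemma nn_integral_powr_at_top_finite:
  assumes "0 < \<beta>"
  shows "(\<integral>\<^sup>+h\<in>{1..}. ennreal (h powr (- 1 - \<beta>)) \<partial>lborel) < \<infinity>"
proof -
  have "((\<lambda>x. x powr (- 1 - \<beta>)) has_integral (- (1 powr (-1 - \<beta> + 1)) / (-1 - \<beta> + 1))) {1..}"
    using has_integral_powr_to_inf[of "-1 - \<beta>" 1] assms by simp
  from nn_integral_has_integral_lebesgue'[OF _ this]
  show ?thesis by (simp add: nn_integral_completion)
qed

text \<open>A comparison test against \<open>\<bar>h\<bar>\<^sup>\<alpha>\<^sup>-\<^sup>1\<close> near the origin and \<open>\<bar>h\<bar>\<^sup>-\<^sup>1\<^sup>-\<^sup>\<beta>\<close> at infinity.\<close>

lemma nn_integral_kernel_finite: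
  fixes f :: "real \<Rightarrow> real"
  assumes [measurable]: "f \<in> borel_measurable borel"
    and "0 < \<alpha>" "0 < \<beta>"
    and even: "\<And>h. f (- h) = f h"
    and near: "\<And>h. 0 < h \<Longrightarrow> h \<le> 1 \<Longrightarrow> f h \<le> h powr (\<alpha> - 1)"
    and far: "\<And>h. 1 \<le> h \<Longrightarrow> f h \<le> h powr (- 1 - \<beta>)"
  shows "(\<integral>\<^sup>+h. ennreal (f h) \<partial>lborel) < \<infinity>"
proof -
  define g where "g h = ennreal (h powr (\<alpha> - 1)) * indicator {0..1} h
      + ennreal (h powr (- 1 - \<beta>)) * indicator {1..} h" for h :: real
  have [measurable]: "g \<in> borel_measurable borel" unfolding g_def by measurable
  have pos: "ennreal (f h) \<le> g h" if "0 < h" for h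
  proof (cases "h \<le> 1")
    case True
    have "ennreal (f h) \<le> ennreal (h powr (\<alpha> - 1))"
      using near[OF that True] by (rule ennreal_leI)
    also have "\<dots> \<le> g h"
      unfolding g_def using that True by auto
    finally show ?thesis .
  next
    case False
    have "ennreal (f h) \<le> ennreal (h powr (- 1 - \<beta>))"
      using far[of h] False by (intro ennreal_leI) auto
    also have "\<dots> \<le> g h"
      unfolding g_def using that False by auto
    finally show ?thesis .
  qed
  have "(\<integral>\<^sup>+h. ennreal (f h) \<partial>lborel) \<le> (\<integral>\<^sup>+h. g h + g (- h) \<partial>lborel)"
  proof (rule nn_integral_mono_AE)
    have "AE h::real in lborel. h \<noteq> 0" by (rule AE_lborel_singleton)
    then show "AE h in lborel. ennreal (f h) \<le> g h + g (- h)"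
    proof eventually_elim
      case (elim h)
      then consider "0 < h" | "0 < - h" by fastforce
      then show ?case
        using pos[of h] pos[of "- h"] even[of h]
        by cases (auto intro: order_trans add_increasing add_increasing2)
    qed
  qed
  also have "\<dots> = (\<integral>\<^sup>+h. g h \<partial>lborel) + (\<integral>\<^sup>+h. g h \<partial>lborel)"
    by (subst nn_integral_add) (auto simp: nn_integral_uminus_real)
  also have "\<dots> < \<infinity>"
  proof -
    have "(\<integral>\<^sup>+h. g h \<partial>lborel) = (\<integral>\<^sup>+h\<in>{0..1}. ennreal (h powr (\<alpha> - 1)) \<partial>lborel)
        + (\<integral>\<^sup>+h\<in>{1..}. ennreal (h powr (- 1 - \<beta>)) \<partial>lborel)"
      unfolding g_def by (subst nn_integral_add) auto
    then show ?thesis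
      using nn_integral_powr_near_0_finite[OF \<open>0 < \<alpha>\<close>] nn_integral_powr_at_top_finite[OF \<open>0 < \<beta>\<close>]
      by simp
  qed
  finally show ?thesis .
qed

lemma nn_integral_truncated_kernel_finite:
  assumes "0 < m" "0 < \<sigma>" "\<sigma> < 1"
  shows "(\<integral>\<^sup>+h. ennreal (min 1 \<bar>h\<bar> powr m / \<bar>h\<bar> powr (1 + \<sigma> * m)) \<partial>lborel) < \<infinity>"
proof (rule nn_integral_kernel_finite[where \<alpha> = "m * (1 - \<sigma>)" and \<beta> = "\<sigma> * m"])
  fix h :: real
  show "min 1 \<bar>h\<bar> powr m / \<bar>h\<bar> powr (1 + \<sigma> * m) \<le> h powr (m * (1 - \<sigma>) - 1)" if "0 < h" "h \<le> 1"
    using that by (simp add: powr_diff[symmetric] algebra_simps)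
  show "min 1 \<bar>h\<bar> powr m / \<bar>h\<bar> powr (1 + \<sigma> * m) \<le> h powr (- 1 - \<sigma> * m)" if "1 \<le> h"
    using that powr_minus_divide[of h "1 + \<sigma> * m"] by simp
qed (use assms in auto)

lemma nn_integral_decaying_kernel_finite:
  assumes "0 < c"
  shows "(\<integral>\<^sup>+h. ennreal (1 / (1 + \<bar>h\<bar>) powr (1 + c)) \<partial>lborel) < \<infinity>"
proof (rule nn_integral_kernel_finite[where \<alpha> = 1 and \<beta> = c])
  fix h :: real
  show "1 / (1 + \<bar>h\<bar>) powr (1 + c) \<le> h powr (1 - 1)" if "0 < h" "h \<le> 1"
    using that assms by (simp add: ge_one_powr_ge_zero divide_le_eq)
  show "1 / (1 + \<bar>h\<bar>) powr (1 + c) \<le> h powr (- 1 - c)" if "1 \<le> h"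
  proof -
    have "h powr (1 + c) \<le> (1 + h) powr (1 + c)"
      using that assms by (intro powr_mono2) auto
    then have "1 / (1 + h) powr (1 + c) \<le> 1 / h powr (1 + c)"
      using that by (intro divide_left_mono mult_pos_pos) auto
    then show ?thesis
      using that powr_minus_divide[of h "1 + c"] by simp
  qed
qed (use assms in auto)

text \<open>
  Exchanging the endpoints \<open>x\<close> and \<open>x + h e\<^sub>i\<close> of a segment; it brings terms weighted at the far
  endpoint to the form in which the weight sits at \<open>x\<close>.
\<close>

lemma nn_integral_pair_swap:
  fixes g :: "real ^ 'n \<Rightarrow> real \<Rightarrow> ennreal"
  assumes [measurable]: "case_prod g \<in> borel_measurable (borel \<Otimes>\<^sub>M borel)"
  shows "(\<integral>\<^sup>+x. \<integral>\<^sup>+h. g (x + h *\<^sub>R axis i 1) (- h) \<partial>lborel \<partial>lborel)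
       = (\<integral>\<^sup>+x. \<integral>\<^sup>+h. g x h \<partial>lborel \<partial>lborel)"
proof -
  have "(\<integral>\<^sup>+x. \<integral>\<^sup>+h. g (x + h *\<^sub>R axis i 1) (- h) \<partial>lborel \<partial>lborel)
      = (\<integral>\<^sup>+h. \<integral>\<^sup>+x. g (x + h *\<^sub>R axis i 1) (- h) \<partial>lborel \<partial>lborel)"
    by (rule lborel_pair.Fubini'[symmetric]) measurable
  also have "\<dots> = (\<integral>\<^sup>+h. \<integral>\<^sup>+x. g x (- h) \<partial>lborel \<partial>lborel)"
    by (intro nn_integral_cong nn_integral_translate) measurable
  also have "\<dots> = (\<integral>\<^sup>+h. \<integral>\<^sup>+x. g x h \<partial>lborel \<partial>lborel)"
    by (rule nn_integral_uminus_real[where f = "\<lambda>h. \<integral>\<^sup>+x. g x h \<partial>lborel"]) measurable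
  also have "\<dots> = (\<integral>\<^sup>+x. \<integral>\<^sup>+h. g x h \<partial>lborel \<partial>lborel)"
    by (rule lborel_pair.Fubini') measurable
  finally show ?thesis .
qed

lemma prod_Basis_vec:
  fixes f :: "real ^ 'n \<Rightarrow> 'a::comm_monoid_mult"
  shows "(\<Prod>b\<in>Basis. f b) = (\<Prod>i\<in>UNIV. f (axis i 1))"
proof -
  have "bij_betw (\<lambda>i::'n. axis i (1::real)) UNIV Basis"
    by (auto simp: bij_betw_def inj_on_def axis_eq_axis Basis_vec_def)
  then show ?thesis
    by (rule prod.reindex_bij_betw[symmetric])
qed

lemma nn_integral_vec_prod:
  fixes f :: "'n::finite \<Rightarrow> real \<Rightarrow> ennreal"
  assumes [measurable]: "\<And>i. f i \<in> borel_measurable borel"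
  shows "(\<integral>\<^sup>+y. (\<Prod>i\<in>UNIV. f i (y $ i)) \<partial>(lborel :: (real ^ 'n) measure))
       = (\<Prod>i\<in>UNIV. \<integral>\<^sup>+h. f i h \<partial>lborel)"
proof -
  define F where "F b = f (THE i. b = axis i 1)" for b :: "real ^ 'n"
  have F: "F (axis i 1) = f i" for i
    unfolding F_def by (rule arg_cong[where f = f]) (auto simp: axis_eq_axis)
  have "(\<integral>\<^sup>+y. (\<Prod>b\<in>Basis. F b (y \<bullet> b)) \<partial>lborel) = (\<Prod>b\<in>Basis. \<integral>\<^sup>+h. F b h \<partial>lborel)"
    by (rule nn_integral_lborel_prod) (auto simp: F_def)
  then show ?thesis
    by (simp add: prod_Basis_vec F inner_axis)
qed

text \<open>
  On a box, a function of one coordinate integrates to its integral over that side times the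
  lengths of the other sides.
\<close>

lemma nn_integral_box_coordinate:
  fixes r :: "'n::finite \<Rightarrow> real"
  assumes [measurable]: "f \<in> borel_measurable borel" and r: "\<And>i. 0 < r i"
  shows "(\<integral>\<^sup>+y\<in>{y. \<forall>j. 0 < y $ j \<and> y $ j < r j}. f (y $ i) \<partial>lborel)
       = ennreal (\<Prod>j\<in>UNIV - {i}. r j) * (\<integral>\<^sup>+h\<in>{0<..<r i}. f h \<partial>lborel)"
proof -
  define F where "F j h = (if j = i then f h else 1) * indicator {0<..<r j} h" for j and h :: real
  have [measurable]: "F j \<in> borel_measurable borel" for j unfolding F_def by measurable
  have ind: "indicator {y. \<forall>j. 0 < y $ j \<and> y $ j < r j} y
      = (\<Prod>j\<in>UNIV. indicator {0<..<r j} (y $ j) :: ennreal)" for y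
    by (cases "\<forall>j. 0 < y $ j \<and> y $ j < r j") (auto simp: indicator_def)
  have "(\<integral>\<^sup>+y\<in>{y. \<forall>j. 0 < y $ j \<and> y $ j < r j}. f (y $ i) \<partial>lborel)
      = (\<integral>\<^sup>+y. (\<Prod>j\<in>UNIV. F j (y $ j)) \<partial>lborel)"
    by (intro nn_integral_cong) (simp add: F_def prod.distrib ind)
  also have "\<dots> = (\<Prod>j\<in>UNIV. \<integral>\<^sup>+h. F j h \<partial>lborel)"
    by (rule nn_integral_vec_prod) measurable
  also have "\<dots> = (\<integral>\<^sup>+h. F i h \<partial>lborel) * (\<Prod>j\<in>UNIV - {i}. \<integral>\<^sup>+h. F j h \<partial>lborel)"
    by (rule prod.remove) auto
  also have "(\<Prod>j\<in>UNIV - {i}. \<integral>\<^sup>+h. F j h \<partial>lborel) = (\<Prod>j\<in>UNIV - {i}. ennreal (r j))"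
    by (intro prod.cong) (auto simp: F_def r less_imp_le)
  also have "\<dots> = ennreal (\<Prod>j\<in>UNIV - {i}. r j)"
    by (intro prod_ennreal) (simp add: r less_imp_le)
  finally show ?thesis by (simp add: F_def mult.commute)
qed

section \<open>The anisotropic fractional Sobolev inequality\<close>

definition aniso_energy :: "real \<Rightarrow> ('n::finite \<Rightarrow> real) \<Rightarrow> (real ^ 'n \<Rightarrow> real) \<Rightarrow> ennreal" where
  "aniso_energy p s g = (\<Sum>i\<in>UNIV. \<integral>\<^sup>+x. \<integral>\<^sup>+h.
     ennreal (\<bar>g x - g (x + h *\<^sub>R axis i 1)\<bar> powr p / \<bar>h\<bar> powr (1 + s i * p)) \<partial>lborel \<partial>lborel)"

lemma abs_add_powr_le:
  fixes a b :: real
  assumes "0 \<le> m"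
  shows "\<bar>a + b\<bar> powr m \<le> 2 powr m * (\<bar>a\<bar> powr m + \<bar>b\<bar> powr m)"
proof -
  have "\<bar>a + b\<bar> powr m \<le> (2 * max \<bar>a\<bar> \<bar>b\<bar>) powr m"
    using assms by (intro powr_mono2) auto
  also have "\<dots> = 2 powr m * max \<bar>a\<bar> \<bar>b\<bar> powr m"
    by (simp add: powr_mult)
  also have "max \<bar>a\<bar> \<bar>b\<bar> powr m \<le> \<bar>a\<bar> powr m + \<bar>b\<bar> powr m"
    by (auto simp: max_def)
  finally show ?thesis by (simp add: mult_left_mono)
qed

lemma vec_eq_sum_axis: "(y :: real ^ 'n::finite) = (\<Sum>i\<in>UNIV. (y $ i) *\<^sub>R axis i 1)"
  by (simp add: vec_eq_iff axis_def if_distrib [where f = "\<lambda>x. _ * x"] cong: if_cong)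

text \<open>
  Walk from \<open>x\<close> to \<open>x + y\<close> one axis at a time. Each step starts at a translate of \<open>x\<close>, which does
  not change the integral over \<open>x\<close>; every triangle inequality costs a factor \<open>2\<^sup>p\<close>.
\<close>

lemma difference_le_axis_differences:
  fixes g :: "real ^ 'n::finite \<Rightarrow> real"
  assumes [measurable]: "g \<in> borel_measurable borel" and "0 \<le> p"
  shows "(\<integral>\<^sup>+x. ennreal (\<bar>g x - g (x + y)\<bar> powr p) \<partial>lborel)
      \<le> ennreal (2 powr (p * CARD('n)))
        * (\<Sum>i\<in>UNIV. \<integral>\<^sup>+x. ennreal (\<bar>g x - g (x + (y $ i) *\<^sub>R axis i 1)\<bar> powr p) \<partial>lborel)"
proof -
  define \<omega> where "\<omega> z = (\<integral>\<^sup>+x. ennreal (\<bar>g x - g (x + z)\<bar> powr p) \<partial>lborel)" for z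
  have add: "\<omega> (a + b) \<le> ennreal (2 powr p) * (\<omega> a + \<omega> b)" for a b
  proof -
    have "\<omega> (a + b) \<le> (\<integral>\<^sup>+x. ennreal (2 powr p) * (ennreal (\<bar>g x - g (x + a)\<bar> powr p)
        + ennreal (\<bar>g (x + a) - g (x + a + b)\<bar> powr p)) \<partial>lborel)"
      unfolding \<omega>_def
    proof (rule nn_integral_mono)
      fix x
      show "ennreal (\<bar>g x - g (x + (a + b))\<bar> powr p) \<le> ennreal (2 powr p)
          * (ennreal (\<bar>g x - g (x + a)\<bar> powr p) + ennreal (\<bar>g (x + a) - g (x + a + b)\<bar> powr p))"
        using abs_add_powr_le[OF \<open>0 \<le> p\<close>, of "g x - g (x + a)" "g (x + a) - g (x + a + b)"]
        by (simp add: ennreal_mult[symmetric] ennreal_plus[symmetric] add.assoc del: ennreal_plus)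
    qed
    also have "\<dots> = ennreal (2 powr p) * (\<omega> a
        + (\<integral>\<^sup>+x. ennreal (\<bar>g (x + a) - g (x + a + b)\<bar> powr p) \<partial>lborel))"
      unfolding \<omega>_def by (simp add: nn_integral_cmult nn_integral_add)
    also have "(\<integral>\<^sup>+x. ennreal (\<bar>g (x + a) - g (x + a + b)\<bar> powr p) \<partial>lborel) = \<omega> b"
      unfolding \<omega>_def by (rule nn_integral_translate) measurable
    finally show ?thesis .
  qed
  have "\<omega> (\<Sum>i\<in>S. (y $ i) *\<^sub>R axis i 1) \<le> ennreal (2 powr (p * card S))
      * (\<Sum>i\<in>S. \<omega> ((y $ i) *\<^sub>R axis i 1))" for S :: "'n set"
  proof (induction S rule: finite_induct[OF finite])
    case 1
    then show ?case by (simp add: \<omega>_def)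
  next
    case (2 i S)
    let ?z = "\<lambda>i. (y $ i) *\<^sub>R axis i (1::real)"
    have one: "1 \<le> ennreal (2 powr (p * card S))"
      using \<open>0 \<le> p\<close> by (simp add: ge_one_powr_ge_zero)
    have "\<omega> (\<Sum>i\<in>insert i S. ?z i) \<le> ennreal (2 powr p) * (\<omega> (?z i) + \<omega> (\<Sum>i\<in>S. ?z i))"
      using 2 add by simp
    also have "\<dots> \<le> ennreal (2 powr p) * (ennreal (2 powr (p * card S)) * \<omega> (?z i)
        + ennreal (2 powr (p * card S)) * (\<Sum>i\<in>S. \<omega> (?z i)))"
      using one 2(3) mult_right_mono[OF one, of "\<omega> (?z i)"]
      by (intro mult_left_mono add_mono) auto
    also have "\<dots> = ennreal (2 powr (p * card (insert i S))) * (\<Sum>i\<in>insert i S. \<omega> (?z i))"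
      using 2 by (simp add: distrib_left powr_add ennreal_mult mult.assoc)
    finally show ?case .
  qed
  from this[of UNIV] show ?thesis
    unfolding \<omega>_def by (simp add: vec_eq_sum_axis[of y, symmetric])
qed

text \<open>
  The function is compared with its translates by vectors of a box of volume \<open>2 \<alpha>\<close>. If \<open>g x = M\<close>,
  then \<open>g (x + y)\<close> vanishes for at least half of the \<open>y\<close> in the box, since \<open>g\<close> is positive on a set
  of measure at most \<open>\<alpha>\<close>. The side in direction \<open>i\<close> is \<open>R powr (1 / s\<^sub>i)\<close>, so that the mean of
  \<open>\<integral> \<bar>g x - g (x + h e\<^sub>i)\<bar>\<^sup>p\<close> over \<open>h\<close> in that side is at most \<open>R\<^sup>p\<close> times the energy in direction
  \<open>i\<close>, uniformly in \<open>i\<close>.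
\<close>

lemma level_set_estimate:
  fixes g :: "real ^ 'n::finite \<Rightarrow> real" and s :: "'n \<Rightarrow> real"
  assumes [measurable]: "g \<in> borel_measurable borel"
    and p: "0 < p" and s: "\<And>i. 0 < s i"
    and g: "\<And>x. 0 \<le> g x" and "0 < M" and "0 \<le> \<alpha>"
    and supp: "emeasure lborel {x. 0 < g x} \<le> ennreal \<alpha>"
  shows "ennreal (M powr p) * emeasure lborel {x. g x = M}
      \<le> ennreal (2 * 2 powr (p * CARD('n)) * (2 * \<alpha>) powr (p / (\<Sum>i\<in>UNIV. 1 / s i))) * aniso_energy p s g"
proof (cases "\<alpha> = 0")
  case True
  have "emeasure lborel {x. g x = M} \<le> emeasure lborel {x. 0 < g x}"
    using \<open>0 < M\<close> by (intro emeasure_mono) auto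
  with True supp show ?thesis by simp
next
  case False
  with \<open>0 \<le> \<alpha>\<close> have "0 < \<alpha>" by simp
  define \<Sigma> where "\<Sigma> = (\<Sum>i\<in>UNIV. 1 / s i)"
  have "0 < \<Sigma>" unfolding \<Sigma>_def using s by (intro sum_pos) auto
  define R where "R = (2 * \<alpha>) powr (1 / \<Sigma>)"
  define r where "r i = R powr (1 / s i)" for i
  have "0 < R" unfolding R_def using \<open>0 < \<alpha>\<close> by simp
  then have r: "0 < r i" for i unfolding r_def by simp
  have prod_r: "(\<Prod>i\<in>UNIV. r i) = 2 * \<alpha>"
  proof -
    have "(\<Prod>i\<in>UNIV. r i) = R powr \<Sigma>"
      unfolding r_def \<Sigma>_def using \<open>0 < R\<close> by (simp add: powr_sum)
    also have "\<dots> = 2 * \<alpha>"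
      unfolding R_def using \<open>0 < \<alpha>\<close> \<open>0 < \<Sigma>\<close> by (simp add: powr_powr)
    finally show ?thesis .
  qed
  define Q where "Q = {y :: real ^ 'n. \<forall>j. 0 < y $ j \<and> y $ j < r j}"
  have [measurable]: "Q \<in> sets borel" unfolding Q_def by measurable
  define \<omega> where "\<omega> i h = (\<integral>\<^sup>+x. ennreal (\<bar>g x - g (x + h *\<^sub>R axis i 1)\<bar> powr p) \<partial>lborel)" for i h
  have [measurable]: "\<omega> i \<in> borel_measurable borel" for i unfolding \<omega>_def by measurable
  define E where "E i = (\<integral>\<^sup>+x. \<integral>\<^sup>+h.
     ennreal (\<bar>g x - g (x + h *\<^sub>R axis i 1)\<bar> powr p / \<bar>h\<bar> powr (1 + s i * p)) \<partial>lborel \<partial>lborel)" for i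
  have Q: "emeasure lborel Q = ennreal (2 * \<alpha>)"
  proof -
    obtain i :: 'n where True by blast
    have "emeasure lborel Q = (\<integral>\<^sup>+y\<in>Q. 1 \<partial>lborel)" by simp
    also have "\<dots> = ennreal (\<Prod>j\<in>UNIV - {i}. r j) * ennreal (r i)"
      using nn_integral_box_coordinate[of "\<lambda>_. 1" r i] r by (simp add: Q_def less_imp_le)
    also have "\<dots> = ennreal (\<Prod>j\<in>UNIV. r j)"
      using r by (subst prod.remove[of UNIV i])
        (auto simp: ennreal_mult[symmetric] prod_nonneg less_imp_le mult.commute)
    finally show ?thesis by (simp add: prod_r)
  qed
  \<comment> \<open>the half of the box on which \<open>g (x + y)\<close> vanishes\<close>
  have lower: "ennreal (M powr p * \<alpha>) \<le> (\<integral>\<^sup>+y\<in>Q. ennreal (\<bar>g x - g (x + y)\<bar> powr p) \<partial>lborel)"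
    if "g x = M" for x
  proof -
    have "ennreal (M powr p * \<alpha>) + ennreal (M powr p * \<alpha>) = ennreal (M powr p) * emeasure lborel Q"
      using \<open>0 < \<alpha>\<close> by (simp add: Q ennreal_mult[symmetric] ennreal_plus[symmetric] del: ennreal_plus)
    also have "\<dots> = (\<integral>\<^sup>+y\<in>Q. ennreal (M powr p) \<partial>lborel)"
      by (simp add: nn_integral_cmult_indicator)
    also have "\<dots> \<le> (\<integral>\<^sup>+y. ennreal (\<bar>g x - g (x + y)\<bar> powr p) * indicator Q y
        + ennreal (M powr p) * indicator {z. 0 < g z} (y + x) \<partial>lborel)"
    proof (rule nn_integral_mono)
      fix y
      have "g (x + y) = 0" if "\<not> 0 < g (x + y)" using that g[of "x + y"] by simp
      then show "ennreal (M powr p) * indicator Q y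
          \<le> ennreal (\<bar>g x - g (x + y)\<bar> powr p) * indicator Q y
        + ennreal (M powr p) * indicator {z. 0 < g z} (y + x)"
        using \<open>g x = M\<close> \<open>0 < M\<close> by (auto simp: indicator_def add.commute)
    qed
    also have "\<dots> = (\<integral>\<^sup>+y\<in>Q. ennreal (\<bar>g x - g (x + y)\<bar> powr p) \<partial>lborel)
        + ennreal (M powr p) * emeasure lborel {z. 0 < g z}"
      by (subst nn_integral_add)
        (auto simp: nn_integral_cmult nn_integral_translate[of "\<lambda>y. indicator {z. 0 < g z} y"])
    also have "\<dots> \<le> (\<integral>\<^sup>+y\<in>Q. ennreal (\<bar>g x - g (x + y)\<bar> powr p) \<partial>lborel) + ennreal (M powr p * \<alpha>)"
      using supp \<open>0 < \<alpha>\<close> by (intro add_mono) (auto simp: ennreal_mult intro!: mult_left_mono)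
    finally show ?thesis
      by (simp add: add.commute ennreal_add_left_cancel_le)
  qed
  \<comment> \<open>here \<open>\<bar>h\<bar> powr (1 + s i * p) \<le> r i * R powr p\<close> for \<open>h\<close> in the \<open>i\<close>-th side\<close>
  have axis: "(\<integral>\<^sup>+y\<in>Q. \<omega> i (y $ i) \<partial>lborel) \<le> ennreal (2 * \<alpha> * R powr p) * E i" for i
  proof -
    have "(\<integral>\<^sup>+h\<in>{0<..<r i}. \<omega> i h \<partial>lborel)
        \<le> (\<integral>\<^sup>+h. ennreal (r i * R powr p) * (\<integral>\<^sup>+x. ennreal (\<bar>g x - g (x + h *\<^sub>R axis i 1)\<bar> powr p / \<bar>h\<bar> powr (1 + s i * p)) \<partial>lborel) \<partial>lborel)"
    proof (rule nn_integral_mono)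
      fix h :: real
      show "\<omega> i h * indicator {0<..<r i} h \<le> ennreal (r i * R powr p) * (\<integral>\<^sup>+x. ennreal (\<bar>g x - g (x + h *\<^sub>R axis i 1)\<bar> powr p / \<bar>h\<bar> powr (1 + s i * p)) \<partial>lborel)"
      proof (cases "h \<in> {0<..<r i}")
        case True
        have "r i powr (1 + s i * p) = r i * R powr p"
          using r[of i] s[of i] \<open>0 < R\<close> by (simp add: powr_add r_def powr_powr)
        then have h: "h powr (1 + s i * p) \<le> r i * R powr p"
          using True p s[of i] powr_mono2[of "1 + s i * p" h "r i"] by simp
        have "ennreal (\<bar>g x - g (x + h *\<^sub>R axis i 1)\<bar> powr p) \<le> ennreal (r i * R powr p)
          * ennreal (\<bar>g x - g (x + h *\<^sub>R axis i 1)\<bar> powr p / \<bar>h\<bar> powr (1 + s i * p))" for x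
        proof -
          have "\<bar>g x - g (x + h *\<^sub>R axis i 1)\<bar> powr p \<le> (r i * R powr p)
            * (\<bar>g x - g (x + h *\<^sub>R axis i 1)\<bar> powr p / \<bar>h\<bar> powr (1 + s i * p))"
            using True mult_right_mono[OF h, of "\<bar>g x - g (x + h *\<^sub>R axis i 1)\<bar> powr p"]
            by (simp add: field_simps)
          then show ?thesis
            using r[of i] by (simp add: ennreal_mult[symmetric] ennreal_leI)
        qed
        then have "\<omega> i h \<le> (\<integral>\<^sup>+x. ennreal (r i * R powr p)
          * ennreal (\<bar>g x - g (x + h *\<^sub>R axis i 1)\<bar> powr p / \<bar>h\<bar> powr (1 + s i * p)) \<partial>lborel)"
          unfolding \<omega>_def by (rule nn_integral_mono)
        also have "\<dots> = ennreal (r i * R powr p) * (\<integral>\<^sup>+x. ennreal (\<bar>g x - g (x + h *\<^sub>R axis i 1)\<bar> powr p / \<bar>h\<bar> powr (1 + s i * p)) \<partial>lborel)"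
          by (rule nn_integral_cmult) measurable
        finally show ?thesis
          using True by (simp only: indicator_simps mult_1_right)
      qed simp
    qed
    also have "\<dots> = ennreal (r i * R powr p) * E i"
    proof -
      have "(\<integral>\<^sup>+h. \<integral>\<^sup>+x. ennreal (\<bar>g x - g (x + h *\<^sub>R axis i 1)\<bar> powr p / \<bar>h\<bar> powr (1 + s i * p)) \<partial>lborel \<partial>lborel) = E i"
        unfolding E_def by (rule lborel_pair.Fubini') measurable
      then show ?thesis
        by (subst nn_integral_cmult) auto
    qed
    finally have "(\<integral>\<^sup>+y\<in>Q. \<omega> i (y $ i) \<partial>lborel)
        \<le> ennreal (\<Prod>j\<in>UNIV - {i}. r j) * (ennreal (r i * R powr p) * E i)"
      using nn_integral_box_coordinate[of "\<omega> i" r i] r unfolding Q_def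
      by (simp add: mult_left_mono)
    also have "\<dots> = ennreal ((\<Prod>j\<in>UNIV - {i}. r j) * (r i * R powr p)) * E i"
      using r by (subst ennreal_mult[of "prod r (UNIV - {i})"])
        (auto simp: prod_nonneg less_imp_le mult.assoc)
    also have "(\<Prod>j\<in>UNIV - {i}. r j) * (r i * R powr p) = (\<Prod>j\<in>UNIV. r j) * R powr p"
      using prod.remove[of UNIV i r] by simp
    finally show ?thesis by (simp add: prod_r)
  qed
  let ?c = "2 powr (p * CARD('n))"
  have "ennreal \<alpha> * (ennreal (M powr p) * emeasure lborel {x. g x = M})
      = (\<integral>\<^sup>+x. ennreal (M powr p * \<alpha>) * indicator {x. g x = M} x \<partial>lborel)"
    using \<open>0 < \<alpha>\<close> by (subst nn_integral_cmult_indicator) (auto simp: ennreal_mult mult.assoc mult.left_commute)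
  also have "\<dots> \<le> (\<integral>\<^sup>+x. (\<integral>\<^sup>+y\<in>Q. ennreal (\<bar>g x - g (x + y)\<bar> powr p) \<partial>lborel) \<partial>lborel)"
    using lower by (intro nn_integral_mono) (auto simp: indicator_def)
  also have "\<dots> = (\<integral>\<^sup>+y. \<integral>\<^sup>+x. ennreal (\<bar>g x - g (x + y)\<bar> powr p) * indicator Q y \<partial>lborel \<partial>lborel)"
    by (rule lborel_pair.Fubini') measurable
  also have "\<dots> \<le> (\<integral>\<^sup>+y. ennreal ?c * (\<Sum>i\<in>UNIV. \<omega> i (y $ i) * indicator Q y) \<partial>lborel)"
  proof (rule nn_integral_mono)
    fix y
    show "(\<integral>\<^sup>+x. ennreal (\<bar>g x - g (x + y)\<bar> powr p) * indicator Q y \<partial>lborel)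
        \<le> ennreal ?c * (\<Sum>i\<in>UNIV. \<omega> i (y $ i) * indicator Q y)"
      using difference_le_axis_differences[of g p y] p
      unfolding \<omega>_def by (auto simp: indicator_def)
  qed
  also have "\<dots> = ennreal ?c * (\<Sum>i\<in>UNIV. \<integral>\<^sup>+y\<in>Q. \<omega> i (y $ i) \<partial>lborel)"
  proof -
    have "(\<integral>\<^sup>+y. (\<Sum>i\<in>UNIV. \<omega> i (y $ i) * indicator Q y) \<partial>lborel)
        = (\<Sum>i\<in>UNIV. \<integral>\<^sup>+y\<in>Q. \<omega> i (y $ i) \<partial>lborel)"
      by (rule nn_integral_sum) measurable
    moreover have "(\<integral>\<^sup>+y. ennreal ?c * (\<Sum>i\<in>UNIV. \<omega> i (y $ i) * indicator Q y) \<partial>lborel)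
        = ennreal ?c * (\<integral>\<^sup>+y. (\<Sum>i\<in>UNIV. \<omega> i (y $ i) * indicator Q y) \<partial>lborel)"
      by (rule nn_integral_cmult) measurable
    ultimately show ?thesis by (simp only:)
  qed
  also have "\<dots> \<le> ennreal ?c * (\<Sum>i\<in>UNIV. ennreal (2 * \<alpha> * R powr p) * E i)"
    by (intro mult_left_mono sum_mono axis) auto
  also have "\<dots> = ennreal \<alpha> * (ennreal (2 * ?c * R powr p) * aniso_energy p s g)"
  proof -
    have "ennreal ?c * (ennreal (2 * \<alpha> * R powr p) * (\<Sum>i\<in>UNIV. E i))
        = ennreal (?c * (2 * \<alpha> * R powr p)) * (\<Sum>i\<in>UNIV. E i)"
      using \<open>0 < \<alpha>\<close> by (subst ennreal_mult[of ?c]) (auto simp: mult.assoc)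
    also have "?c * (2 * \<alpha> * R powr p) = \<alpha> * (2 * ?c * R powr p)" by simp
    also have "ennreal \<dots> * (\<Sum>i\<in>UNIV. E i) = ennreal \<alpha> * (ennreal (2 * ?c * R powr p) * (\<Sum>i\<in>UNIV. E i))"
      using \<open>0 < \<alpha>\<close> by (subst ennreal_mult[of \<alpha>]) (auto simp: mult.assoc)
    finally show ?thesis
      unfolding aniso_energy_def E_def by (simp only: sum_distrib_left)
  qed
  finally have "ennreal (M powr p) * emeasure lborel {x. g x = M}
      \<le> ennreal (2 * ?c * R powr p) * aniso_energy p s g"
    using \<open>0 < \<alpha>\<close> by (subst (asm) ennreal_mult_le_mult_iff) auto
  moreover have "R powr p = (2 * \<alpha>) powr (p / \<Sigma>)"
    unfolding R_def by (simp add: powr_powr)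
  ultimately show ?thesis by (simp add: \<Sigma>_def)
qed


text \<open>
  The part of \<open>a\<close> lying between the heights \<open>l\<close> and \<open>2 l\<close>.
\<close>

definition slice :: "real \<Rightarrow> real \<Rightarrow> real" where
  "slice l a = min (max (a - l) 0) l"

lemma slice_measurable [measurable]: "slice l \<in> borel_measurable borel"
  unfolding slice_def by measurable

lemma slice_mono: "a \<le> b \<Longrightarrow> slice l a \<le> slice l b"
  by (auto simp: slice_def)

lemma sum_slice:
  assumes "0 \<le> l"
  shows "(\<Sum>j<n. slice (l * 2 ^ j) a) = min (max (a - l) 0) (l * 2 ^ n - l)"
proof (induction n)
  case (Suc n)
  have "min (max (a - l) 0) (z - l) + slice z a = min (max (a - l) 0) (2 * z - l)"
    if "l \<le> z" for z
    using that assms unfolding slice_def by (auto simp: min_def max_def)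
  from this[of "l * 2 ^ n"] assms
  have "min (max (a - l) 0) (l * 2 ^ n - l) + slice (l * 2 ^ n) a
      = min (max (a - l) 0) (l * 2 ^ Suc n - l)"
    by (simp add: mult_le_cancel_left1 mult.left_commute)
  then show ?case
    by (simp only: sum.lessThan_Suc Suc.IH)
qed (use assms in auto)

lemma sum_powr_le_powr_sum:
  fixes t :: "'b \<Rightarrow> real"
  assumes "1 \<le> p" "finite F" "\<And>j. j \<in> F \<Longrightarrow> 0 \<le> t j"
  shows "(\<Sum>j\<in>F. t j powr p) \<le> (\<Sum>j\<in>F. t j) powr p"
proof -
  define S where "S = (\<Sum>j\<in>F. t j)"
  have "0 \<le> S" unfolding S_def using assms by (intro sum_nonneg) auto
  have "t j powr p \<le> t j * S powr (p - 1)" if "j \<in> F" for j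
  proof -
    have "t j powr p = t j * t j powr (p - 1)"
      using assms(3)[OF that] by (cases "t j = 0") (auto simp: powr_mult_base)
    also have "t j \<le> S"
      unfolding S_def using assms that by (intro member_le_sum) auto
    then have "t j * t j powr (p - 1) \<le> t j * S powr (p - 1)"
      using assms(1) assms(3)[OF that] by (intro mult_left_mono powr_mono2) auto
    finally show ?thesis .
  qed
  then have "(\<Sum>j\<in>F. t j powr p) \<le> (\<Sum>j\<in>F. t j * S powr (p - 1))"
    by (rule sum_mono)
  also have "\<dots> = S * S powr (p - 1)"
    unfolding S_def by (rule sum_distrib_right[symmetric])
  also have "\<dots> = S powr p"
    using \<open>0 \<le> S\<close> by (cases "S = 0") (auto simp: powr_mult_base)
  finally show ?thesis by (simp add: S_def)
qed

text \<open>
  The slices are monotone and add up to a function with Lipschitz constant 1, and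
  \<open>\<Sum> t\<^sub>j\<^sup>p \<le> (\<Sum> t\<^sub>j)\<^sup>p\<close> for \<open>p \<ge> 1\<close>.
\<close>

lemma sum_slice_difference_powr_le:
  assumes "1 \<le> p" "0 \<le> l"
  shows "(\<Sum>j<n. \<bar>slice (l * 2 ^ j) a - slice (l * 2 ^ j) b\<bar> powr p) \<le> \<bar>a - b\<bar> powr p"
proof (induction a b rule: linorder_wlog)
  case (le a b)
  let ?T = "\<lambda>j. slice (l * 2 ^ j)"
  have mono: "?T j a \<le> ?T j b" for j using le by (rule slice_mono)
  have "(\<Sum>j<n. \<bar>?T j a - ?T j b\<bar>) = (\<Sum>j<n. ?T j b) - (\<Sum>j<n. ?T j a)"
    using mono unfolding sum_subtractf[symmetric] by (intro sum.cong) auto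
  also have "\<dots> \<le> \<bar>a - b\<bar>"
    unfolding sum_slice[OF assms(2)] using le by (auto simp: min_def max_def)
  finally have "(\<Sum>j<n. \<bar>?T j a - ?T j b\<bar>) powr p \<le> \<bar>a - b\<bar> powr p"
    using assms by (intro powr_mono2 sum_nonneg) auto
  moreover have "(\<Sum>j<n. \<bar>?T j a - ?T j b\<bar> powr p) \<le> (\<Sum>j<n. \<bar>?T j a - ?T j b\<bar>) powr p"
    using assms by (intro sum_powr_le_powr_sum) auto
  ultimately show ?case by linarith
qed (simp add: abs_minus_commute)

lemma sum_slice_energy_le:
  fixes f :: "real ^ 'n::finite \<Rightarrow> real"
  assumes [measurable]: "f \<in> borel_measurable borel" and "1 \<le> p" "0 \<le> l"
  shows "(\<Sum>j<n. aniso_energy p s (\<lambda>x. slice (l * 2 ^ j) (f x))) \<le> aniso_energy p s f"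
proof -
  let ?d = "\<lambda>j i x h. \<bar>slice (l * 2 ^ j) (f x) - slice (l * 2 ^ j) (f (x + h *\<^sub>R axis i 1))\<bar> powr p"
  have "(\<Sum>j<n. aniso_energy p s (\<lambda>x. slice (l * 2 ^ j) (f x)))
      = (\<Sum>i\<in>UNIV. \<integral>\<^sup>+x. \<integral>\<^sup>+h. (\<Sum>j<n. ennreal (?d j i x h / \<bar>h\<bar> powr (1 + s i * p))) \<partial>lborel \<partial>lborel)"
    unfolding aniso_energy_def by (subst sum.swap) (simp add: nn_integral_sum del: sum_ennreal)
  also have "\<dots> \<le> aniso_energy p s f"
    unfolding aniso_energy_def
  proof (intro sum_mono nn_integral_mono)
    fix i :: 'n and x and h :: real
    have "(\<Sum>j<n. ?d j i x h / \<bar>h\<bar> powr (1 + s i * p)) \<le> \<bar>f x - f (x + h *\<^sub>R axis i 1)\<bar> powr p / \<bar>h\<bar> powr (1 + s i * p)"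
      unfolding sum_divide_distrib[symmetric]
      using assms by (intro divide_right_mono sum_slice_difference_powr_le) auto
    then show "(\<Sum>j<n. ennreal (?d j i x h / \<bar>h\<bar> powr (1 + s i * p)))
        \<le> ennreal (\<bar>f x - f (x + h *\<^sub>R axis i 1)\<bar> powr p / \<bar>h\<bar> powr (1 + s i * p))"
      by (simp add: sum_ennreal ennreal_leI)
  qed
  finally show ?thesis .
qed

text \<open>
  Here \<open>a j\<close> is the measure of the set above height \<open>l 2\<^sup>j\<close> and \<open>e j\<close> the energy of the \<open>j\<close>-th slice.
  Since \<open>P - p = P \<theta>\<close>, the level estimates bound the sum \<open>S\<close> on the left by a boundary term plus a
  multiple of \<open>S powr \<theta>\<close>, and \<open>\<theta> < 1\<close> lets \<open>S\<close> be absorbed. The boundary term carries a positive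
  power of \<open>l\<close> and disappears as \<open>l\<close> tends to zero.
\<close>

lemma dyadic_sum_bound:
  fixes a e :: "nat \<Rightarrow> real"
  assumes "0 < l" "0 \<le> C" "0 \<le> c" "0 < \<theta>" "\<theta> < 1" "0 < p" and P: "P = p / (1 - \<theta>)"
    and a: "\<And>j. 0 \<le> a j" and e: "\<And>j. 0 \<le> e j"
    and step: "\<And>j. j < n \<Longrightarrow> (l * 2 ^ j) powr p * a (Suc j) \<le> C * a j powr \<theta> * e j"
    and sum_e: "(\<Sum>j<n. e j) \<le> c"
    and a0: "l powr p * a 0 \<le> I"
  shows "(\<Sum>j\<le>n. (l * 2 ^ j) powr P * a j)
    \<le> 2 * l powr (P - p) * I + (2 powr (P + 1) * C * c) powr (1 / (1 - \<theta>))"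
proof -
  define S where "S = (\<Sum>j\<le>n. (l * 2 ^ j) powr P * a j)"
  have "0 \<le> S" unfolding S_def using a by (intro sum_nonneg) auto
  have P\<theta>: "P - p = P * \<theta>" using \<open>\<theta> < 1\<close> unfolding P by (simp add: field_simps)
  have next_level: "(l * 2 ^ Suc j) powr P * a (Suc j) \<le> 2 powr P * (C * S powr \<theta> * e j)" if "j < n" for j
  proof -
    have "(l * 2 ^ j) powr P * a j \<le> S"
      unfolding S_def using a that by (intro member_le_sum) auto
    then have le_S: "((l * 2 ^ j) powr P * a j) powr \<theta> \<le> S powr \<theta>"
      using a \<open>0 < \<theta>\<close> by (intro powr_mono2) auto
    have "(l * 2 ^ j) powr P * a (Suc j) = (l * 2 ^ j) powr (P * \<theta>) * ((l * 2 ^ j) powr p * a (Suc j))"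
      using P\<theta>[symmetric] by (simp add: mult.assoc[symmetric] powr_add[symmetric])
    also have "\<dots> \<le> (l * 2 ^ j) powr (P * \<theta>) * (C * a j powr \<theta> * e j)"
      using step[OF that] by (intro mult_left_mono) auto
    also have "\<dots> = C * ((l * 2 ^ j) powr P * a j) powr \<theta> * e j"
      using a by (simp add: powr_mult powr_powr)
    also have "\<dots> \<le> C * S powr \<theta> * e j"
      using le_S \<open>0 \<le> C\<close> e by (intro mult_right_mono mult_left_mono) auto
    finally have "(l * 2 ^ j) powr P * a (Suc j) \<le> C * S powr \<theta> * e j" .
    moreover have "(l * 2 ^ Suc j) powr P = 2 powr P * (l * 2 ^ j) powr P"
      using \<open>0 < l\<close> by (simp add: powr_mult mult.left_commute)
    ultimately show ?thesis by (simp add: mult.assoc)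
  qed
  have "S = l powr P * a 0 + (\<Sum>j<n. (l * 2 ^ Suc j) powr P * a (Suc j))"
    unfolding S_def by (subst sum.atMost_shift) simp
  also have "l powr P * a 0 = l powr (P - p) * (l powr p * a 0)"
    by (simp add: mult.assoc[symmetric] powr_add[symmetric])
  also have "\<dots> \<le> l powr (P - p) * I"
    using a0 by (intro mult_left_mono) auto
  also have "(\<Sum>j<n. (l * 2 ^ Suc j) powr P * a (Suc j)) \<le> (\<Sum>j<n. 2 powr P * (C * S powr \<theta> * e j))"
    using next_level by (intro sum_mono) auto
  also have "\<dots> = 2 powr P * C * S powr \<theta> * (\<Sum>j<n. e j)"
    by (simp add: sum_distrib_left mult.assoc)
  also have "\<dots> \<le> 2 powr P * C * S powr \<theta> * c"
    using sum_e \<open>0 \<le> C\<close> by (intro mult_left_mono) auto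
  finally have main: "S \<le> l powr (P - p) * I + 2 powr P * C * S powr \<theta> * c" by simp
  have nonneg: "0 \<le> l powr (P - p) * I"
    using a0 a[of 0] by (intro mult_nonneg_nonneg) (auto intro: order_trans[OF _ a0])
  show ?thesis
  proof (cases "S \<le> 2 * l powr (P - p) * I")
    case True
    then show ?thesis unfolding S_def[symmetric] by (simp add: add_increasing2)
  next
    case False
    then have "0 < S" using nonneg by linarith
    have "S powr (1 - \<theta>) * S powr \<theta> = S"
      using \<open>0 < S\<close> by (simp add: powr_add[symmetric])
    also have "S \<le> 2 * (2 powr P * C * S powr \<theta> * c)" using main False by linarith
    also have "\<dots> = 2 powr (P + 1) * C * c * S powr \<theta>"
      by (simp add: powr_add)
    finally have "S powr (1 - \<theta>) \<le> 2 powr (P + 1) * C * c"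
      using \<open>0 < S\<close> by simp
    then have "(S powr (1 - \<theta>)) powr (1 / (1 - \<theta>)) \<le> (2 powr (P + 1) * C * c) powr (1 / (1 - \<theta>))"
      using \<open>\<theta> < 1\<close> by (intro powr_mono2) auto
    then have "S \<le> (2 powr (P + 1) * C * c) powr (1 / (1 - \<theta>))"
      using \<open>0 < S\<close> \<open>\<theta> < 1\<close> by (simp add: powr_powr)
    with nonneg show ?thesis unfolding S_def[symmetric] by simp
  qed
qed

text \<open>
  The integral of \<open>f\<^sup>P\<close> over the region \<open>l < f \<le> 2\<^sup>n\<^sup>+\<^sup>1 l\<close> is at most a multiple of the dyadic sum;
  then \<open>l\<close> tends to 0 and \<open>2\<^sup>n l\<close> to infinity. Integrability of \<open>f\<^sup>p\<close> makes the measures of the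
  level sets finite and the boundary term vanish in the limit.
\<close>

theorem aniso_sobolev:
  fixes s :: "'n::finite \<Rightarrow> real" and p \<theta> P :: real
  assumes p: "1 \<le> p" and s: "\<And>i. 0 < s i"
    and \<theta>: "\<theta> = p / (\<Sum>i\<in>UNIV. 1 / s i)" "\<theta> < 1" and P: "P = p / (1 - \<theta>)"
  obtains K where "0 \<le> K"
    and "\<And>(f :: real ^ 'n \<Rightarrow> real) c. f \<in> borel_measurable borel \<Longrightarrow> (\<And>x. 0 \<le> f x) \<Longrightarrow>
      (\<integral>\<^sup>+x. ennreal (f x powr p) \<partial>lborel) < \<infinity> \<Longrightarrow> 0 \<le> c \<Longrightarrow> aniso_energy p s f \<le> ennreal c \<Longrightarrow>
      (\<integral>\<^sup>+x. ennreal (f x powr P) \<partial>lborel) \<le> ennreal (K * c powr (1 / (1 - \<theta>)))"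
proof -
  define C where "C = 2 * 2 powr (p * CARD('n)) * 2 powr \<theta>"
  define K where "K = 2 powr P * (2 powr (P + 1) * C) powr (1 / (1 - \<theta>))"
  have "0 \<le> C" unfolding C_def by simp
  have "0 < \<theta>" unfolding \<theta> using p s by (intro divide_pos_pos sum_pos) auto
  have "0 < P" unfolding P using p \<theta> by simp
  have "p < P" unfolding P using p \<open>0 < \<theta>\<close> \<theta>(2) by (simp add: field_simps)
  have "(\<integral>\<^sup>+x. ennreal (f x powr P) \<partial>lborel) \<le> ennreal (K * c powr (1 / (1 - \<theta>)))"
    if [measurable]: "f \<in> borel_measurable borel" and f: "\<And>x. 0 \<le> f x"
      and fin: "(\<integral>\<^sup>+x. ennreal (f x powr p) \<partial>lborel) < \<infinity>"
      and "0 \<le> c" and energy: "aniso_energy p s f \<le> ennreal c"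
    for f :: "real ^ 'n \<Rightarrow> real" and c
  proof -
    obtain I where "0 \<le> I" and I: "(\<integral>\<^sup>+x. ennreal (f x powr p) \<partial>lborel) = ennreal I"
      using fin by (cases "\<integral>\<^sup>+x. ennreal (f x powr p) \<partial>lborel") auto
    have markov: "ennreal (l powr p) * emeasure lborel {x. l < f x} \<le> ennreal I" if "0 < l" for l
    proof -
      have "ennreal (l powr p) * emeasure lborel {x. l < f x}
          = (\<integral>\<^sup>+x. ennreal (l powr p) * indicator {x. l < f x} x \<partial>lborel)"
        by (subst nn_integral_cmult_indicator) auto
      also have "\<dots> \<le> (\<integral>\<^sup>+x. ennreal (f x powr p) \<partial>lborel)"
        using that p by (intro nn_integral_mono) (auto simp: indicator_def intro!: ennreal_leI powr_mono2)
      finally show ?thesis by (simp add: I)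
    qed
    have finite: "emeasure lborel {x. l < f x} = ennreal (measure lborel {x. l < f x})" if "0 < l" for l
    proof (rule emeasure_eq_ennreal_measure)
      show "emeasure lborel {x. l < f x} \<noteq> top"
        using markov[OF that] that by (auto simp: ennreal_mult_top top_unique)
    qed
    have bound: "(\<integral>\<^sup>+x\<in>{x. l < f x \<and> f x \<le> l * 2 ^ Suc n}. ennreal (f x powr P) \<partial>lborel)
        \<le> ennreal (2 powr P * (2 * l powr (P - p) * I + (2 powr (P + 1) * C * c) powr (1 / (1 - \<theta>))))"
      if "0 < l" for l n
    proof -
      define a where "a j = measure lborel {x. l * 2 ^ j < f x}" for j
      define T where "T j x = slice (l * 2 ^ j) (f x)" for j x
      have [measurable]: "T j \<in> borel_measurable borel" for j unfolding T_def by measurable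
      have energies: "(\<Sum>j<m. aniso_energy p s (T j)) \<le> ennreal c" for m
        using sum_slice_energy_le[where f = f and p = p and l = l and n = m and s = s] energy p \<open>0 < l\<close> unfolding T_def by auto
      have "aniso_energy p s (T j) \<le> ennreal c" for j
        using energies[of "Suc j"] by (simp add: order_trans[rotated])
      then have e: "aniso_energy p s (T j) = ennreal (enn2real (aniso_energy p s (T j)))" for j
        by (metis ennreal_enn2real ennreal_less_top le_less_trans)
      have "(l * 2 ^ j) powr p * a (Suc j) \<le> C * a j powr \<theta> * enn2real (aniso_energy p s (T j))" for j
      proof -
        have "ennreal ((l * 2 ^ j) powr p * a (Suc j))
            \<le> ennreal ((l * 2 ^ j) powr p) * emeasure lborel {x. T j x = l * 2 ^ j}"
        proof -
          have "{x. l * 2 ^ Suc j < f x} \<subseteq> {x. T j x = l * 2 ^ j}"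
            unfolding T_def slice_def by auto
          then have "emeasure lborel {x. l * 2 ^ Suc j < f x} \<le> emeasure lborel {x. T j x = l * 2 ^ j}"
            by (intro emeasure_mono) auto
          then show ?thesis
            using \<open>0 < l\<close> unfolding a_def
            by (simp add: ennreal_mult finite[symmetric] mult_left_mono)
        qed
        also have "\<dots> \<le> ennreal (2 * 2 powr (p * CARD('n)) * (2 * a j) powr (p / (\<Sum>i\<in>UNIV. 1 / s i)))
            * aniso_energy p s (T j)"
        proof (rule level_set_estimate)
          have "{x. 0 < T j x} \<subseteq> {x. l * 2 ^ j < f x}"
            using \<open>0 < l\<close> unfolding T_def slice_def by auto
          then have "emeasure lborel {x. 0 < T j x} \<le> emeasure lborel {x. l * 2 ^ j < f x}"
            by (intro emeasure_mono) auto
          then show "emeasure lborel {x. 0 < T j x} \<le> ennreal (a j)"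
            unfolding a_def using finite \<open>0 < l\<close> by simp
        qed (use \<open>0 < l\<close> p s in \<open>auto simp: T_def slice_def a_def\<close>)
        also have "\<dots> = ennreal (C * a j powr \<theta> * enn2real (aniso_energy p s (T j)))"
          unfolding \<theta>(1)[symmetric] C_def
          by (subst e) (simp add: ennreal_mult[symmetric] powr_mult a_def)
        finally show ?thesis
          using \<open>0 \<le> C\<close> by (subst (asm) ennreal_le_iff) auto
      qed
      moreover have "(\<Sum>j<n. enn2real (aniso_energy p s (T j))) \<le> c"
        using energies[of n] \<open>0 \<le> c\<close> by (subst (asm) e) (simp add: sum_ennreal)
      moreover have "l powr p * a 0 \<le> I"
        using markov[OF \<open>0 < l\<close>] \<open>0 \<le> I\<close> finite[OF \<open>0 < l\<close>] unfolding a_def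
        by (simp add: ennreal_mult[symmetric])
      ultimately have sum: "(\<Sum>j\<le>n. (l * 2 ^ j) powr P * a j)
          \<le> 2 * l powr (P - p) * I + (2 powr (P + 1) * C * c) powr (1 / (1 - \<theta>))"
        using \<open>0 < l\<close> \<open>0 \<le> C\<close> \<open>0 \<le> c\<close> \<open>0 < \<theta>\<close> \<theta>(2) p P
        by (intro dyadic_sum_bound[where e = "\<lambda>j. enn2real (aniso_energy p s (T j))"]) (auto simp: a_def)
      have "(\<integral>\<^sup>+x\<in>{x. l < f x \<and> f x \<le> l * 2 ^ Suc n}. ennreal (f x powr P) \<partial>lborel)
          \<le> (\<integral>\<^sup>+x. (\<Sum>j\<le>n. ennreal ((l * 2 ^ Suc j) powr P) * indicator {x. l * 2 ^ j < f x} x) \<partial>lborel)"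
      proof (rule nn_integral_mono)
        fix x
        show "ennreal (f x powr P) * indicator {x. l < f x \<and> f x \<le> l * 2 ^ Suc n} x
          \<le> (\<Sum>j\<le>n. ennreal ((l * 2 ^ Suc j) powr P) * indicator {x. l * 2 ^ j < f x} x)"
        proof (cases "l < f x \<and> f x \<le> l * 2 ^ Suc n")
          case True
          \<comment> \<open>the dyadic range \<open>l * 2 ^ k < f x \<le> l * 2 ^ Suc k\<close> of the value at \<open>x\<close>\<close>
          define k where "k = (LEAST k. f x \<le> l * 2 ^ Suc k)"
          have k: "f x \<le> l * 2 ^ Suc k" and "k \<le> n"
            unfolding k_def using True by (auto intro: LeastI Least_le)
          have "l * 2 ^ k < f x"
          proof (cases k)
            case (Suc k')
            then have "\<not> f x \<le> l * 2 ^ Suc k'"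
              unfolding k_def by (intro not_less_Least) simp
            with Suc show ?thesis by simp
          qed (use True in simp)
          then have "ennreal (f x powr P) \<le> ennreal ((l * 2 ^ Suc k) powr P) * indicator {x. l * 2 ^ k < f x} x"
            using k f[of x] \<open>0 < P\<close> by (auto intro!: ennreal_leI powr_mono2)
          also have "\<dots> \<le> (\<Sum>j\<le>n. ennreal ((l * 2 ^ Suc j) powr P) * indicator {x. l * 2 ^ j < f x} x)"
            using \<open>k \<le> n\<close> by (intro member_le_sum) auto
          finally show ?thesis using True by simp
        qed simp
      qed
      also have "\<dots> = (\<Sum>j\<le>n. ennreal ((l * 2 ^ Suc j) powr P) * emeasure lborel {x. l * 2 ^ j < f x})"
        by (subst nn_integral_sum) (auto intro!: sum.cong nn_integral_cmult_indicator)
      also have "\<dots> = (\<Sum>j\<le>n. ennreal (2 powr P * ((l * 2 ^ j) powr P * a j)))"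
      proof (rule sum.cong)
        fix j
        have "(l * 2 ^ Suc j) powr P = 2 powr P * (l * 2 ^ j) powr P"
          using \<open>0 < l\<close> by (simp add: powr_mult mult.left_commute)
        then show "ennreal ((l * 2 ^ Suc j) powr P) * emeasure lborel {x. l * 2 ^ j < f x}
            = ennreal (2 powr P * ((l * 2 ^ j) powr P * a j))"
          using \<open>0 < l\<close> finite[of "l * 2 ^ j"] unfolding a_def
          by (simp add: ennreal_mult[symmetric] mult.assoc del: power_Suc)
      qed simp
      also have "\<dots> = ennreal (2 powr P * (\<Sum>j\<le>n. (l * 2 ^ j) powr P * a j))"
        by (subst sum_ennreal) (auto simp: a_def sum_distrib_left)
      also have "\<dots> \<le> ennreal (2 powr P * (2 * l powr (P - p) * I + (2 powr (P + 1) * C * c) powr (1 / (1 - \<theta>))))"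
        using sum by (intro ennreal_leI mult_left_mono) auto
      finally show ?thesis .
    qed
    \<comment> \<open>heights from \<open>L m = 2\<^sup>-\<^sup>m\<close> up to \<open>2\<^sup>m\<^sup>+\<^sup>1\<close>\<close>
    define L where "L m = (1 / 2 :: real) ^ m" for m :: nat
    define A where "A m = {x. L m < f x \<and> f x \<le> L m * 2 ^ Suc (2 * m)}" for m
    have [measurable]: "A m \<in> sets borel" for m unfolding A_def by measurable
    have Lpos: "0 < L m" for m unfolding L_def by simp
    have L2: "L m * 2 ^ Suc (2 * m) = 2 * 2 ^ m" for m
      unfolding L_def by (simp add: power_mult power_one_over field_simps power2_eq_square power_mult_distrib[symmetric])
    have "(\<lambda>m. \<integral>\<^sup>+x\<in>A m. ennreal (f x powr P) \<partial>lborel) \<longlonglongrightarrow> (\<integral>\<^sup>+x. ennreal (f x powr P) \<partial>lborel)"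
    proof (rule nn_integral_LIMSEQ)
      show "incseq (\<lambda>m x. ennreal (f x powr P) * indicator (A m) x)"
      proof (intro incseq_SucI le_funI mult_left_mono)
        fix m x
        have "L (Suc m) \<le> L m" unfolding L_def by simp
        then have "A m \<subseteq> A (Suc m)" unfolding A_def L2 by (auto intro: order_trans)
        then show "indicator (A m) x \<le> (indicator (A (Suc m)) x :: ennreal)"
          by (auto simp: indicator_def)
      qed simp
      show "(\<lambda>m. ennreal (f x powr P) * indicator (A m) x) \<longlonglongrightarrow> ennreal (f x powr P)" for x
      proof (cases "f x = 0")
        case False
        then have "0 < f x" using f[of x] by simp
        have "(\<lambda>m. L m) \<longlonglongrightarrow> 0" unfolding L_def by (rule LIMSEQ_power_zero) simp
        then have "eventually (\<lambda>m. L m < f x) sequentially"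
          using \<open>0 < f x\<close> by (rule order_tendstoD)
        moreover have "eventually (\<lambda>m. f x \<le> 2 * 2 ^ m) sequentially"
        proof -
          obtain M where "f x < 2 ^ M" using real_arch_pow[of 2 "f x"] by auto
          then have "f x \<le> 2 * 2 ^ m" if "M \<le> m" for m
            using that power_increasing[of M m "2::real"] f[of x] by (smt (verit) zero_less_power)
          then show ?thesis by (auto simp: eventually_sequentially)
        qed
        ultimately have "eventually (\<lambda>m. ennreal (f x powr P) * indicator (A m) x = ennreal (f x powr P)) sequentially"
          unfolding A_def L2 by eventually_elim simp
        then show ?thesis by (rule tendsto_eventually)
      qed simp
    qed measurable
    moreover have "(\<lambda>m. ennreal (2 powr P * (2 * L m powr (P - p) * I + (2 powr (P + 1) * C * c) powr (1 / (1 - \<theta>)))))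
        \<longlonglongrightarrow> ennreal (2 powr P * (2 * 0 * I + (2 powr (P + 1) * C * c) powr (1 / (1 - \<theta>))))"
    proof (intro tendsto_ennrealI tendsto_intros)
      have "(\<lambda>m. L m) \<longlonglongrightarrow> 0" unfolding L_def by (rule LIMSEQ_power_zero) simp
      then show "(\<lambda>m. L m powr (P - p)) \<longlonglongrightarrow> 0"
        using \<open>p < P\<close> Lpos by (intro tendsto_zero_powrI[OF _ tendsto_const]) (auto simp: less_imp_le)
    qed
    ultimately have "(\<integral>\<^sup>+x. ennreal (f x powr P) \<partial>lborel)
        \<le> ennreal (2 powr P * (2 * 0 * I + (2 powr (P + 1) * C * c) powr (1 / (1 - \<theta>))))"
      by (rule LIMSEQ_le) (use bound[OF Lpos] in \<open>auto simp: A_def\<close>)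
    also have "\<dots> = ennreal (K * c powr (1 / (1 - \<theta>)))"
      using \<open>0 \<le> C\<close> \<open>0 \<le> c\<close> unfolding K_def by (simp add: powr_mult mult.assoc)
    finally show ?thesis .
  qed
  moreover have "0 \<le> K" unfolding K_def by simp
  ultimately show ?thesis using that by blast
qed

section \<open>The pointwise Caccioppoli inequality\<close>

definition flux :: "real \<Rightarrow> real \<Rightarrow> real" where
  "flux m d = \<bar>d\<bar> powr (m - 2) * d"

lemma flux_minus: "flux m (- d) = - flux m d"
  by (simp add: flux_def)

lemma flux_nonneg_eq: "0 \<le> d \<Longrightarrow> flux m d = d powr (m - 1)"
  using powr_mult_base[of d "m - 2"] by (cases "d = 0") (auto simp: flux_def mult.commute)

lemma flux_nonneg: "0 \<le> d \<Longrightarrow> 0 \<le> flux m d"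
  by (simp add: flux_def)

lemma abs_flux: "\<bar>flux m d\<bar> = \<bar>d\<bar> powr (m - 1)"
  using flux_nonneg_eq[of "\<bar>d\<bar>" m] by (simp add: flux_def abs_mult)

lemma powr_difference_le:
  fixes a b :: real
  assumes "1 \<le> Q" "0 \<le> a" "a \<le> b"
  shows "b powr Q - a powr Q \<le> Q * b powr (Q - 1) * (b - a)"
proof (cases "a = b")
  case False
  with assms have "a < b" by simp
  have "continuous_on {a..b} (\<lambda>x. x powr Q)"
    by (intro continuous_on_powr' continuous_intros) (use assms in auto)
  moreover have "((\<lambda>x. x powr Q) has_derivative (*) (Q * x powr (Q - 1))) (at x)" if "a < x" for x
    using has_real_derivative_powr[of x Q] that assms by (simp add: has_field_derivative_def)
  ultimately obtain z where z: "a < z" "z < b" "b powr Q - a powr Q = Q * z powr (Q - 1) * (b - a)"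
    using mvt[OF \<open>a < b\<close>, of "\<lambda>x. x powr Q" "\<lambda>x. (*) (Q * x powr (Q - 1))"] by blast
  have "z powr (Q - 1) \<le> b powr (Q - 1)"
    using z assms by (intro powr_mono2) auto
  then show ?thesis
    unfolding z(3) using assms by (intro mult_right_mono mult_left_mono) auto
qed simp

lemma abs_powr_difference_le:
  fixes a b :: real
  assumes "1 \<le> Q" "0 \<le> a" "a \<le> 1" "0 \<le> b" "b \<le> 1"
  shows "\<bar>a powr Q - b powr Q\<bar> \<le> Q * \<bar>a - b\<bar>"
  using assms
proof (induction a b rule: linorder_wlog)
  case (le a b)
  have "b powr Q - a powr Q \<le> Q * b powr (Q - 1) * (b - a)"
    using le by (intro powr_difference_le) auto
  also have "\<dots> \<le> Q * 1 * (b - a)"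
    using le by (intro mult_right_mono mult_left_mono powr_le1) auto
  finally show ?case
    using le powr_mono2[of Q a b] by simp
qed (simp add: abs_minus_commute)

lemma powr_antimono_exponent:
  fixes x :: real
  assumes "0 \<le> x" "x \<le> 1" "m \<le> Q" "0 < m"
  shows "x powr Q \<le> x powr m"
  using assms by (cases "x = 0") (auto intro: powr_mono')

text \<open>
  With \<open>w\<close>, \<open>v\<close> the truncations at the two points and \<open>\<phi>\<close>, \<open>\<psi>\<close> the values of the cut-off there.
  By symmetry \<open>B \<le> A\<close>. If the cut-off is larger at the point where \<open>u\<close> is larger, the flux term
  alone suffices. Otherwise \<open>\<psi> = \<phi> + \<delta>\<close>: if \<open>v = 0\<close>, then \<open>\<psi>\<^sup>Q\<close> is compared with \<open>\<phi>\<^sup>Q + \<delta>\<^sup>Q\<close>, and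
  if \<open>v > 0\<close> the defect \<open>w (\<psi>\<^sup>Q - \<phi>\<^sup>Q)\<close> is at most \<open>Q w \<psi>\<^sup>Q\<^sup>-\<^sup>1 \<delta>\<close>, which is either half of the left-hand
  side or dominated by the error term, according to which of \<open>(w - v) \<psi>\<close> and \<open>2 Q w \<delta>\<close> is larger.
\<close>

lemma caccioppoli_weighted_increment:
  fixes A B k \<phi> \<psi> :: real
  defines "w \<equiv> max (A - k) 0" and "v \<equiv> max (B - k) 0"
  assumes m: "1 < m" "m \<le> Q"
    and \<phi>: "0 \<le> \<phi>" "\<phi> \<le> 1" and \<psi>: "0 \<le> \<psi>" "\<psi> \<le> 1"
  shows "\<bar>w - v\<bar> powr m * max \<phi> \<psi> powr Q
    \<le> 2 powr Q * (flux m (A - B) * (w * \<phi> powr Q - v * \<psi> powr Q) + (2 * Q) powr m * (max w v * \<bar>\<phi> - \<psi>\<bar>) powr m)"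
  using \<phi> \<psi> unfolding w_def v_def
proof (induction B A arbitrary: \<phi> \<psi> rule: linorder_wlog)
  case (le B A)
  define w v e d \<delta> where "w = max (A - k) 0" and "v = max (B - k) 0" and "e = w - v" and "d = A - B"
    and "\<delta> = \<bar>\<phi> - \<psi>\<bar>"
  note \<phi> = le(2,3) and \<psi> = le(4,5)
  have 0: "0 \<le> v" "v \<le> w" "0 \<le> e" "e \<le> w" "e \<le> d" "0 \<le> d" "0 \<le> w" "0 \<le> \<delta>" "\<delta> \<le> 1"
    using le(1) \<phi> \<psi> unfolding w_def v_def e_def d_def \<delta>_def by auto
  define J where "J = flux m d * (w * \<phi> powr Q - v * \<psi> powr Q)"
  define X where "X = e powr m * max \<phi> \<psi> powr Q"
  define Y where "Y = (2 * Q) powr m * (w * \<delta>) powr m"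
  have Q: "1 \<le> 2 powr Q" "1 \<le> (2 * Q) powr m" "1 < Q"
    using m by (auto intro: ge_one_powr_ge_zero)
  have "0 \<le> X" "0 \<le> Y" unfolding X_def Y_def by auto
  have fl: "flux m d = d powr (m - 1)" using 0 by (intro flux_nonneg_eq) auto
  have ed: "e powr (m - 1) \<le> d powr (m - 1)" using 0 m by (intro powr_mono2) auto
  have ee: "e powr m = e powr (m - 1) * e"
    using 0 m powr_mult_base[of e "m - 1"] by (cases "e = 0") (auto simp: mult.commute)
  have "X \<le> 2 powr Q * (J + Y)"
  proof (cases "\<psi> \<le> \<phi>")
    case True
    have "e * \<phi> powr Q \<le> w * \<phi> powr Q - v * \<psi> powr Q"
    proof -
      have "v * \<psi> powr Q \<le> v * \<phi> powr Q"
        using True 0 \<psi> m by (intro mult_left_mono powr_mono2) auto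
      then show ?thesis unfolding e_def by (simp add: algebra_simps)
    qed
    then have "e powr (m - 1) * (e * \<phi> powr Q) \<le> J"
      unfolding J_def fl using ed 0 by (intro mult_mono) auto
    then have "X \<le> J" unfolding X_def ee using True by (simp add: max_absorb1 mult.assoc)
    with \<open>0 \<le> X\<close> \<open>0 \<le> Y\<close> Q(1) have "1 * X \<le> 2 powr Q * (J + Y)" by (intro mult_mono) auto
    then show ?thesis by simp
  next
    case False
    then have \<delta>: "\<psi> = \<phi> + \<delta>" and max: "max \<phi> \<psi> = \<psi>" unfolding \<delta>_def by auto
    show ?thesis
    proof (cases "v = 0")
      case True
      then have "e = w" unfolding e_def by simp
      have J: "e powr m * \<phi> powr Q \<le> J"
        unfolding J_def fl ee True using ed \<open>e = w\<close> 0 by (auto intro!: mult_mono simp: mult.assoc)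
      have "\<psi> powr Q \<le> 2 powr Q * (\<phi> powr Q + \<delta> powr Q)"
        using abs_add_powr_le[of Q \<phi> \<delta>] \<phi> \<delta> 0 m by simp
      also have "\<dots> \<le> 2 powr Q * (\<phi> powr Q + \<delta> powr m)"
        using powr_antimono_exponent[of \<delta> m Q] 0 m by (intro mult_left_mono add_left_mono) auto
      finally have "X \<le> e powr m * (2 powr Q * (\<phi> powr Q + \<delta> powr m))"
        unfolding X_def max by (intro mult_left_mono) auto
      also have "\<dots> = 2 powr Q * (e powr m * \<phi> powr Q + 1 * (w * \<delta>) powr m)"
        using 0 \<open>e = w\<close> by (simp add: powr_mult algebra_simps)
      also have "\<dots> \<le> 2 powr Q * (J + Y)"
        unfolding Y_def using J Q(2) by (intro mult_left_mono add_mono mult_right_mono) auto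
      finally show ?thesis .
    next
      case False
      then have "d = e" unfolding w_def v_def e_def d_def using le(1) by (auto simp: max_def split: if_splits)
      have "\<psi> powr Q - \<phi> powr Q \<le> Q * \<psi> powr (Q - 1) * \<delta>"
        using powr_difference_le[of Q \<phi> \<psi>] Q \<phi> \<delta> 0 by simp
      then have *: "e powr (m - 1) * (w * (\<psi> powr Q - \<phi> powr Q)) \<le> e powr (m - 1) * (w * (Q * \<psi> powr (Q - 1) * \<delta>))"
        using 0 by (intro mult_left_mono) auto
      have "X = J + e powr (m - 1) * (w * (\<psi> powr Q - \<phi> powr Q))"
        unfolding X_def J_def ee max fl[unfolded \<open>d = e\<close>] \<open>d = e\<close> unfolding e_def
        by (simp add: algebra_simps)
      with * have X: "X \<le> J + e powr (m - 1) * (w * (Q * \<psi> powr (Q - 1) * \<delta>))" by simp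
      have \<psi>Q: "\<psi> powr Q = \<psi> powr (Q - 1) * \<psi>"
        using \<psi> Q powr_mult_base[of \<psi> "Q - 1"] by (cases "\<psi> = 0") (auto simp: mult.commute)
      have "X \<le> J + max (X / 2) Y"
      proof (cases "2 * Q * (w * \<delta>) \<le> e * \<psi>")
        case True
        have "e powr (m - 1) * \<psi> powr (Q - 1) * (Q * (w * \<delta>)) \<le> e powr (m - 1) * \<psi> powr (Q - 1) * (e * \<psi> / 2)"
          using True by (intro mult_left_mono) auto
        also have "\<dots> = X / 2" unfolding X_def ee max \<psi>Q by simp
        finally show ?thesis using X by (simp add: mult_ac)
      next
        case False
        have "e powr (m - 1) * \<psi> powr (Q - 1) \<le> e powr (m - 1) * \<psi> powr (m - 1)"
          using powr_antimono_exponent[of \<psi> "m - 1" "Q - 1"] \<psi> m by (intro mult_left_mono) auto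
        also have "\<dots> = (e * \<psi>) powr (m - 1)"
          using 0 \<psi> by (simp add: powr_mult)
        also have "\<dots> \<le> (2 * Q * (w * \<delta>)) powr (m - 1)"
          using False 0 \<psi> m by (intro powr_mono2) auto
        finally have "e powr (m - 1) * \<psi> powr (Q - 1) * (Q * (w * \<delta>))
            \<le> (2 * Q * (w * \<delta>)) powr (m - 1) * (2 * Q * (w * \<delta>))"
          using 0 Q by (intro mult_mono) auto
        also have "\<dots> = (2 * Q * (w * \<delta>)) powr m"
          using 0 Q powr_mult_base[of "2 * Q * (w * \<delta>)" "m - 1"] m
          by (cases "w * \<delta> = 0") (auto simp: mult.commute)
        also have "\<dots> = Y" unfolding Y_def using 0 Q by (subst powr_mult[symmetric]) auto
        finally show ?thesis using X by (simp add: mult_ac)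
      qed
      then have X2: "X \<le> 2 * (J + Y)"
        using \<open>0 \<le> X\<close> \<open>0 \<le> Y\<close> by (auto simp: max_def split: if_splits)
      have "2 * (J + Y) \<le> 2 powr Q * (J + Y)"
      proof -
        have "2 powr 1 \<le> (2 powr Q :: real)" using Q by (intro powr_mono) auto
        moreover have "0 \<le> J + Y" using X2 \<open>0 \<le> X\<close> by simp
        ultimately show ?thesis by (intro mult_right_mono) auto
      qed
      with X2 show ?thesis by simp
    qed
  qed
  then show ?case
    unfolding X_def J_def Y_def e_def d_def \<delta>_def using 0
    by (simp add: w_def[symmetric] v_def[symmetric] max_absorb1 abs_of_nonneg)
next
  case (sym B A)
  from sym(1)[of \<psi> \<phi>] sym(2-) show ?case
    using flux_minus[of m "A - B"]
    by (simp add: abs_minus_commute max.commute algebra_simps)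
qed

text \<open>
  The same bound for the increment of the test function \<open>w \<phi>\<^sup>Q\<close> itself, whose remaining part
  \<open>w (\<phi>\<^sup>Q - \<psi>\<^sup>Q)\<close> is an error term because \<open>\<phi>\<^sup>Q\<close> is Lipschitz in \<open>\<phi>\<close>.
\<close>

lemma caccioppoli_interior:
  fixes A B k \<phi> \<psi> :: real
  defines "w \<equiv> max (A - k) 0" and "v \<equiv> max (B - k) 0"
  assumes m: "1 < m" "m \<le> Q"
    and \<phi>: "0 \<le> \<phi>" "\<phi> \<le> 1" and \<psi>: "0 \<le> \<psi>" "\<psi> \<le> 1"
  shows "\<bar>w * \<phi> powr Q - v * \<psi> powr Q\<bar> powr m
    \<le> 2 powr (m + Q) * (flux m (A - B) * (w * \<phi> powr Q - v * \<psi> powr Q)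
       + 2 * (2 * Q) powr m * (max w v * \<bar>\<phi> - \<psi>\<bar>) powr m)"
proof -
  define J where "J = flux m (A - B) * (w * \<phi> powr Q - v * \<psi> powr Q)"
  define Y where "Y = (2 * Q) powr m * (max w v * \<bar>\<phi> - \<psi>\<bar>) powr m"
  define M where "M = max \<phi> \<psi> powr Q"
  have wv: "0 \<le> w" "0 \<le> v" unfolding w_def v_def by auto
  have M: "0 \<le> M" "M \<le> 1" "\<phi> powr Q \<le> M" "\<psi> powr Q \<le> M"
    unfolding M_def using \<phi> \<psi> m by (auto intro!: powr_le1 powr_mono2)
  have "\<bar>w * \<phi> powr Q - v * \<psi> powr Q\<bar> \<le> \<bar>\<bar>w - v\<bar> * M + max w v * (Q * \<bar>\<phi> - \<psi>\<bar>)\<bar>"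
  proof -
    have "w * \<phi> powr Q - v * \<psi> powr Q = (w - v) * \<psi> powr Q + w * (\<phi> powr Q - \<psi> powr Q)"
      by (simp add: algebra_simps)
    also have "\<bar>\<dots>\<bar> \<le> \<bar>w - v\<bar> * \<psi> powr Q + w * \<bar>\<phi> powr Q - \<psi> powr Q\<bar>"
      using wv by (simp add: order_trans[OF abs_triangle_ineq] abs_mult)
    also have "\<dots> \<le> \<bar>w - v\<bar> * M + max w v * (Q * \<bar>\<phi> - \<psi>\<bar>)"
      using M wv abs_powr_difference_le[of Q \<phi> \<psi>] m \<phi> \<psi> by (intro add_mono mult_mono) auto
    finally show ?thesis by linarith
  qed
  then have "\<bar>w * \<phi> powr Q - v * \<psi> powr Q\<bar> powr m \<le> \<bar>\<bar>w - v\<bar> * M + max w v * (Q * \<bar>\<phi> - \<psi>\<bar>)\<bar> powr m"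
    using m by (intro powr_mono2) auto
  also have "\<dots> \<le> 2 powr m * (\<bar>\<bar>w - v\<bar> * M\<bar> powr m + \<bar>max w v * (Q * \<bar>\<phi> - \<psi>\<bar>)\<bar> powr m)"
    using m by (intro abs_add_powr_le) auto
  also have "\<dots> \<le> 2 powr m * (2 powr Q * (J + Y) + Y)"
  proof (intro mult_left_mono add_mono)
    have "\<bar>\<bar>w - v\<bar> * M\<bar> powr m = \<bar>w - v\<bar> powr m * M powr m"
      using M by (simp add: powr_mult abs_mult)
    also have "\<dots> \<le> \<bar>w - v\<bar> powr m * M"
      using M m powr_antimono_exponent[of M 1 m] by (intro mult_left_mono) auto
    also have "\<dots> \<le> 2 powr Q * (J + Y)"
      unfolding M_def J_def Y_def w_def v_def
      by (rule caccioppoli_weighted_increment) (use m \<phi> \<psi> in auto)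
    finally show "\<bar>\<bar>w - v\<bar> * M\<bar> powr m \<le> 2 powr Q * (J + Y)" .
    have "\<bar>max w v * (Q * \<bar>\<phi> - \<psi>\<bar>)\<bar> powr m \<le> (2 * Q * (max w v * \<bar>\<phi> - \<psi>\<bar>)) powr m"
      using wv m by (intro powr_mono2) (auto simp: abs_mult mult.left_commute mult_left_mono)
    also have "\<dots> = Y"
      unfolding Y_def using wv m by (subst powr_mult) auto
    finally show "\<bar>max w v * (Q * \<bar>\<phi> - \<psi>\<bar>)\<bar> powr m \<le> Y" .
  qed auto
  also have "\<dots> \<le> 2 powr m * (2 powr Q * (J + Y) + 2 powr Q * Y)"
  proof (intro mult_left_mono add_left_mono)
    have "1 * Y \<le> 2 powr Q * Y"
      using m unfolding Y_def by (intro mult_right_mono) (auto intro: ge_one_powr_ge_zero)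
    then show "Y \<le> 2 powr Q * Y" by simp
  qed simp
  also have "\<dots> = 2 powr (m + Q) * (J + 2 * Y)"
    by (simp add: powr_add algebra_simps)
  finally show ?thesis unfolding J_def Y_def by (simp add: mult.assoc)
qed

text \<open>
  A negative flux out of a point above level \<open>k\<close> comes from a larger value \<open>B\<close>, and then
  \<open>B - A \<le> B - k\<close>.
\<close>

lemma flux_truncation_lower_bound:
  fixes A B k \<zeta> :: real
  assumes "1 \<le> m" "0 \<le> \<zeta>"
  shows "0 \<le> flux m (A - B) * (max (A - k) 0 * \<zeta>) + max (A - k) 0 * \<zeta> * max (B - k) 0 powr (m - 1)"
proof (cases "A \<le> B \<and> k \<le> A")
  case True
  have "(B - A) powr (m - 1) \<le> max (B - k) 0 powr (m - 1)"
    using True assms by (intro powr_mono2) auto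
  moreover have "flux m (A - B) = - ((B - A) powr (m - 1))"
    using True flux_nonneg_eq[of "B - A" m] flux_minus[of m "B - A"] by simp
  ultimately have "0 \<le> flux m (A - B) + max (B - k) 0 powr (m - 1)" by simp
  then have "0 \<le> (max (A - k) 0 * \<zeta>) * (flux m (A - B) + max (B - k) 0 powr (m - 1))"
    using assms by (intro mult_nonneg_nonneg) auto
  then show ?thesis by (simp add: algebra_simps)
next
  case False
  then show ?thesis using flux_nonneg[of "A - B" m] assms by (auto simp: max_def)
qed

text \<open>
  \<open>b\<close> and \<open>c\<close> tell whether the two points lie in the ball outside of which the cut-off vanishes.
  A point outside contributes only the power \<open>m - 1\<close> of its truncation, the power that the tail of
  \<open>u\<close> controls; an error term with the power \<open>m\<close> would not be localized.
\<close>

lemma pointwise_caccioppoli: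
  fixes A B k \<phi> \<psi> :: real and b c :: bool
  defines "w \<equiv> max (A - k) 0" and "v \<equiv> max (B - k) 0"
  assumes m: "1 < m" "m \<le> Q"
    and \<phi>: "0 \<le> \<phi>" "\<phi> \<le> 1" "\<not> b \<Longrightarrow> \<phi> = 0" and \<psi>: "0 \<le> \<psi>" "\<psi> \<le> 1" "\<not> c \<Longrightarrow> \<psi> = 0"
  shows "\<bar>w * \<phi> powr Q - v * \<psi> powr Q\<bar> powr m
    \<le> 2 powr (m + Q) * (flux m (A - B) * (w * \<phi> powr Q - v * \<psi> powr Q)
       + 2 * (2 * Q) powr m * (\<bar>\<phi> - \<psi>\<bar> powr m * (of_bool b * w powr m + of_bool c * v powr m)
       + of_bool (\<not> c) * (w * \<phi> powr Q * v powr (m - 1)) + of_bool (\<not> b) * (v * \<psi> powr Q * w powr (m - 1))))"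
proof -
  define D where "D = 2 * (2 * Q) powr m"
  have "1 \<le> (2 * Q) powr m" using m by (intro ge_one_powr_ge_zero) auto
  then have D: "1 \<le> D" unfolding D_def by simp
  have wv: "0 \<le> w" "0 \<le> v" unfolding w_def v_def by auto
  have out: "(a * x powr Q) powr m \<le> 2 powr (m + Q) * (J + D * (x powr m * a powr m + t))"
    if "0 \<le> a" "0 \<le> x" "x \<le> 1" "0 \<le> J + t" "0 \<le> t" for a x J t :: real
  proof -
    have "(a * x powr Q) powr m \<le> (a * x) powr m"
      using that m powr_antimono_exponent[of x 1 Q] by (intro powr_mono2 mult_left_mono) auto
    also have "\<dots> = x powr m * a powr m"
      using that by (simp add: powr_mult mult.commute)
    also have "\<dots> \<le> D * (x powr m * a powr m)"
      using D mult_right_mono[OF D, of "x powr m * a powr m"] by simp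
    also have "\<dots> \<le> J + D * (x powr m * a powr m + t)"
      using that D mult_right_mono[OF D, of t] by (simp add: distrib_left)
    finally have "(a * x powr Q) powr m \<le> J + D * (x powr m * a powr m + t)" .
    moreover have "1 \<le> 2 powr (m + Q)" using m by (intro ge_one_powr_ge_zero) auto
    ultimately have "1 * (a * x powr Q) powr m \<le> 2 powr (m + Q) * (J + D * (x powr m * a powr m + t))"
      by (intro mult_mono) auto
    then show ?thesis by simp
  qed
  show ?thesis
  proof (cases b; cases c)
    assume bc: b c
    have "(max w v * \<bar>\<phi> - \<psi>\<bar>) powr m \<le> \<bar>\<phi> - \<psi>\<bar> powr m * (w powr m + v powr m)"
      using wv by (auto simp: powr_mult max_def mult.commute mult_left_mono)
    then have "D * (max w v * \<bar>\<phi> - \<psi>\<bar>) powr m \<le> D * (\<bar>\<phi> - \<psi>\<bar> powr m * (w powr m + v powr m))"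
      using D by (intro mult_left_mono) auto
    moreover have "\<bar>w * \<phi> powr Q - v * \<psi> powr Q\<bar> powr m
      \<le> 2 powr (m + Q) * (flux m (A - B) * (w * \<phi> powr Q - v * \<psi> powr Q) + D * (max w v * \<bar>\<phi> - \<psi>\<bar>) powr m)"
      unfolding D_def w_def v_def by (rule caccioppoli_interior) (use m \<phi> \<psi> in auto)
    ultimately show ?thesis
      using bc unfolding D_def[symmetric] by (elim order_trans) (auto intro!: mult_left_mono)
  next
    assume bc: b "\<not> c"
    show ?thesis
      using out[of w \<phi> "flux m (A - B) * (w * \<phi> powr Q)" "w * \<phi> powr Q * v powr (m - 1)"]
        flux_truncation_lower_bound[of m "\<phi> powr Q" A B k] wv m \<phi> \<psi>(3)[OF bc(2)] bc
      unfolding D_def[symmetric] by (simp add: w_def[symmetric] v_def[symmetric])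
  next
    assume bc: "\<not> b" c
    show ?thesis
      using out[of v \<psi> "flux m (B - A) * (v * \<psi> powr Q)" "v * \<psi> powr Q * w powr (m - 1)"]
        flux_truncation_lower_bound[of m "\<psi> powr Q" B A k] wv m \<psi> \<phi>(3)[OF bc(1)] bc flux_minus[of m "A - B"]
      unfolding D_def[symmetric] by (simp add: w_def[symmetric] v_def[symmetric])
  next
    assume bc: "\<not> b" "\<not> c"
    then show ?thesis using \<phi>(3) \<psi>(3) by simp
  qed
qed

section \<open>The energy space and its test functions\<close>

text \<open>
  \<open>\<theta>\<close> is the number \<open>\<sigma> p / N\<close>, where \<open>\<sigma>\<close> is the harmonic mean of the orders \<open>s\<^sub>i\<close>, and \<open>P\<close> is the critical exponent.
\<close>

locale double_phase =
  fixes p q \<theta> P \<Lambda> :: real and s t :: "'n::finite \<Rightarrow> real"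
    and a :: "(real ^ 'n) \<times> (real ^ 'n) \<Rightarrow> real"
  assumes s_pos: "0 < s i" and s_le_t: "s i \<le> t i" and t_less_1: "t i < 1"
    and one_less_p: "1 < p" and p_le_q: "p \<le> q"
    and a_measurable [measurable]: "a \<in> borel_measurable borel"
    and a_nonneg: "0 \<le> a z" and a_le: "a z \<le> \<Lambda>"
    and \<theta>: "\<theta> = p / (\<Sum>i\<in>UNIV. 1 / s i)" and \<theta>_less_1: "\<theta> < 1"
    and P: "P = p / (1 - \<theta>)" and q_le_P: "q \<le> P"
begin

lemma exponents: "1 < q" "0 < \<theta>" "p < P" "1 < P" "0 \<le> \<Lambda>"
proof -
  show "1 < q" using one_less_p p_le_q by simp
  show "0 < \<theta>" unfolding \<theta> using one_less_p s_pos by (intro divide_pos_pos sum_pos) auto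
  with \<theta>_less_1 one_less_p show "p < P" unfolding P by (simp add: field_simps)
  with one_less_p show "1 < P" by simp
  show "0 \<le> \<Lambda>" using a_nonneg a_le by (rule order_trans)
qed

lemma s_less_1: "s i < 1" and t_pos: "0 < t i"
  using s_pos[of i] s_le_t[of i] t_less_1[of i] by auto

definition p_weight :: "'n \<Rightarrow> real" where
  "p_weight i = s i * (1 - s i)"

definition q_weight :: "'n \<Rightarrow> real ^ 'n \<Rightarrow> real \<Rightarrow> real" where
  "q_weight i x h = t i * (1 - t i) * a (x, x + h *\<^sub>R axis i 1)"

definition p_kernel :: "'n \<Rightarrow> real \<Rightarrow> real" where
  "p_kernel i h = 1 / \<bar>h\<bar> powr (1 + s i * p)"

definition q_kernel :: "'n \<Rightarrow> real \<Rightarrow> real" where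
  "q_kernel i h = 1 / \<bar>h\<bar> powr (1 + t i * q)"

definition increment :: "(real ^ 'n \<Rightarrow> real) \<Rightarrow> 'n \<Rightarrow> real ^ 'n \<Rightarrow> real \<Rightarrow> real" where
  "increment v i x h = v x - v (x + h *\<^sub>R axis i 1)"

definition energy_density :: "(real ^ 'n \<Rightarrow> real) \<Rightarrow> 'n \<Rightarrow> real ^ 'n \<Rightarrow> real \<Rightarrow> real" where
  "energy_density v i x h = p_weight i * p_kernel i h * \<bar>increment v i x h\<bar> powr p
     + q_weight i x h * q_kernel i h * \<bar>increment v i x h\<bar> powr q"

lemma weight_product_bounds:
  fixes r :: real
  assumes "0 < r" "r < 1"
  shows "0 < r * (1 - r)" "r * (1 - r) \<le> 1"
  using assms mult_le_one[of r "1 - r"] by auto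

lemma p_weight_bounds: "0 < p_weight i" "p_weight i \<le> 1"
  unfolding p_weight_def using weight_product_bounds[OF s_pos s_less_1] by auto

lemma q_weight_bounds: "0 \<le> q_weight i x h" "q_weight i x h \<le> \<Lambda>"
proof -
  note T = weight_product_bounds[OF t_pos t_less_1, of i]
  show "0 \<le> q_weight i x h"
    unfolding q_weight_def by (rule mult_nonneg_nonneg[OF less_imp_le[OF T(1)] a_nonneg])
  have "q_weight i x h \<le> 1 * \<Lambda>"
    unfolding q_weight_def by (rule mult_mono) (use T t_pos[of i] t_less_1[of i] a_nonneg a_le in auto)
  then show "q_weight i x h \<le> \<Lambda>" by simp
qed

lemma kernels_nonneg: "0 \<le> p_kernel i h" "0 \<le> q_kernel i h"
  by (auto simp: p_kernel_def q_kernel_def)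

lemma energy_density_nonneg: "0 \<le> energy_density v i x h"
  unfolding energy_density_def using p_weight_bounds(1)[of i] q_weight_bounds kernels_nonneg
  by (intro add_nonneg_nonneg mult_nonneg_nonneg) (auto intro: less_imp_le)

lemma kernel_measurable [measurable]:
  "p_kernel i \<in> borel_measurable borel" "q_kernel i \<in> borel_measurable borel"
  unfolding p_kernel_def q_kernel_def by measurable

lemma q_weight_measurable [measurable (raw)]:
  assumes [measurable]: "f \<in> borel_measurable M" "g \<in> borel_measurable M"
  shows "(\<lambda>w. q_weight i (f w) (g w)) \<in> borel_measurable M"
  unfolding q_weight_def by measurable

lemma increment_measurable [measurable (raw)]:
  assumes [measurable]: "v \<in> borel_measurable borel" "f \<in> borel_measurable M" "g \<in> borel_measurable M"
  shows "(\<lambda>w. increment v i (f w) (g w)) \<in> borel_measurable M"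
  unfolding increment_def by measurable

lemma energy_density_measurable [measurable (raw)]:
  assumes [measurable]: "v \<in> borel_measurable borel" "f \<in> borel_measurable M" "g \<in> borel_measurable M"
  shows "(\<lambda>w. energy_density v i (f w) (g w)) \<in> borel_measurable M"
  unfolding energy_density_def by measurable

lemma H_fun_eq_energy_density:
  "H_fun p q s t a i x h \<bar>v x - v (x + h *\<^sub>R axis i 1)\<bar> / \<bar>h\<bar> = energy_density v i x h"
  unfolding H_fun_def energy_density_def p_weight_def q_weight_def p_kernel_def q_kernel_def increment_def
  by (cases "h = 0") (auto simp: powr_add field_simps)

lemma A_space_iff:
  "v \<in> A_space p q s t a \<longleftrightarrow> in_Lp p v \<and>
     (\<forall>i. (\<integral>\<^sup>+x. \<integral>\<^sup>+h. ennreal (energy_density v i x h) \<partial>lborel \<partial>lborel) < \<infinity>)"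
  unfolding A_space_def H_fun_eq_energy_density by (simp add: less_top[symmetric])

lemma op_integrand_eq:
  "op_integrand p q s t a v i x h = p_weight i * p_kernel i h * flux p (increment v i x h)
     + q_weight i x h * q_kernel i h * flux q (increment v i x h)"
  unfolding op_integrand_def p_weight_def q_weight_def p_kernel_def q_kernel_def increment_def flux_def Let_def
  by (simp add: field_simps)

lemma aniso_energy_eq:
  "aniso_energy p s v = (\<Sum>i\<in>UNIV. \<integral>\<^sup>+x. \<integral>\<^sup>+h.
     ennreal (p_kernel i h * \<bar>increment v i x h\<bar> powr p) \<partial>lborel \<partial>lborel)"
  unfolding aniso_energy_def p_kernel_def increment_def by simp

lemma A_space_aniso_energy_finite:
  assumes "v \<in> A_space p q s t a"
  shows "aniso_energy p s v < \<infinity>"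
proof -
  from assms have v: "in_Lp p v" and fin: "\<And>i. (\<integral>\<^sup>+x. \<integral>\<^sup>+h. ennreal (energy_density v i x h) \<partial>lborel \<partial>lborel) < \<infinity>"
    by (auto simp: A_space_iff)
  have [measurable]: "v \<in> borel_measurable borel" using v by (simp add: in_Lp_def)
  have "(\<integral>\<^sup>+x. \<integral>\<^sup>+h. ennreal (p_kernel i h * \<bar>increment v i x h\<bar> powr p) \<partial>lborel \<partial>lborel) < \<infinity>" for i
  proof -
    have "(\<integral>\<^sup>+x. \<integral>\<^sup>+h. ennreal (p_kernel i h * \<bar>increment v i x h\<bar> powr p) \<partial>lborel \<partial>lborel)
      \<le> (\<integral>\<^sup>+x. \<integral>\<^sup>+h. ennreal (1 / p_weight i) * ennreal (energy_density v i x h) \<partial>lborel \<partial>lborel)"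
    proof (intro nn_integral_mono)
      fix x and h :: real
      have "p_weight i * (p_kernel i h * \<bar>increment v i x h\<bar> powr p) \<le> energy_density v i x h"
        unfolding energy_density_def using q_weight_bounds kernels_nonneg by (simp add: mult.assoc)
      then have "p_kernel i h * \<bar>increment v i x h\<bar> powr p \<le> 1 / p_weight i * energy_density v i x h"
        using p_weight_bounds(1)[of i] by (simp add: field_simps)
      then show "ennreal (p_kernel i h * \<bar>increment v i x h\<bar> powr p)
          \<le> ennreal (1 / p_weight i) * ennreal (energy_density v i x h)"
        using p_weight_bounds(1)[of i] energy_density_nonneg[of v i x h]
        by (simp add: ennreal_mult[symmetric] ennreal_leI)
    qed
    also have "\<dots> = ennreal (1 / p_weight i) * (\<integral>\<^sup>+x. \<integral>\<^sup>+h. ennreal (energy_density v i x h) \<partial>lborel \<partial>lborel)"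
      by (simp add: nn_integral_cmult)
    also have "\<dots> < \<infinity>"
      using fin[of i] by (simp add: ennreal_mult_less_top)
    finally show ?thesis .
  qed
  then show ?thesis
    unfolding aniso_energy_eq by (simp add: less_top[symmetric])
qed

text \<open>
  The Sobolev inequality applies to \<open>\<bar>v\<bar>\<close> on the whole space; the powers in between follow from
  \<open>r\<^sup>m \<le> r\<^sup>p + r\<^sup>P\<close>.
\<close>

lemma A_space_integrable_powers:
  assumes v: "v \<in> A_space p q s t a" and m: "p \<le> m" "m \<le> P"
  shows "(\<integral>\<^sup>+x. ennreal (\<bar>v x\<bar> powr m) \<partial>lborel) < \<infinity>"
proof -
  have [measurable]: "v \<in> borel_measurable borel" and Lp: "(\<integral>\<^sup>+x. ennreal (\<bar>v x\<bar> powr p) \<partial>lborel) < \<infinity>"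
    using v by (auto simp: A_space_iff in_Lp_def)
  have "aniso_energy p s (\<lambda>x. \<bar>v x\<bar>) \<le> aniso_energy p s v"
    unfolding aniso_energy_def using one_less_p
    by (intro sum_mono nn_integral_mono ennreal_leI divide_right_mono powr_mono2) auto
  also note A_space_aniso_energy_finite[OF v]
  finally obtain c where "0 \<le> c" and c: "aniso_energy p s (\<lambda>x. \<bar>v x\<bar>) = ennreal c"
    by (cases "aniso_energy p s (\<lambda>x. \<bar>v x\<bar>)") auto
  obtain K where K: "\<And>(f :: real ^ 'n \<Rightarrow> real) c. f \<in> borel_measurable borel \<Longrightarrow> (\<And>x. 0 \<le> f x) \<Longrightarrow>
      (\<integral>\<^sup>+x. ennreal (f x powr p) \<partial>lborel) < \<infinity> \<Longrightarrow> 0 \<le> c \<Longrightarrow> aniso_energy p s f \<le> ennreal c \<Longrightarrow>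
      (\<integral>\<^sup>+x. ennreal (f x powr P) \<partial>lborel) \<le> ennreal (K * c powr (1 / (1 - \<theta>)))"
    using aniso_sobolev[OF less_imp_le[OF one_less_p] s_pos \<theta> \<theta>_less_1 P] by metis
  have "(\<integral>\<^sup>+x. ennreal (\<bar>v x\<bar> powr P) \<partial>lborel) \<le> ennreal (K * c powr (1 / (1 - \<theta>)))"
    using \<open>0 \<le> c\<close> c Lp by (intro K) auto
  then have LP: "(\<integral>\<^sup>+x. ennreal (\<bar>v x\<bar> powr P) \<partial>lborel) < \<infinity>"
    by (rule le_less_trans) simp
  have "(\<integral>\<^sup>+x. ennreal (\<bar>v x\<bar> powr m) \<partial>lborel)
      \<le> (\<integral>\<^sup>+x. ennreal (\<bar>v x\<bar> powr p) + ennreal (\<bar>v x\<bar> powr P) \<partial>lborel)"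
  proof (rule nn_integral_mono)
    fix x
    have "\<bar>v x\<bar> powr m \<le> \<bar>v x\<bar> powr p + \<bar>v x\<bar> powr P"
    proof (cases "\<bar>v x\<bar> \<le> 1")
      case True
      then have "\<bar>v x\<bar> powr m \<le> \<bar>v x\<bar> powr p"
        using m one_less_p by (intro powr_antimono_exponent) auto
      then show ?thesis by (simp add: add_increasing2)
    next
      case False
      then have "\<bar>v x\<bar> powr m \<le> \<bar>v x\<bar> powr P" using m by (intro powr_mono) auto
      then show ?thesis by (simp add: add_increasing)
    qed
    then show "ennreal (\<bar>v x\<bar> powr m) \<le> ennreal (\<bar>v x\<bar> powr p) + ennreal (\<bar>v x\<bar> powr P)"
      by (simp add: ennreal_plus[symmetric] ennreal_leI del: ennreal_plus)
  qed
  also have "\<dots> < \<infinity>"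
    using Lp LP by (subst nn_integral_add) auto
  finally show ?thesis .
qed

definition truncated_kernel_mass :: "'n \<Rightarrow> ennreal" where
  "truncated_kernel_mass i = (\<integral>\<^sup>+h. ennreal (p_kernel i h * min 1 \<bar>h\<bar> powr p) \<partial>lborel)
     + (\<integral>\<^sup>+h. ennreal (q_kernel i h * min 1 \<bar>h\<bar> powr q) \<partial>lborel)"

lemma truncated_kernel_mass_finite: "truncated_kernel_mass i < \<infinity>"
  unfolding truncated_kernel_mass_def p_kernel_def q_kernel_def
  using nn_integral_truncated_kernel_finite[of p "s i"] nn_integral_truncated_kernel_finite[of q "t i"]
    one_less_p exponents(1) s_pos[of i] s_less_1[of i] t_pos[of i] t_less_1[of i]
  by simp

definition level_test :: "(real ^ 'n \<Rightarrow> real) \<Rightarrow> real \<Rightarrow> (real ^ 'n \<Rightarrow> real) \<Rightarrow> real ^ 'n \<Rightarrow> real" where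
  "level_test u k \<phi> x = max (u x - k) 0 * \<phi> x powr q"

lemma level_test_measurable [measurable]:
  assumes [measurable]: "u \<in> borel_measurable borel" "\<phi> \<in> borel_measurable borel"
  shows "level_test u k \<phi> \<in> borel_measurable borel"
  unfolding level_test_def by measurable

lemma level_test_bounds:
  assumes "0 \<le> k" "0 \<le> \<phi> x" "\<phi> x \<le> 1"
  shows "0 \<le> level_test u k \<phi> x" "level_test u k \<phi> x \<le> max (u x - k) 0" "level_test u k \<phi> x \<le> \<bar>u x\<bar>"
proof -
  have "\<phi> x powr q \<le> 1" using assms exponents by (intro powr_le1) auto
  then have "max (u x - k) 0 * \<phi> x powr q \<le> max (u x - k) 0 * 1"
    by (intro mult_left_mono) auto
  then show le: "level_test u k \<phi> x \<le> max (u x - k) 0" unfolding level_test_def by simp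
  show "level_test u k \<phi> x \<le> \<bar>u x\<bar>"
    by (rule order_trans[OF le]) (use assms in auto)
  show "0 \<le> level_test u k \<phi> x" unfolding level_test_def by auto
qed

text \<open>
  The product rule for \<open>w \<phi>\<^sup>q\<close>, with the increment of \<open>\<phi>\<^sup>q\<close> weighted by the value of \<open>w\<close> at \<open>x\<close>,
  so that the error term factorizes into a function of \<open>x\<close> and a kernel in \<open>h\<close>.
\<close>

lemma increment_powr_le:
  assumes "0 \<le> k" and \<phi>: "\<And>x. 0 \<le> \<phi> x" "\<And>x. \<phi> x \<le> 1" and "1 \<le> L" "L-lipschitz_on UNIV \<phi>"
    and "0 \<le> m"
  shows "\<bar>increment (level_test u k \<phi>) i x h\<bar> powr m
    \<le> 2 powr m * (\<bar>increment u i x h\<bar> powr m + (q * L) powr m * (\<bar>u x\<bar> powr m * min 1 \<bar>h\<bar> powr m))"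
proof -
  let ?y = "x + h *\<^sub>R axis i 1" and ?w = "\<lambda>x. max (u x - k) 0"
  have "\<bar>\<phi> x - \<phi> ?y\<bar> \<le> L * \<bar>h\<bar>"
    using lipschitz_onD[OF assms(5), of x ?y] by (simp add: dist_norm)
  moreover have "\<bar>\<phi> x - \<phi> ?y\<bar> \<le> 1"
    using \<phi>[of x] \<phi>[of ?y] by (simp add: abs_le_iff)
  ultimately have d: "\<bar>\<phi> x - \<phi> ?y\<bar> \<le> L * min 1 \<bar>h\<bar>"
    using \<open>1 \<le> L\<close> by (auto simp: min_def)
  have "\<bar>increment (level_test u k \<phi>) i x h\<bar>
      = \<bar>?w x * (\<phi> x powr q - \<phi> ?y powr q) + (?w x - ?w ?y) * \<phi> ?y powr q\<bar>"
    unfolding increment_def level_test_def by (simp add: algebra_simps)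
  also have "\<dots> \<le> \<bar>?w x\<bar> * \<bar>\<phi> x powr q - \<phi> ?y powr q\<bar> + \<bar>?w x - ?w ?y\<bar> * \<phi> ?y powr q"
    by (rule order_trans[OF abs_triangle_ineq]) (simp add: abs_mult)
  also have "\<dots> \<le> \<bar>u x\<bar> * (q * (L * min 1 \<bar>h\<bar>)) + \<bar>increment u i x h\<bar> * 1"
  proof (intro add_mono mult_mono)
    have "\<bar>\<phi> x powr q - \<phi> ?y powr q\<bar> \<le> q * \<bar>\<phi> x - \<phi> ?y\<bar>"
      using \<phi> exponents(1) by (intro abs_powr_difference_le) auto
    also have "\<dots> \<le> q * (L * min 1 \<bar>h\<bar>)"
      using d exponents(1) by (intro mult_left_mono) auto
    finally show "\<bar>\<phi> x powr q - \<phi> ?y powr q\<bar> \<le> q * (L * min 1 \<bar>h\<bar>)" .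
    show "\<phi> ?y powr q \<le> 1" using \<phi> exponents(1) by (intro powr_le1) auto
  qed (use \<open>0 \<le> k\<close> exponents(1) in \<open>auto simp: increment_def\<close>)
  finally have "\<bar>increment (level_test u k \<phi>) i x h\<bar>
      \<le> \<bar>\<bar>increment u i x h\<bar> + q * L * (\<bar>u x\<bar> * min 1 \<bar>h\<bar>)\<bar>"
    by (simp add: mult_ac)
  then have "\<bar>increment (level_test u k \<phi>) i x h\<bar> powr m
      \<le> \<bar>\<bar>increment u i x h\<bar> + q * L * (\<bar>u x\<bar> * min 1 \<bar>h\<bar>)\<bar> powr m"
    using \<open>0 \<le> m\<close> by (intro powr_mono2) auto
  also have "\<dots> \<le> 2 powr m * (\<bar>\<bar>increment u i x h\<bar>\<bar> powr m + \<bar>q * L * (\<bar>u x\<bar> * min 1 \<bar>h\<bar>)\<bar> powr m)"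
    using \<open>0 \<le> m\<close> by (rule abs_add_powr_le)
  also have "\<bar>q * L * (\<bar>u x\<bar> * min 1 \<bar>h\<bar>)\<bar> = (q * L) * (\<bar>u x\<bar> * min 1 \<bar>h\<bar>)"
    using exponents(1) \<open>1 \<le> L\<close> by simp
  finally show ?thesis
    using exponents(1) \<open>1 \<le> L\<close> by (simp add: powr_mult)
qed

text \<open>
  Finiteness of the energy of the test function: the error terms are products of
  \<open>\<integral> \<bar>u\<bar>\<^sup>p\<close> and \<open>\<integral> \<bar>u\<bar>\<^sup>q\<close> with finite masses of truncated kernels.
\<close>

lemma level_test_in_A_space:
  assumes u: "u \<in> A_space p q s t a" and "0 \<le> k"
    and \<phi>: "\<And>x. 0 \<le> \<phi> x" "\<And>x. \<phi> x \<le> 1" "1 \<le> L" "L-lipschitz_on UNIV \<phi>"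
  shows "level_test u k \<phi> \<in> A_space p q s t a"
proof -
  have [measurable]: "u \<in> borel_measurable borel" and Lp: "(\<integral>\<^sup>+x. ennreal (\<bar>u x\<bar> powr p) \<partial>lborel) < \<infinity>"
    using u by (auto simp: A_space_iff in_Lp_def)
  have [measurable]: "\<phi> \<in> borel_measurable borel"
    using \<phi>(4) by (intro borel_measurable_continuous_onI lipschitz_on_continuous_on)
  have "in_Lp p (level_test u k \<phi>)"
  proof -
    have "(\<integral>\<^sup>+x. ennreal (\<bar>level_test u k \<phi> x\<bar> powr p) \<partial>lborel) \<le> (\<integral>\<^sup>+x. ennreal (\<bar>u x\<bar> powr p) \<partial>lborel)"
    proof (intro nn_integral_mono ennreal_leI powr_mono2)
      fix x
      show "\<bar>level_test u k \<phi> x\<bar> \<le> \<bar>u x\<bar>"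
        using level_test_bounds[of k \<phi> x u] \<open>0 \<le> k\<close> \<phi> by simp
    qed (use one_less_p in auto)
    then show ?thesis unfolding in_Lp_def using Lp by auto
  qed
  moreover have "(\<integral>\<^sup>+x. \<integral>\<^sup>+h. ennreal (energy_density (level_test u k \<phi>) i x h) \<partial>lborel \<partial>lborel) < \<infinity>" for i
  proof -
    define C where "C = 2 powr q * (1 + \<Lambda>) * (q * L) powr q"
    have qL: "1 \<le> q * L" using exponents(1) \<phi>(3) mult_mono[of 1 q 1 L] by simp
    have C: "0 \<le> C" unfolding C_def using exponents by simp
    have pointwise: "energy_density (level_test u k \<phi>) i x h \<le> 2 powr q * energy_density u i x h
        + C * (\<bar>u x\<bar> powr p * (p_kernel i h * min 1 \<bar>h\<bar> powr p) + \<bar>u x\<bar> powr q * (q_kernel i h * min 1 \<bar>h\<bar> powr q))"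
      for x h
    proof -
      have part: "W * k' * \<bar>increment (level_test u k \<phi>) i x h\<bar> powr m
          \<le> 2 powr q * (W * k' * \<bar>increment u i x h\<bar> powr m) + C * (\<bar>u x\<bar> powr m * (k' * min 1 \<bar>h\<bar> powr m))"
        if "0 \<le> W" "W \<le> 1 + \<Lambda>" "0 \<le> k'" "0 \<le> m" "m \<le> q" for W k' m
      proof -
        have "\<bar>increment (level_test u k \<phi>) i x h\<bar> powr m
          \<le> 2 powr m * (\<bar>increment u i x h\<bar> powr m + (q * L) powr m * (\<bar>u x\<bar> powr m * min 1 \<bar>h\<bar> powr m))"
          using assms that by (intro increment_powr_le) auto
        also have "\<dots> \<le> 2 powr q * (\<bar>increment u i x h\<bar> powr m + (q * L) powr q * (\<bar>u x\<bar> powr m * min 1 \<bar>h\<bar> powr m))"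
        proof (rule mult_mono)
          have "(q * L) powr m \<le> (q * L) powr q" using that qL by (intro powr_mono) auto
          then show "\<bar>increment u i x h\<bar> powr m + (q * L) powr m * (\<bar>u x\<bar> powr m * min 1 \<bar>h\<bar> powr m)
              \<le> \<bar>increment u i x h\<bar> powr m + (q * L) powr q * (\<bar>u x\<bar> powr m * min 1 \<bar>h\<bar> powr m)"
            by (intro add_left_mono mult_right_mono) auto
        qed (use that in auto)
        finally have "(W * k') * \<bar>increment (level_test u k \<phi>) i x h\<bar> powr m \<le> (W * k')
            * (2 powr q * (\<bar>increment u i x h\<bar> powr m + (q * L) powr q * (\<bar>u x\<bar> powr m * min 1 \<bar>h\<bar> powr m)))"
          using that by (intro mult_left_mono) auto
        also have "\<dots> = 2 powr q * (W * k' * \<bar>increment u i x h\<bar> powr m)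
            + W * (2 powr q * (q * L) powr q * (\<bar>u x\<bar> powr m * (k' * min 1 \<bar>h\<bar> powr m)))"
          by (simp add: algebra_simps)
        also have "\<dots> \<le> 2 powr q * (W * k' * \<bar>increment u i x h\<bar> powr m)
            + (1 + \<Lambda>) * (2 powr q * (q * L) powr q * (\<bar>u x\<bar> powr m * (k' * min 1 \<bar>h\<bar> powr m)))"
          using that by (intro add_left_mono mult_right_mono) auto
        finally show ?thesis unfolding C_def by (simp add: mult_ac)
      qed
      have "p_weight i * p_kernel i h * \<bar>increment (level_test u k \<phi>) i x h\<bar> powr p
          \<le> 2 powr q * (p_weight i * p_kernel i h * \<bar>increment u i x h\<bar> powr p)
            + C * (\<bar>u x\<bar> powr p * (p_kernel i h * min 1 \<bar>h\<bar> powr p))"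
        using p_weight_bounds[of i] kernels_nonneg exponents one_less_p p_le_q by (intro part) auto
      moreover have "q_weight i x h * q_kernel i h * \<bar>increment (level_test u k \<phi>) i x h\<bar> powr q
          \<le> 2 powr q * (q_weight i x h * q_kernel i h * \<bar>increment u i x h\<bar> powr q)
            + C * (\<bar>u x\<bar> powr q * (q_kernel i h * min 1 \<bar>h\<bar> powr q))"
        using q_weight_bounds[of i x h] kernels_nonneg exponents by (intro part) auto
      ultimately show ?thesis unfolding energy_density_def by (simp add: distrib_left)
    qed
    have "(\<integral>\<^sup>+x. \<integral>\<^sup>+h. ennreal (energy_density (level_test u k \<phi>) i x h) \<partial>lborel \<partial>lborel)
      \<le> (\<integral>\<^sup>+x. \<integral>\<^sup>+h. ennreal (2 powr q) * ennreal (energy_density u i x h)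
          + ennreal C * (ennreal (\<bar>u x\<bar> powr p) * ennreal (p_kernel i h * min 1 \<bar>h\<bar> powr p)
          + ennreal (\<bar>u x\<bar> powr q) * ennreal (q_kernel i h * min 1 \<bar>h\<bar> powr q)) \<partial>lborel \<partial>lborel)"
      using C kernels_nonneg energy_density_nonneg
      by (intro nn_integral_mono order_trans[OF ennreal_leI[OF pointwise]])
        (simp add: ennreal_mult ennreal_plus mult_nonneg_nonneg)
    also have "\<dots> = ennreal (2 powr q) * (\<integral>\<^sup>+x. \<integral>\<^sup>+h. ennreal (energy_density u i x h) \<partial>lborel \<partial>lborel)
        + ennreal C * ((\<integral>\<^sup>+x. ennreal (\<bar>u x\<bar> powr p) \<partial>lborel) * (\<integral>\<^sup>+h. ennreal (p_kernel i h * min 1 \<bar>h\<bar> powr p) \<partial>lborel)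
          + (\<integral>\<^sup>+x. ennreal (\<bar>u x\<bar> powr q) \<partial>lborel) * (\<integral>\<^sup>+h. ennreal (q_kernel i h * min 1 \<bar>h\<bar> powr q) \<partial>lborel))"
      by (simp add: nn_integral_cmult nn_integral_multc nn_integral_add)
    also have "\<dots> < \<infinity>"
      using truncated_kernel_mass_finite[of i] u Lp
        A_space_integrable_powers[OF u p_le_q q_le_P]
      by (simp add: A_space_iff truncated_kernel_mass_def ennreal_mult_less_top)
    finally show ?thesis .
  qed
  ultimately show ?thesis by (simp add: A_space_iff)
qed

end

section \<open>The Caccioppoli inequality\<close>

text \<open>
  How the weak formulation is exploited: the integrands \<open>F\<close> have total integral zero, so a pointwise
  bound of \<open>G\<close> by \<open>F + Z\<close> turns into a bound of the integral of \<open>G\<close> by that of \<open>Z\<close>.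
\<close>

lemma sum_nn_integral_le_of_balance:
  fixes F G Z :: "'i::finite \<Rightarrow> 'b \<Rightarrow> real"
  assumes F: "\<And>i. integrable M (F i)" and balance: "(\<Sum>i\<in>UNIV. integral\<^sup>L M (F i)) = 0"
    and [measurable]: "\<And>i. G i \<in> borel_measurable M" "\<And>i. Z i \<in> borel_measurable M"
    and G: "\<And>i x. 0 \<le> G i x" "\<And>i x. G i x \<le> F i x + Z i x" and Z: "\<And>i x. 0 \<le> Z i x"
  shows "(\<Sum>i\<in>UNIV. \<integral>\<^sup>+x. ennreal (G i x) \<partial>M) \<le> (\<Sum>i\<in>UNIV. \<integral>\<^sup>+x. ennreal (Z i x) \<partial>M)"
proof (cases "(\<Sum>i\<in>UNIV. \<integral>\<^sup>+x. ennreal (Z i x) \<partial>M) = \<infinity>")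
  case False
  then have fin: "(\<integral>\<^sup>+x. ennreal (Z i x) \<partial>M) < \<infinity>" for i
    by (auto simp: less_top)
  have Zi: "integrable M (Z i)" for i
    using fin[of i] Z by (intro integrableI_nonneg) auto
  have Gi: "integrable M (G i)" for i
  proof (rule Bochner_Integration.integrable_bound)
    show "integrable M (\<lambda>x. F i x + Z i x)" using F Zi by auto
    have "norm (G i x) \<le> norm (F i x + Z i x)" for x
      using G(1)[of i x] G(2)[of i x] by simp
    then show "AE x in M. norm (G i x) \<le> norm (F i x + Z i x)" by simp
  qed measurable
  have "(\<Sum>i\<in>UNIV. integral\<^sup>L M (G i)) \<le> (\<Sum>i\<in>UNIV. integral\<^sup>L M (\<lambda>x. F i x + Z i x))"
    using F Zi Gi G by (intro sum_mono integral_mono) auto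
  also have "\<dots> = (\<Sum>i\<in>UNIV. integral\<^sup>L M (Z i))"
    using F Zi balance by (simp add: sum.distrib)
  finally have "ennreal (\<Sum>i\<in>UNIV. integral\<^sup>L M (G i)) \<le> ennreal (\<Sum>i\<in>UNIV. integral\<^sup>L M (Z i))"
    by (rule ennreal_leI)
  then show ?thesis
    using Gi Zi G Z by (simp add: nn_integral_eq_integral sum_ennreal[symmetric] del: sum_ennreal)
qed (simp only: infinity_ennreal_def top_greatest)

lemma powr_product_le:
  fixes d e :: real
  assumes "1 \<le> m"
  shows "\<bar>d\<bar> powr (m - 1) * \<bar>e\<bar> \<le> \<bar>d\<bar> powr m + \<bar>e\<bar> powr m"
proof -
  define M where "M = max \<bar>d\<bar> \<bar>e\<bar>"
  have "\<bar>d\<bar> powr (m - 1) * \<bar>e\<bar> \<le> M powr (m - 1) * M"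
    using assms unfolding M_def by (intro mult_mono powr_mono2) auto
  also have "\<dots> = M powr m"
    using powr_mult_base[of M "m - 1"] by (cases "M = 0") (auto simp: M_def mult.commute)
  also have "\<dots> \<le> \<bar>d\<bar> powr m + \<bar>e\<bar> powr m"
    unfolding M_def by (auto simp: max_def)
  finally show ?thesis .
qed

text \<open>
  At distance at least \<open>1 / L\<close> from a bounded set the singular kernel is comparable with the weight
  \<open>(1 + \<bar>h + z\<bar>) powr - \<alpha>\<close> of the tail, since \<open>1 + \<bar>h + z\<bar> \<le> L (2 + X) \<bar>h\<bar>\<close>.
\<close>

lemma far_kernel_le:
  fixes h z :: real
  assumes "1 \<le> L" "1 / L \<le> \<bar>h\<bar>" "\<bar>z\<bar> \<le> X" "0 \<le> \<alpha>" "\<alpha> \<le> \<beta>"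
  shows "1 / \<bar>h\<bar> powr \<beta> \<le> (L * (2 + X)) powr \<beta> / (1 + \<bar>h + z\<bar>) powr \<alpha>"
proof -
  have "0 < \<bar>h\<bar>" using assms by (intro less_le_trans[OF _ assms(2)]) auto
  have "0 \<le> X" using assms by linarith
  have L: "1 \<le> L * \<bar>h\<bar>" using assms by (simp add: field_simps)
  have "1 + \<bar>h + z\<bar> \<le> (1 + X) * 1 + \<bar>h\<bar> * 1" using assms by simp
  also have "\<dots> \<le> (1 + X) * (L * \<bar>h\<bar>) + \<bar>h\<bar> * L"
    using L \<open>0 \<le> X\<close> assms by (intro add_mono mult_left_mono) auto
  also have "\<dots> = L * (2 + X) * \<bar>h\<bar>" by (simp add: algebra_simps)
  finally have "(1 + \<bar>h + z\<bar>) powr \<beta> \<le> (L * (2 + X) * \<bar>h\<bar>) powr \<beta>"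
    using assms by (intro powr_mono2) auto
  also have "\<dots> = (L * (2 + X)) powr \<beta> * \<bar>h\<bar> powr \<beta>"
    using assms \<open>0 \<le> X\<close> by (simp add: powr_mult)
  finally have "(1 + \<bar>h + z\<bar>) powr \<alpha> \<le> (L * (2 + X)) powr \<beta> * \<bar>h\<bar> powr \<beta>"
    using assms powr_mono[of \<alpha> \<beta> "1 + \<bar>h + z\<bar>"] by simp
  then show ?thesis
    using \<open>0 < \<bar>h\<bar>\<close> by (simp add: field_simps)
qed

context double_phase
begin

text \<open>
  By \<open>\<bar>d\<bar>\<^sup>m\<^sup>-\<^sup>1 \<bar>e\<bar> \<le> \<bar>d\<bar>\<^sup>m + \<bar>e\<bar>\<^sup>m\<close> the integrand is dominated by the energy densities of \<open>u\<close> and \<open>\<eta>\<close>.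
\<close>

lemma weak_form_integrable:
  assumes u: "u \<in> A_space p q s t a" and \<eta>: "\<eta> \<in> A_space p q s t a"
  shows "integrable (lborel \<Otimes>\<^sub>M lborel) (\<lambda>(x, h). op_integrand p q s t a u i x h * increment \<eta> i x h)"
proof -
  have [measurable]: "u \<in> borel_measurable borel" "\<eta> \<in> borel_measurable borel"
    using u \<eta> by (auto simp: A_space_iff in_Lp_def)
  have [measurable]: "(\<lambda>(x, h). op_integrand p q s t a u i x h * increment \<eta> i x h)
      \<in> borel_measurable (lborel \<Otimes>\<^sub>M lborel)"
    unfolding op_integrand_eq flux_def by measurable
  have dens: "integrable (lborel \<Otimes>\<^sub>M lborel) (\<lambda>(x, h). energy_density v i x h)"
    if "v \<in> A_space p q s t a" "v \<in> borel_measurable borel" for v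
  proof (rule integrableI_nonneg)
    have [measurable]: "v \<in> borel_measurable borel" by fact
    show "(\<lambda>(x, h). energy_density v i x h) \<in> borel_measurable (lborel \<Otimes>\<^sub>M lborel)" by measurable
    have "(\<integral>\<^sup>+z. ennreal (case z of (x, h) \<Rightarrow> energy_density v i x h) \<partial>(lborel \<Otimes>\<^sub>M lborel))
        = (\<integral>\<^sup>+x. \<integral>\<^sup>+h. ennreal (energy_density v i x h) \<partial>lborel \<partial>lborel)"
      by (subst lborel.nn_integral_fst[symmetric]) auto
    then show "(\<integral>\<^sup>+z. ennreal (case z of (x, h) \<Rightarrow> energy_density v i x h) \<partial>(lborel \<Otimes>\<^sub>M lborel)) < \<infinity>"
      using that(1) by (simp add: A_space_iff)
  qed (auto simp: energy_density_nonneg)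
  show ?thesis
  proof (rule Bochner_Integration.integrable_bound)
    show "integrable (lborel \<Otimes>\<^sub>M lborel) (\<lambda>z. (case z of (x, h) \<Rightarrow> energy_density u i x h) + (case z of (x, h) \<Rightarrow> energy_density \<eta> i x h))"
      using dens u \<eta> by auto
    have "\<bar>op_integrand p q s t a u i x h * increment \<eta> i x h\<bar> \<le> energy_density u i x h + energy_density \<eta> i x h" for x h
    proof -
      let ?d = "increment u i x h" and ?e = "increment \<eta> i x h"
      have part: "\<bar>W * flux m ?d * ?e\<bar> \<le> W * \<bar>?d\<bar> powr m + W * \<bar>?e\<bar> powr m" if "0 \<le> W" "1 \<le> m" for W m
        using mult_left_mono[OF powr_product_le[OF that(2), of ?d ?e] that(1)] that(1)
        by (simp add: abs_mult abs_flux distrib_left mult.assoc)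
      have "\<bar>op_integrand p q s t a u i x h * ?e\<bar>
          \<le> \<bar>p_weight i * p_kernel i h * flux p ?d * ?e\<bar> + \<bar>q_weight i x h * q_kernel i h * flux q ?d * ?e\<bar>"
        unfolding op_integrand_eq distrib_right by (rule abs_triangle_ineq)
      also have "\<dots> \<le> (p_weight i * p_kernel i h * \<bar>?d\<bar> powr p + p_weight i * p_kernel i h * \<bar>?e\<bar> powr p)
          + (q_weight i x h * q_kernel i h * \<bar>?d\<bar> powr q + q_weight i x h * q_kernel i h * \<bar>?e\<bar> powr q)"
        using p_weight_bounds[of i] q_weight_bounds[of i x h] kernels_nonneg one_less_p exponents(1)
        by (intro add_mono part) auto
      also have "\<dots> = energy_density u i x h + energy_density \<eta> i x h" unfolding energy_density_def by simp
      finally show ?thesis .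
    qed
    then show "AE z in lborel \<Otimes>\<^sub>M lborel. norm (case z of (x, h) \<Rightarrow> op_integrand p q s t a u i x h * increment \<eta> i x h)
        \<le> norm ((case z of (x, h) \<Rightarrow> energy_density u i x h) + (case z of (x, h) \<Rightarrow> energy_density \<eta> i x h))"
      using energy_density_nonneg by (auto intro!: AE_I2)
  qed measurable
qed

text \<open>
  One half of the right-hand side of the pointwise inequality: the terms carrying the weight at the
  starting point \<open>x\<close> of the segment. The other half is the same expression for the reversed segment
  from \<open>x + h e\<^sub>i\<close> with step \<open>- h\<close>.
\<close>

definition remainder :: "real \<Rightarrow> (real ^ 'n \<Rightarrow> real) \<Rightarrow> real \<Rightarrow> (real ^ 'n \<Rightarrow> real) \<Rightarrow> (real ^ 'n) set \<Rightarrow>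
    'n \<Rightarrow> real ^ 'n \<Rightarrow> real \<Rightarrow> real" where
  "remainder m u k \<phi> B i x h = \<bar>increment \<phi> i x h\<bar> powr m * (of_bool (x \<in> B) * max (u x - k) 0 powr m)
     + of_bool (x + h *\<^sub>R axis i 1 \<notin> B) * (level_test u k \<phi> x * max (u (x + h *\<^sub>R axis i 1) - k) 0 powr (m - 1))"

lemma remainder_nonneg: "0 \<le> remainder m u k \<phi> B i x h"
  unfolding remainder_def level_test_def by auto

lemma remainder_measurable [measurable (raw)]:
  assumes [measurable]: "u \<in> borel_measurable borel" "\<phi> \<in> borel_measurable borel" "B \<in> sets borel"
    "f \<in> borel_measurable M" "g \<in> borel_measurable M"
  shows "(\<lambda>w. remainder m u k \<phi> B i (f w) (g w)) \<in> borel_measurable M"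
  unfolding remainder_def of_bool_def by measurable

lemma increment_level_test_powr_le:
  assumes \<phi>: "\<And>x. 0 \<le> \<phi> x" "\<And>x. \<phi> x \<le> 1" "\<And>x. x \<notin> B \<Longrightarrow> \<phi> x = 0" and m: "1 < m" "m \<le> q"
  shows "\<bar>increment (level_test u k \<phi>) i x h\<bar> powr m
    \<le> 2 powr (m + q) * (flux m (increment u i x h) * increment (level_test u k \<phi>) i x h
       + 2 * (2 * q) powr m * (remainder m u k \<phi> B i x h + remainder m u k \<phi> B i (x + h *\<^sub>R axis i 1) (- h)))"
proof -
  let ?y = "x + h *\<^sub>R axis i 1"
  have "?y + (- h) *\<^sub>R axis i 1 = x" by simp
  then have reversed: "increment \<phi> i ?y (- h) = - increment \<phi> i x h" and x: "x + h *\<^sub>R axis i 1 + (- h) *\<^sub>R axis i 1 = x"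
    unfolding increment_def by simp_all
  let ?w = "max (u x - k) 0" and ?v = "max (u ?y - k) 0"
  have "remainder m u k \<phi> B i x h + remainder m u k \<phi> B i ?y (- h)
      = \<bar>\<phi> x - \<phi> ?y\<bar> powr m * (of_bool (x \<in> B) * ?w powr m + of_bool (?y \<in> B) * ?v powr m)
        + of_bool (?y \<notin> B) * (?w * \<phi> x powr q * ?v powr (m - 1))
        + of_bool (x \<notin> B) * (?v * \<phi> ?y powr q * ?w powr (m - 1))"
    unfolding remainder_def reversed x abs_minus_cancel unfolding increment_def level_test_def
    by (simp only: distrib_left add_ac)
  then show ?thesis
    using pointwise_caccioppoli[where A = "u x" and B = "u ?y" and k = k and \<phi> = "\<phi> x" and \<psi> = "\<phi> ?y" and m = m and Q = q
        and b = "x \<in> B" and c = "?y \<in> B", OF m \<phi>(1) \<phi>(2) _ \<phi>(1) \<phi>(2)] \<phi>(3)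
    unfolding increment_def level_test_def by presburger
qed

text \<open>
  The pointwise inequality is divided by its constant, multiplied by the weights and summed over the
  two growths: the exponent \<open>p\<close> yields the energy, while for \<open>q\<close> only nonnegativity of the right-hand
  side is kept. Reversing segments then folds the two halves of the error into one; since only
  \<open>0 \<le> a \<le> \<Lambda>\<close> is used for the weight of the error, the coefficient \<open>a\<close> may be asymmetric.
\<close>

lemma energy_le_remainders:
  obtains C where "0 \<le> C" and
    "\<And>\<Omega> u k \<phi> L B. weak_solution \<Omega> p q s t a u \<Longrightarrow> 0 \<le> k \<Longrightarrow>
      (\<And>x. 0 \<le> \<phi> x) \<Longrightarrow> (\<And>x. \<phi> x \<le> 1) \<Longrightarrow> 1 \<le> L \<Longrightarrow> L-lipschitz_on UNIV \<phi> \<Longrightarrow>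
      B \<in> sets borel \<Longrightarrow> B \<subseteq> \<Omega> \<Longrightarrow> (\<And>x. x \<notin> B \<Longrightarrow> \<phi> x = 0) \<Longrightarrow>
      aniso_energy p s (level_test u k \<phi>) \<le> ennreal C * (\<Sum>i\<in>UNIV.
        (\<integral>\<^sup>+x. \<integral>\<^sup>+h. ennreal (p_kernel i h * remainder p u k \<phi> B i x h) \<partial>lborel \<partial>lborel)
      + (\<integral>\<^sup>+x. \<integral>\<^sup>+h. ennreal (q_kernel i h * remainder q u k \<phi> B i x h) \<partial>lborel \<partial>lborel))"
proof
  define D where "D = 2 * (2 * q) powr q"
  \<comment> \<open>\<open>D\<close> and \<open>1 / c\<close> are the constants of the pointwise inequality for \<open>m = q\<close>, which dominate those for \<open>m = p\<close>\<close>
  define c where "c = 1 / 2 powr (2 * q)"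
  define C1 where "C1 = (\<Sum>i\<in>UNIV. 1 / (c * p_weight i))"
  have D: "0 \<le> D" and c: "0 < c" unfolding D_def c_def by auto
  have C1: "1 / (c * p_weight i) \<le> C1" "0 \<le> 1 / (c * p_weight i)" for i
  proof -
    have *: "0 \<le> 1 / (c * p_weight i)" for i using c p_weight_bounds(1)[of i] by simp
    then show "0 \<le> 1 / (c * p_weight i)" .
    show "1 / (c * p_weight i) \<le> C1" unfolding C1_def using * by (intro member_le_sum) auto
  qed
  then have "0 \<le> C1" using order_trans by blast
  show "0 \<le> C1 * (2 * (D * (1 + \<Lambda>)))"
    using \<open>0 \<le> C1\<close> D exponents by simp
  fix \<Omega> B :: "(real ^ 'n) set" and u \<phi> :: "real ^ 'n \<Rightarrow> real" and k L :: real
  assume sol: "weak_solution \<Omega> p q s t a u" and "0 \<le> k" and \<phi>: "\<And>x. 0 \<le> \<phi> x" "\<And>x. \<phi> x \<le> 1"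
    and "1 \<le> L" "L-lipschitz_on UNIV \<phi>" and [measurable]: "B \<in> sets borel" and "B \<subseteq> \<Omega>"
    and supp: "\<And>x. x \<notin> B \<Longrightarrow> \<phi> x = 0"
  have u: "u \<in> A_space p q s t a" using sol by (simp add: weak_solution_def)
  then have [measurable]: "u \<in> borel_measurable borel" by (simp add: A_space_iff in_Lp_def)
  have [measurable]: "\<phi> \<in> borel_measurable borel"
    using \<open>L-lipschitz_on UNIV \<phi>\<close> by (intro borel_measurable_continuous_onI lipschitz_on_continuous_on)
  define \<eta> where "\<eta> = level_test u k \<phi>"
  have [measurable]: "\<eta> \<in> borel_measurable borel" unfolding \<eta>_def by measurable
  have \<eta>: "\<eta> \<in> A_space p q s t a"
    unfolding \<eta>_def using u \<open>0 \<le> k\<close> \<phi> \<open>1 \<le> L\<close> \<open>L-lipschitz_on UNIV \<phi>\<close> by (rule level_test_in_A_space)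
  define F where "F i = (\<lambda>(x, h). op_integrand p q s t a u i x h * increment \<eta> i x h)" for i
  define G where "G i = (\<lambda>(x, h). c * p_weight i * (p_kernel i h * \<bar>increment \<eta> i x h\<bar> powr p))" for i
  define R where "R m i x h = remainder m u k \<phi> B i x h" for m i x h
  have R0: "0 \<le> R m i x h" for m i x h unfolding R_def by (rule remainder_nonneg)
  have [measurable]: "(\<lambda>(x, h). R m i x h) \<in> borel_measurable (borel \<Otimes>\<^sub>M borel)" for m i
    unfolding R_def by measurable
  define Z where "Z i = (\<lambda>(x, h). D * (1 + \<Lambda>) *
      (p_kernel i h * (R p i x h + R p i (x + h *\<^sub>R axis i 1) (- h))
     + q_kernel i h * (R q i x h + R q i (x + h *\<^sub>R axis i 1) (- h))))" for i
  have F: "integrable (lborel \<Otimes>\<^sub>M lborel) (F i)" for i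
    unfolding F_def by (rule weak_form_integrable[OF u \<eta>])
  have "(\<Sum>i\<in>UNIV. integral\<^sup>L (lborel \<Otimes>\<^sub>M lborel) (F i)) = 0"
  proof -
    have "AE x in lborel. x \<notin> \<Omega> \<longrightarrow> \<eta> x = 0"
      using supp \<open>B \<subseteq> \<Omega>\<close> by (intro AE_I2) (auto simp: \<eta>_def level_test_def)
    then have "(\<Sum>i\<in>UNIV. LINT x|lborel. (LINT h|lborel.
        op_integrand p q s t a u i x h * (\<eta> x - \<eta> (x + h *\<^sub>R axis i 1)))) = 0"
      using sol \<eta> unfolding weak_solution_def by blast
    moreover have "(LINT x|lborel. LINT h|lborel. op_integrand p q s t a u i x h * (\<eta> x - \<eta> (x + h *\<^sub>R axis i 1)))
        = integral\<^sup>L (lborel \<Otimes>\<^sub>M lborel) (F i)" for i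
      using lborel_pair.integral_fst'[OF F[of i]] by (simp add: F_def increment_def)
    ultimately show ?thesis by simp
  qed
  moreover have GFZ: "G i z \<le> F i z + Z i z" for i z
  proof (cases z)
    case (Pair x h)
    let ?e = "increment \<eta> i x h" and ?d = "increment u i x h"
    let ?R = "\<lambda>m. R m i x h + R m i (x + h *\<^sub>R axis i 1) (- h)"
    have cm: "c * \<bar>?e\<bar> powr m \<le> flux m ?d * ?e + D * ?R m \<and> 0 \<le> flux m ?d * ?e + D * ?R m"
      if m: "1 < m" "m \<le> q" for m
    proof -
      have "\<bar>?e\<bar> powr m \<le> 2 powr (m + q) * (flux m ?d * ?e + 2 * (2 * q) powr m * ?R m)"
        unfolding \<eta>_def R_def using \<phi> supp m by (rule increment_level_test_powr_le)
      then have *: "\<bar>?e\<bar> powr m / 2 powr (m + q) \<le> flux m ?d * ?e + 2 * (2 * q) powr m * ?R m"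
        by (simp add: field_simps)
      also have "\<dots> \<le> flux m ?d * ?e + D * ?R m"
        unfolding D_def using m R0 exponents(1)
        by (intro add_left_mono mult_right_mono mult_left_mono powr_mono) auto
      finally have le: "\<bar>?e\<bar> powr m / 2 powr (m + q) \<le> flux m ?d * ?e + D * ?R m" .
      have "c * \<bar>?e\<bar> powr m \<le> \<bar>?e\<bar> powr m / 2 powr (m + q)"
        unfolding c_def using m by (simp add: divide_left_mono)
      moreover have "0 \<le> \<bar>?e\<bar> powr m / 2 powr (m + q)" by simp
      ultimately show ?thesis using le by linarith
    qed
    have weigh: "W * (flux m ?d * ?e + D * ?R m) \<le> W * (flux m ?d * ?e) + (1 + \<Lambda>) * \<kappa> * (D * ?R m)"
      if "0 \<le> W" "W \<le> (1 + \<Lambda>) * \<kappa>" for W m \<kappa>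
      using mult_right_mono[OF that(2), of "D * ?R m"] D R0 by (simp add: distrib_left)
    have "G i z \<le> p_weight i * p_kernel i h * (flux p ?d * ?e + D * ?R p)"
      using cm[of p] one_less_p p_le_q p_weight_bounds(1)[of i] kernels_nonneg
        mult_left_mono[of "c * \<bar>?e\<bar> powr p" "flux p ?d * ?e + D * ?R p" "p_weight i * p_kernel i h"]
      unfolding G_def Pair by (simp add: mult_ac)
    moreover have "0 \<le> q_weight i x h * q_kernel i h * (flux q ?d * ?e + D * ?R q)"
      using cm[of q] exponents(1) q_weight_bounds[of i x h] kernels_nonneg by (intro mult_nonneg_nonneg) auto
    moreover have "p_weight i * p_kernel i h * (flux p ?d * ?e + D * ?R p)
        \<le> p_weight i * p_kernel i h * (flux p ?d * ?e) + (1 + \<Lambda>) * p_kernel i h * (D * ?R p)"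
      using p_weight_bounds[of i] kernels_nonneg exponents by (intro weigh mult_right_mono) auto
    moreover have "q_weight i x h * q_kernel i h * (flux q ?d * ?e + D * ?R q)
        \<le> q_weight i x h * q_kernel i h * (flux q ?d * ?e) + (1 + \<Lambda>) * q_kernel i h * (D * ?R q)"
      using q_weight_bounds[of i x h] kernels_nonneg exponents by (intro weigh mult_right_mono) auto
    moreover have "F i z + Z i z = p_weight i * p_kernel i h * (flux p ?d * ?e) + (1 + \<Lambda>) * p_kernel i h * (D * ?R p)
        + (q_weight i x h * q_kernel i h * (flux q ?d * ?e) + (1 + \<Lambda>) * q_kernel i h * (D * ?R q))"
      unfolding F_def Z_def Pair op_integrand_eq by (simp add: algebra_simps)
    ultimately show ?thesis by linarith
  qed
  moreover have "0 \<le> G i z" for i z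
    unfolding G_def using c p_weight_bounds(1)[of i] kernels_nonneg by (auto split: prod.split)
  moreover have "0 \<le> Z i z" for i z
    unfolding Z_def using D exponents kernels_nonneg R0 by (auto split: prod.split)
  ultimately have main: "(\<Sum>i\<in>UNIV. \<integral>\<^sup>+z. ennreal (G i z) \<partial>(lborel \<Otimes>\<^sub>M lborel))
      \<le> (\<Sum>i\<in>UNIV. \<integral>\<^sup>+z. ennreal (Z i z) \<partial>(lborel \<Otimes>\<^sub>M lborel))"
    using F by (intro sum_nn_integral_le_of_balance[where F = F]) (auto simp: G_def Z_def)
  let ?I = "\<lambda>k' m i. \<integral>\<^sup>+x. \<integral>\<^sup>+h. ennreal (k' i h * R m i x h) \<partial>lborel \<partial>lborel"
  have "aniso_energy p s \<eta> \<le> ennreal C1 * (\<Sum>i\<in>UNIV. \<integral>\<^sup>+z. ennreal (G i z) \<partial>(lborel \<Otimes>\<^sub>M lborel))"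
    unfolding aniso_energy_eq sum_distrib_left
  proof (rule sum_mono)
    fix i
    have "(\<integral>\<^sup>+x. \<integral>\<^sup>+h. ennreal (p_kernel i h * \<bar>increment \<eta> i x h\<bar> powr p) \<partial>lborel \<partial>lborel)
        \<le> (\<integral>\<^sup>+x. \<integral>\<^sup>+h. ennreal C1 * ennreal (G i (x, h)) \<partial>lborel \<partial>lborel)"
    proof (intro nn_integral_mono)
      fix x and h :: real
      have "p_kernel i h * \<bar>increment \<eta> i x h\<bar> powr p = 1 / (c * p_weight i) * G i (x, h)"
        unfolding G_def using c p_weight_bounds(1)[of i] by simp
      also have "\<dots> \<le> C1 * G i (x, h)"
        using C1 \<open>\<And>i z. 0 \<le> G i z\<close> by (intro mult_right_mono) auto
      finally show "ennreal (p_kernel i h * \<bar>increment \<eta> i x h\<bar> powr p) \<le> ennreal C1 * ennreal (G i (x, h))"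
        using \<open>0 \<le> C1\<close> \<open>\<And>i z. 0 \<le> G i z\<close> by (simp add: ennreal_mult[symmetric] ennreal_leI)
    qed
    also have "\<dots> = ennreal C1 * (\<integral>\<^sup>+x. \<integral>\<^sup>+h. ennreal (G i (x, h)) \<partial>lborel \<partial>lborel)"
      unfolding G_def by (simp add: nn_integral_cmult)
    also have "(\<integral>\<^sup>+x. \<integral>\<^sup>+h. ennreal (G i (x, h)) \<partial>lborel \<partial>lborel) = (\<integral>\<^sup>+z. ennreal (G i z) \<partial>(lborel \<Otimes>\<^sub>M lborel))"
      by (rule lborel.nn_integral_fst) (simp add: G_def)
    finally show "(\<integral>\<^sup>+x. \<integral>\<^sup>+h. ennreal (p_kernel i h * \<bar>increment \<eta> i x h\<bar> powr p) \<partial>lborel \<partial>lborel)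
        \<le> ennreal C1 * (\<integral>\<^sup>+z. ennreal (G i z) \<partial>(lborel \<Otimes>\<^sub>M lborel))" .
  qed
  also have "\<dots> \<le> ennreal C1 * (\<Sum>i\<in>UNIV. \<integral>\<^sup>+z. ennreal (Z i z) \<partial>(lborel \<Otimes>\<^sub>M lborel))"
    using main by (intro mult_left_mono) auto
  also have "(\<lambda>i. \<integral>\<^sup>+z. ennreal (Z i z) \<partial>(lborel \<Otimes>\<^sub>M lborel))
      = (\<lambda>i. ennreal (2 * (D * (1 + \<Lambda>))) * (?I p_kernel p i + ?I q_kernel q i))"
  proof
    fix i
    have swap: "(\<integral>\<^sup>+x. \<integral>\<^sup>+h. ennreal (k' h * R m i (x + h *\<^sub>R axis i 1) (- h)) \<partial>lborel \<partial>lborel)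
        = (\<integral>\<^sup>+x. \<integral>\<^sup>+h. ennreal (k' h * R m i x h) \<partial>lborel \<partial>lborel)"
      if [measurable]: "k' \<in> borel_measurable borel" and "\<And>h. k' (- h) = k' h" for k' m
      using nn_integral_pair_swap[of "\<lambda>x h. ennreal (k' h * R m i x h)" i] that(2) by simp
    have "(\<integral>\<^sup>+z. ennreal (Z i z) \<partial>(lborel \<Otimes>\<^sub>M lborel)) = (\<integral>\<^sup>+x. \<integral>\<^sup>+h. ennreal (Z i (x, h)) \<partial>lborel \<partial>lborel)"
      by (rule lborel.nn_integral_fst[symmetric]) (simp add: Z_def)
    also have "\<dots> = (\<integral>\<^sup>+x. \<integral>\<^sup>+h. ennreal (D * (1 + \<Lambda>)) *
        ((ennreal (p_kernel i h * R p i x h) + ennreal (p_kernel i h * R p i (x + h *\<^sub>R axis i 1) (- h)))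
       + (ennreal (q_kernel i h * R q i x h) + ennreal (q_kernel i h * R q i (x + h *\<^sub>R axis i 1) (- h)))) \<partial>lborel \<partial>lborel)"
      unfolding Z_def using D exponents kernels_nonneg R0
      by (simp add: ennreal_mult[symmetric] ennreal_plus[symmetric] distrib_left del: ennreal_plus)
    also have "\<dots> = ennreal (D * (1 + \<Lambda>)) * ((?I p_kernel p i + ?I p_kernel p i) + (?I q_kernel q i + ?I q_kernel q i))"
      using swap[of "p_kernel i" p] swap[of "q_kernel i" q]
      by (simp add: nn_integral_cmult nn_integral_add p_kernel_def q_kernel_def)
    also have "\<dots> = ennreal (2 * (D * (1 + \<Lambda>))) * (?I p_kernel p i + ?I q_kernel q i)"
    proof -
      have double: "ennreal e * ((y + y) + (z + z)) = ennreal (2 * e) * (y + z)" if "0 \<le> e" for e y z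
      proof -
        have "(y + y) + (z + z) = 2 * (y + z)" by (simp add: mult_2 add_ac)
        then show ?thesis using that by (simp add: ennreal_mult mult.assoc mult.left_commute)
      qed
      show ?thesis using D exponents by (intro double) simp
    qed
    finally show "(\<integral>\<^sup>+z. ennreal (Z i z) \<partial>(lborel \<Otimes>\<^sub>M lborel))
      = ennreal (2 * (D * (1 + \<Lambda>))) * (?I p_kernel p i + ?I q_kernel q i)" .
  qed
  also have "ennreal C1 * (\<Sum>i\<in>UNIV. ennreal (2 * (D * (1 + \<Lambda>))) * (?I p_kernel p i + ?I q_kernel q i))
      = ennreal (C1 * (2 * (D * (1 + \<Lambda>)))) * (\<Sum>i\<in>UNIV. ?I p_kernel p i + ?I q_kernel q i)"
    using \<open>0 \<le> C1\<close> D exponents by (subst ennreal_mult) (auto simp: sum_distrib_left[symmetric] mult.assoc)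
  finally show "aniso_energy p s (level_test u k \<phi>) \<le> ennreal (C1 * (2 * (D * (1 + \<Lambda>)))) * (\<Sum>i\<in>UNIV.
        (\<integral>\<^sup>+x. \<integral>\<^sup>+h. ennreal (p_kernel i h * remainder p u k \<phi> B i x h) \<partial>lborel \<partial>lborel)
      + (\<integral>\<^sup>+x. \<integral>\<^sup>+h. ennreal (q_kernel i h * remainder q u k \<phi> B i x h) \<partial>lborel \<partial>lborel))"
    unfolding \<eta>_def R_def .
qed

definition tail :: "(real ^ 'n \<Rightarrow> real) \<Rightarrow> 'n \<Rightarrow> real ^ 'n \<Rightarrow> ennreal" where
  "tail u i x = (\<integral>\<^sup>+h. ennreal (\<bar>u (x + h *\<^sub>R axis i 1)\<bar> powr (q - 1)
     / (1 + \<bar>h + x $ i\<bar>) powr (1 + s i * p)) \<partial>lborel)"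

definition decaying_kernel_mass :: "'n \<Rightarrow> ennreal" where
  "decaying_kernel_mass i = (\<integral>\<^sup>+h. ennreal (1 / (1 + \<bar>h\<bar>) powr (1 + s i * p)) \<partial>lborel)"

lemma decaying_kernel_mass_finite: "decaying_kernel_mass i < \<infinity>"
  unfolding decaying_kernel_mass_def using s_pos[of i] one_less_p
  by (intro nn_integral_decaying_kernel_finite) auto

text \<open>
  Besides the comparison of kernels this uses \<open>w\<^sup>m\<^sup>-\<^sup>1 \<le> 1 + \<bar>u\<bar>\<^sup>q\<^sup>-\<^sup>1\<close>, which replaces both growths by the
  one that occurs in the tail.
\<close>

lemma far_interaction_le:
  assumes [measurable]: "u \<in> borel_measurable borel" and B [measurable]: "B \<in> sets borel" and "0 \<le> k"
    and "1 \<le> L" and x: "\<bar>x $ i\<bar> \<le> X"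
    and far: "\<And>h. x + h *\<^sub>R axis i 1 \<notin> B \<Longrightarrow> 1 / L \<le> \<bar>h\<bar>"
    and m: "1 \<le> m" "m \<le> q" and \<beta>: "1 + s i * p \<le> \<beta>" "\<beta> \<le> 1 + q"
  shows "(\<integral>\<^sup>+h. ennreal (1 / \<bar>h\<bar> powr \<beta> * (of_bool (x + h *\<^sub>R axis i 1 \<notin> B)
       * max (u (x + h *\<^sub>R axis i 1) - k) 0 powr (m - 1))) \<partial>lborel)
    \<le> ennreal ((L * (2 + X)) powr (1 + q)) * (decaying_kernel_mass i + tail u i x)"
proof -
  define r where "r = L * (2 + X)"
  have "0 \<le> X" using x by linarith
  then have "1 \<le> r" unfolding r_def using \<open>1 \<le> L\<close> mult_mono[of 1 L 1 "2 + X"] by simp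
  let ?d = "\<lambda>h. (1 + \<bar>h + x $ i\<bar>) powr (1 + s i * p)"
  have sp: "0 \<le> 1 + s i * p" using s_pos[of i] one_less_p by simp
  have "1 / \<bar>h\<bar> powr \<beta> * (of_bool (x + h *\<^sub>R axis i 1 \<notin> B) * max (u (x + h *\<^sub>R axis i 1) - k) 0 powr (m - 1))
      \<le> r powr (1 + q) * (1 / ?d h + \<bar>u (x + h *\<^sub>R axis i 1)\<bar> powr (q - 1) / ?d h)" for h
  proof (cases "x + h *\<^sub>R axis i 1 \<in> B")
    case False
    let ?v = "max (u (x + h *\<^sub>R axis i 1) - k) 0" and ?U = "\<bar>u (x + h *\<^sub>R axis i 1)\<bar>"
    have "1 / \<bar>h\<bar> powr \<beta> \<le> r powr \<beta> / ?d h"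
      unfolding r_def using \<open>1 \<le> L\<close> far[OF False] x sp \<beta>(1) by (rule far_kernel_le)
    also have "\<dots> \<le> r powr (1 + q) / ?d h"
      using \<open>1 \<le> r\<close> \<beta>(2) by (intro divide_right_mono powr_mono) auto
    finally have kern: "1 / \<bar>h\<bar> powr \<beta> \<le> r powr (1 + q) / ?d h" .
    have "?v powr (m - 1) \<le> 1 + ?U powr (q - 1)"
    proof (cases "?v \<le> 1")
      case True
      then have "?v powr (m - 1) \<le> 1" using m by (intro powr_le1) auto
      then show ?thesis by (simp add: add_increasing2)
    next
      case False
      then have "?v powr (m - 1) \<le> ?v powr (q - 1)" using m by (intro powr_mono) auto
      also have "\<dots> \<le> ?U powr (q - 1)"
        using \<open>0 \<le> k\<close> m by (intro powr_mono2) auto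
      finally show ?thesis by simp
    qed
    with kern have "1 / \<bar>h\<bar> powr \<beta> * ?v powr (m - 1) \<le> r powr (1 + q) / ?d h * (1 + ?U powr (q - 1))"
      by (intro mult_mono) auto
    then show ?thesis using False by (simp add: distrib_left add_divide_distrib)
  qed simp
  then have "(\<integral>\<^sup>+h. ennreal (1 / \<bar>h\<bar> powr \<beta> * (of_bool (x + h *\<^sub>R axis i 1 \<notin> B)
       * max (u (x + h *\<^sub>R axis i 1) - k) 0 powr (m - 1))) \<partial>lborel)
    \<le> (\<integral>\<^sup>+h. ennreal (r powr (1 + q)) * (ennreal (1 / ?d h)
        + ennreal (\<bar>u (x + h *\<^sub>R axis i 1)\<bar> powr (q - 1) / ?d h)) \<partial>lborel)"
    by (intro nn_integral_mono)
      (simp add: ennreal_mult[symmetric] ennreal_plus[symmetric] ennreal_leI del: ennreal_plus)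
  also have "\<dots> = ennreal (r powr (1 + q)) * ((\<integral>\<^sup>+h. ennreal (1 / ?d h) \<partial>lborel) + tail u i x)"
    unfolding tail_def by (subst nn_integral_cmult) (auto simp: nn_integral_add)
  also have "(\<integral>\<^sup>+h. ennreal (1 / ?d h) \<partial>lborel) = decaying_kernel_mass i"
    unfolding decaying_kernel_mass_def
    by (rule nn_integral_translate[of "\<lambda>h. ennreal (1 / (1 + \<bar>h\<bar>) powr (1 + s i * p))"]) measurable
  finally show ?thesis unfolding r_def .
qed

text \<open>
  The singular part of the remainder is tamed by the Lipschitz bound
  \<open>\<bar>\<phi> x - \<phi> (x + h e\<^sub>i)\<bar> \<le> L min 1 \<bar>h\<bar>\<close>, the part outside \<open>B\<close> by the tail; in the latter the
  test function at \<open>x\<close> is bounded by \<open>w x\<close>. Both occurring kernels are covered by the exponent \<open>\<beta>\<close>.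
\<close>

lemma remainder_integral_le:
  assumes [measurable]: "u \<in> borel_measurable borel" and B [measurable]: "B \<in> sets borel" and "0 \<le> k"
    and \<phi>: "\<And>x. 0 \<le> \<phi> x" "\<And>x. \<phi> x \<le> 1" "\<And>x. x \<notin> B \<Longrightarrow> \<phi> x = 0" "1 \<le> L" "L-lipschitz_on UNIV \<phi>"
    and far: "\<And>x h. \<phi> x \<noteq> 0 \<Longrightarrow> x + h *\<^sub>R axis i 1 \<notin> B \<Longrightarrow> 1 / L \<le> \<bar>h\<bar>"
    and X: "\<And>x. x \<in> B \<Longrightarrow> \<bar>x $ i\<bar> \<le> X" "0 \<le> X"
    and T: "AE x in lborel. x \<in> B \<longrightarrow> tail u i x \<le> ennreal T" "0 \<le> T"
    and mass: "(\<integral>\<^sup>+h. ennreal (1 / \<bar>h\<bar> powr \<beta> * min 1 \<bar>h\<bar> powr m) \<partial>lborel) \<le> ennreal M" "0 \<le> M"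
    and decay: "decaying_kernel_mass i \<le> ennreal M"
    and m: "1 \<le> m" "m \<le> q" and \<beta>: "1 + s i * p \<le> \<beta>" "\<beta> \<le> 1 + q"
  shows "(\<integral>\<^sup>+x. \<integral>\<^sup>+h. ennreal (1 / \<bar>h\<bar> powr \<beta> * remainder m u k \<phi> B i x h) \<partial>lborel \<partial>lborel)
    \<le> ennreal ((M + T) * (2 + X) powr (1 + q) * L powr (1 + q))
      * (\<integral>\<^sup>+x\<in>B. ennreal (max (u x - k) 0 powr m + max (u x - k) 0) \<partial>lborel)"
proof -
  have [measurable]: "\<phi> \<in> borel_measurable borel"
    using \<phi>(5) by (intro borel_measurable_continuous_onI lipschitz_on_continuous_on)
  define w where "w x = max (u x - k) 0" for x
  have [measurable]: "w \<in> borel_measurable borel" unfolding w_def by measurable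
  have w: "0 \<le> w x" for x unfolding w_def by simp
  define A where "A = (M + T) * (2 + X) powr (1 + q) * L powr (1 + q)"
  have LX: "(L * (2 + X)) powr (1 + q) = (2 + X) powr (1 + q) * L powr (1 + q)"
    using \<phi>(4) X by (simp add: powr_mult)
  have "1 * 1 \<le> (2 + X) powr (1 + q) * L powr (1 + q)"
    using X \<phi>(4) exponents(1) by (intro mult_mono ge_one_powr_ge_zero) auto
  then have one: "1 \<le> (2 + X) powr (1 + q) * L powr (1 + q)" by simp
  have near: "(\<integral>\<^sup>+h. ennreal (1 / \<bar>h\<bar> powr \<beta> * (\<bar>increment \<phi> i x h\<bar> powr m * (of_bool (x \<in> B) * w x powr m))) \<partial>lborel)
      \<le> ennreal A * ennreal (w x powr m) * indicator B x" for x
  proof (cases "x \<in> B")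
    case True
    have "1 / \<bar>h\<bar> powr \<beta> * (\<bar>increment \<phi> i x h\<bar> powr m * w x powr m)
        \<le> (L powr m * w x powr m) * (1 / \<bar>h\<bar> powr \<beta> * min 1 \<bar>h\<bar> powr m)" for h
    proof -
      let ?y = "x + h *\<^sub>R axis i 1"
      have "\<bar>\<phi> x - \<phi> ?y\<bar> \<le> L * \<bar>h\<bar>"
        using lipschitz_onD[OF \<phi>(5), of x ?y] by (simp add: dist_norm)
      moreover have "\<bar>\<phi> x - \<phi> ?y\<bar> \<le> 1"
        using \<phi>(1,2)[of x] \<phi>(1,2)[of ?y] by (simp add: abs_le_iff)
      ultimately have "\<bar>increment \<phi> i x h\<bar> \<le> L * min 1 \<bar>h\<bar>"
        using \<phi>(4) unfolding increment_def by (auto simp: min_def)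
      then have "\<bar>increment \<phi> i x h\<bar> powr m \<le> (L * min 1 \<bar>h\<bar>) powr m"
        using m by (intro powr_mono2) auto
      also have "\<dots> = L powr m * min 1 \<bar>h\<bar> powr m"
        using \<phi>(4) by (simp add: powr_mult)
      finally have "1 / \<bar>h\<bar> powr \<beta> * (\<bar>increment \<phi> i x h\<bar> powr m * w x powr m)
          \<le> 1 / \<bar>h\<bar> powr \<beta> * ((L powr m * min 1 \<bar>h\<bar> powr m) * w x powr m)"
        by (intro mult_left_mono mult_right_mono) auto
      then show ?thesis by (simp add: mult_ac)
    qed
    then have "(\<integral>\<^sup>+h. ennreal (1 / \<bar>h\<bar> powr \<beta> * (\<bar>increment \<phi> i x h\<bar> powr m * (of_bool (x \<in> B) * w x powr m))) \<partial>lborel)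
        \<le> (\<integral>\<^sup>+h. ennreal (L powr m * w x powr m) * ennreal (1 / \<bar>h\<bar> powr \<beta> * min 1 \<bar>h\<bar> powr m) \<partial>lborel)"
      using True by (intro nn_integral_mono) (simp add: ennreal_mult[symmetric] ennreal_leI)
    also have "\<dots> \<le> ennreal (L powr m * w x powr m) * ennreal M"
      using mass by (subst nn_integral_cmult) (auto intro: mult_left_mono)
    also have "\<dots> \<le> ennreal (A * w x powr m)"
    proof -
      have "M * L powr m \<le> (M + T) * ((2 + X) powr (1 + q) * L powr (1 + q))"
      proof (rule mult_mono)
        have "1 * L powr m \<le> (2 + X) powr (1 + q) * L powr (1 + q)"
          using X \<phi>(4) m exponents(1) by (intro mult_mono ge_one_powr_ge_zero powr_mono) auto
        then show "L powr m \<le> (2 + X) powr (1 + q) * L powr (1 + q)" by simp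
      qed (use T mass in auto)
      then have "M * L powr m * w x powr m \<le> A * w x powr m"
        unfolding A_def by (intro mult_right_mono) (auto simp: mult.assoc)
      then show ?thesis
        using mass(2) by (simp add: ennreal_mult[symmetric] ennreal_leI mult_ac)
    qed
    finally show ?thesis
      using True T mass by (simp add: ennreal_mult A_def)
  qed simp
  have off: "AE x in lborel. (\<integral>\<^sup>+h. ennreal (1 / \<bar>h\<bar> powr \<beta> * (of_bool (x + h *\<^sub>R axis i 1 \<notin> B)
        * (level_test u k \<phi> x * w (x + h *\<^sub>R axis i 1) powr (m - 1)))) \<partial>lborel)
      \<le> ennreal A * ennreal (w x) * indicator B x"
    using T(1)
  proof eventually_elim
    case (elim x)
    show ?case
    proof (cases "\<phi> x = 0")
      case True
      then show ?thesis by (simp add: level_test_def)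
    next
      case False
      then have "x \<in> B" using \<phi>(3) by blast
      have lt: "0 \<le> level_test u k \<phi> x" "level_test u k \<phi> x \<le> w x"
        using level_test_bounds[of k \<phi> x u] \<phi> \<open>0 \<le> k\<close> unfolding w_def by auto
      have "(\<integral>\<^sup>+h. ennreal (1 / \<bar>h\<bar> powr \<beta> * (of_bool (x + h *\<^sub>R axis i 1 \<notin> B)
          * (level_test u k \<phi> x * w (x + h *\<^sub>R axis i 1) powr (m - 1)))) \<partial>lborel)
          = (\<integral>\<^sup>+h. ennreal (level_test u k \<phi> x) * ennreal (1 / \<bar>h\<bar> powr \<beta> * (of_bool (x + h *\<^sub>R axis i 1 \<notin> B)
          * w (x + h *\<^sub>R axis i 1) powr (m - 1))) \<partial>lborel)"
        using lt by (intro nn_integral_cong) (simp add: ennreal_mult[symmetric] mult_ac)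
      also have "\<dots> = ennreal (level_test u k \<phi> x) * (\<integral>\<^sup>+h. ennreal (1 / \<bar>h\<bar> powr \<beta> * (of_bool (x + h *\<^sub>R axis i 1 \<notin> B)
          * w (x + h *\<^sub>R axis i 1) powr (m - 1))) \<partial>lborel)"
        by (rule nn_integral_cmult) (simp add: of_bool_def)
      also have "\<dots> \<le> ennreal (w x) * (ennreal ((L * (2 + X)) powr (1 + q)) * (decaying_kernel_mass i + tail u i x))"
        unfolding w_def[of "_ + _"] using lt
        by (intro mult_mono far_interaction_le)
          (use B \<open>0 \<le> k\<close> \<phi> X(1)[OF \<open>x \<in> B\<close>] far[OF False] m \<beta> in \<open>auto intro!: ennreal_leI\<close>)
      also have "\<dots> \<le> ennreal (w x) * (ennreal ((L * (2 + X)) powr (1 + q)) * (ennreal M + ennreal T))"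
        using elim \<open>x \<in> B\<close> decay by (intro mult_left_mono add_mono) auto
      also have "\<dots> = ennreal A * ennreal (w x) * indicator B x"
        unfolding A_def LX using \<open>x \<in> B\<close> w mass(2) T(2)
        by (simp add: ennreal_mult[symmetric] ennreal_plus[symmetric] mult_ac del: ennreal_plus)
      finally show ?thesis .
    qed
  qed
  have "(\<integral>\<^sup>+x. \<integral>\<^sup>+h. ennreal (1 / \<bar>h\<bar> powr \<beta> * remainder m u k \<phi> B i x h) \<partial>lborel \<partial>lborel)
      = (\<integral>\<^sup>+x. (\<integral>\<^sup>+h. ennreal (1 / \<bar>h\<bar> powr \<beta> * (\<bar>increment \<phi> i x h\<bar> powr m * (of_bool (x \<in> B) * w x powr m))) \<partial>lborel)
       + (\<integral>\<^sup>+h. ennreal (1 / \<bar>h\<bar> powr \<beta> * (of_bool (x + h *\<^sub>R axis i 1 \<notin> B)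
        * (level_test u k \<phi> x * w (x + h *\<^sub>R axis i 1) powr (m - 1)))) \<partial>lborel) \<partial>lborel)"
  proof (rule nn_integral_cong)
    fix x
    have lt: "0 \<le> level_test u k \<phi> x" using level_test_bounds[of k \<phi> x u] \<phi> \<open>0 \<le> k\<close> by simp
    have "ennreal (1 / \<bar>h\<bar> powr \<beta> * remainder m u k \<phi> B i x h)
       = ennreal (1 / \<bar>h\<bar> powr \<beta> * (\<bar>increment \<phi> i x h\<bar> powr m * (of_bool (x \<in> B) * w x powr m)))
       + ennreal (1 / \<bar>h\<bar> powr \<beta> * (of_bool (x + h *\<^sub>R axis i 1 \<notin> B)
        * (level_test u k \<phi> x * w (x + h *\<^sub>R axis i 1) powr (m - 1))))" for h
      using lt unfolding remainder_def w_def[symmetric] distrib_left by (subst ennreal_plus) auto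
    then show "(\<integral>\<^sup>+h. ennreal (1 / \<bar>h\<bar> powr \<beta> * remainder m u k \<phi> B i x h) \<partial>lborel)
      = (\<integral>\<^sup>+h. ennreal (1 / \<bar>h\<bar> powr \<beta> * (\<bar>increment \<phi> i x h\<bar> powr m * (of_bool (x \<in> B) * w x powr m))) \<partial>lborel)
       + (\<integral>\<^sup>+h. ennreal (1 / \<bar>h\<bar> powr \<beta> * (of_bool (x + h *\<^sub>R axis i 1 \<notin> B)
        * (level_test u k \<phi> x * w (x + h *\<^sub>R axis i 1) powr (m - 1)))) \<partial>lborel)"
      by (simp only:) (rule nn_integral_add; simp add: of_bool_def)
  qed
  also have "\<dots> \<le> (\<integral>\<^sup>+x. ennreal A * ennreal (w x powr m) * indicator B x + ennreal A * ennreal (w x) * indicator B x \<partial>lborel)"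
    by (rule nn_integral_mono_AE, use off in eventually_elim) (intro add_mono near)
  also have "\<dots> = (\<integral>\<^sup>+x. ennreal A * (ennreal (w x powr m + w x) * indicator B x) \<partial>lborel)"
    using w by (intro nn_integral_cong) (simp add: distrib_left distrib_right mult.assoc)
  also have "\<dots> = ennreal A * (\<integral>\<^sup>+x\<in>B. ennreal (w x powr m + w x) \<partial>lborel)"
    by (rule nn_integral_cmult) measurable
  finally show ?thesis unfolding A_def w_def .
qed

text \<open>
  The reference set \<open>B\<^sub>0\<close> fixes the bounds \<open>X\<close> for coordinates and \<open>T\<close> for tails, so that the constant
  is the same for all levels \<open>k\<close>, all cut-offs \<open>\<phi>\<close> and all sets \<open>B\<close> inside \<open>B\<^sub>0\<close>, as the iteration
  requires.
\<close>

lemma caccioppoli: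
  assumes sol: "weak_solution \<Omega> p q s t a u" and B\<^sub>0: "B\<^sub>0 \<subseteq> \<Omega>"
    and X: "\<And>x i. x \<in> B\<^sub>0 \<Longrightarrow> \<bar>x $ i\<bar> \<le> X" "0 \<le> X"
    and T: "AE x in lborel. x \<in> B\<^sub>0 \<longrightarrow> (\<Sum>i\<in>UNIV. tail u i x) \<le> ennreal T" "0 \<le> T"
  obtains C where "0 \<le> C" and
    "\<And>k \<phi> L B. 0 \<le> k \<Longrightarrow> (\<And>x. 0 \<le> \<phi> x) \<Longrightarrow> (\<And>x. \<phi> x \<le> 1) \<Longrightarrow> 1 \<le> L \<Longrightarrow> L-lipschitz_on UNIV \<phi> \<Longrightarrow>
      B \<in> sets borel \<Longrightarrow> B \<subseteq> B\<^sub>0 \<Longrightarrow> (\<And>x. x \<notin> B \<Longrightarrow> \<phi> x = 0) \<Longrightarrow>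
      (\<And>x i h. \<phi> x \<noteq> 0 \<Longrightarrow> x + h *\<^sub>R axis i 1 \<notin> B \<Longrightarrow> 1 / L \<le> \<bar>h\<bar>) \<Longrightarrow>
      aniso_energy p s (level_test u k \<phi>) \<le> ennreal (C * L powr (1 + q))
        * (\<integral>\<^sup>+x\<in>B. ennreal (max (u x - k) 0 powr p + max (u x - k) 0 powr q + max (u x - k) 0) \<partial>lborel)"
proof (rule energy_le_remainders)
  fix C assume C: "0 \<le> C" and energy: "\<And>\<Omega> u k \<phi> L B. weak_solution \<Omega> p q s t a u \<Longrightarrow> 0 \<le> k \<Longrightarrow>
      (\<And>x. 0 \<le> \<phi> x) \<Longrightarrow> (\<And>x. \<phi> x \<le> 1) \<Longrightarrow> 1 \<le> L \<Longrightarrow> L-lipschitz_on UNIV \<phi> \<Longrightarrow>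
      B \<in> sets borel \<Longrightarrow> B \<subseteq> \<Omega> \<Longrightarrow> (\<And>x. x \<notin> B \<Longrightarrow> \<phi> x = 0) \<Longrightarrow>
      aniso_energy p s (level_test u k \<phi>) \<le> ennreal C * (\<Sum>i\<in>UNIV.
        (\<integral>\<^sup>+x. \<integral>\<^sup>+h. ennreal (p_kernel i h * remainder p u k \<phi> B i x h) \<partial>lborel \<partial>lborel)
      + (\<integral>\<^sup>+x. \<integral>\<^sup>+h. ennreal (q_kernel i h * remainder q u k \<phi> B i x h) \<partial>lborel \<partial>lborel))"
  have [measurable]: "u \<in> borel_measurable borel"
    using sol by (simp add: weak_solution_def A_space_iff in_Lp_def)
  define M where "M = (\<Sum>i\<in>UNIV. enn2real (truncated_kernel_mass i) + enn2real (decaying_kernel_mass i))"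
  have "0 \<le> M" unfolding M_def by (intro sum_nonneg) auto
  have M: "truncated_kernel_mass i \<le> ennreal M" "decaying_kernel_mass i \<le> ennreal M" for i
  proof -
    have "enn2real (truncated_kernel_mass i) + enn2real (decaying_kernel_mass i) \<le> M"
      unfolding M_def by (intro member_le_sum) auto
    then have le: "enn2real (truncated_kernel_mass i) \<le> M" "enn2real (decaying_kernel_mass i) \<le> M"
      using enn2real_nonneg[of "truncated_kernel_mass i"] enn2real_nonneg[of "decaying_kernel_mass i"]
      by linarith+
    show "truncated_kernel_mass i \<le> ennreal M"
      using ennreal_leI[OF le(1)] truncated_kernel_mass_finite[of i] by simp
    show "decaying_kernel_mass i \<le> ennreal M"
      using ennreal_leI[OF le(2)] decaying_kernel_mass_finite[of i] by simp
  qed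
  define A where "A = (M + T) * (2 + X) powr (1 + q)"
  have A: "0 \<le> A" unfolding A_def using \<open>0 \<le> M\<close> T by simp
  show thesis
  proof (rule that)
    show "0 \<le> C * (CARD('n) * (2 * A))" using C A by simp
    fix k L :: real and \<phi> :: "real ^ 'n \<Rightarrow> real" and B
    assume k: "0 \<le> k" and \<phi>: "\<And>x. 0 \<le> \<phi> x" "\<And>x. \<phi> x \<le> 1" "1 \<le> L" "L-lipschitz_on UNIV \<phi>"
      and B [measurable]: "B \<in> sets borel" and "B \<subseteq> B\<^sub>0" and supp: "\<And>x. x \<notin> B \<Longrightarrow> \<phi> x = 0"
      and far: "\<And>x i h. \<phi> x \<noteq> 0 \<Longrightarrow> x + h *\<^sub>R axis i 1 \<notin> B \<Longrightarrow> 1 / L \<le> \<bar>h\<bar>"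
    let ?w = "\<lambda>x. max (u x - k) 0"
    let ?W = "\<integral>\<^sup>+x\<in>B. ennreal (?w x powr p + ?w x powr q + ?w x) \<partial>lborel"
    have tail_i: "AE x in lborel. x \<in> B \<longrightarrow> tail u i x \<le> ennreal T" for i
      using T(1)
    proof eventually_elim
      case (elim x)
      have "tail u i x \<le> (\<Sum>i\<in>UNIV. tail u i x)" by (intro member_le_sum) auto
      with elim \<open>B \<subseteq> B\<^sub>0\<close> show ?case by (auto intro: order_trans)
    qed
    have bound: "(\<integral>\<^sup>+x. \<integral>\<^sup>+h. ennreal (1 / \<bar>h\<bar> powr \<beta> * remainder m u k \<phi> B i x h) \<partial>lborel \<partial>lborel)
        \<le> ennreal (A * L powr (1 + q)) * ?W"
      if m: "m = p \<or> m = q" and "(\<integral>\<^sup>+h. ennreal (1 / \<bar>h\<bar> powr \<beta> * min 1 \<bar>h\<bar> powr m) \<partial>lborel) \<le> ennreal M"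
        and "1 + s i * p \<le> \<beta>" "\<beta> \<le> 1 + q" for \<beta> m i
    proof -
      have "(\<integral>\<^sup>+x. \<integral>\<^sup>+h. ennreal (1 / \<bar>h\<bar> powr \<beta> * remainder m u k \<phi> B i x h) \<partial>lborel \<partial>lborel)
          \<le> ennreal ((M + T) * (2 + X) powr (1 + q) * L powr (1 + q))
            * (\<integral>\<^sup>+x\<in>B. ennreal (?w x powr m + ?w x) \<partial>lborel)"
      proof (rule remainder_integral_le)
        show "\<bar>x $ i\<bar> \<le> X" if "x \<in> B" for x using X(1) that \<open>B \<subseteq> B\<^sub>0\<close> by blast
        show "1 \<le> m" "m \<le> q" using m one_less_p p_le_q by auto
        show "1 / L \<le> \<bar>h\<bar>" if "\<phi> x \<noteq> 0" "x + h *\<^sub>R axis i 1 \<notin> B" for x h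
          using far that by blast
      qed (fact | use k \<phi> supp X(2) T(2) tail_i M(2) \<open>0 \<le> M\<close> in blast)+
      also have "\<dots> \<le> ennreal (A * L powr (1 + q)) * ?W"
        unfolding A_def using m
        by (intro mult_mono nn_integral_mono) (auto simp: indicator_def intro!: ennreal_leI)
      finally show ?thesis .
    qed
    have "(\<Sum>i\<in>UNIV.
        (\<integral>\<^sup>+x. \<integral>\<^sup>+h. ennreal (p_kernel i h * remainder p u k \<phi> B i x h) \<partial>lborel \<partial>lborel)
      + (\<integral>\<^sup>+x. \<integral>\<^sup>+h. ennreal (q_kernel i h * remainder q u k \<phi> B i x h) \<partial>lborel \<partial>lborel))
      \<le> (\<Sum>i\<in>(UNIV :: 'n set). ennreal (A * L powr (1 + q)) * ?W + ennreal (A * L powr (1 + q)) * ?W)"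
      unfolding p_kernel_def q_kernel_def
    proof (intro sum_mono add_mono)
      fix i
      have sp: "s i * p \<le> t i * q"
        using s_le_t[of i] p_le_q s_pos[of i] one_less_p by (intro mult_mono) auto
      have tq: "t i * q \<le> q" using t_less_1[of i] exponents(1) by simp
      have "(\<integral>\<^sup>+h. ennreal (1 / \<bar>h\<bar> powr (1 + s i * p) * min 1 \<bar>h\<bar> powr p) \<partial>lborel) \<le> truncated_kernel_mass i"
        "(\<integral>\<^sup>+h. ennreal (1 / \<bar>h\<bar> powr (1 + t i * q) * min 1 \<bar>h\<bar> powr q) \<partial>lborel) \<le> truncated_kernel_mass i"
        unfolding truncated_kernel_mass_def p_kernel_def q_kernel_def by auto
      note mass = this[THEN order_trans, OF M(1)]
      show "(\<integral>\<^sup>+x. \<integral>\<^sup>+h. ennreal (1 / \<bar>h\<bar> powr (1 + s i * p) * remainder p u k \<phi> B i x h) \<partial>lborel \<partial>lborel)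
          \<le> ennreal (A * L powr (1 + q)) * ?W"
        using mass sp tq by (intro bound) auto
      show "(\<integral>\<^sup>+x. \<integral>\<^sup>+h. ennreal (1 / \<bar>h\<bar> powr (1 + t i * q) * remainder q u k \<phi> B i x h) \<partial>lborel \<partial>lborel)
          \<le> ennreal (A * L powr (1 + q)) * ?W"
        using mass sp tq by (intro bound) auto
    qed
    also have "\<dots> = ennreal (CARD('n) * (2 * A) * L powr (1 + q)) * ?W"
    proof -
      have "y + y = 2 * y" for y :: ennreal by (simp add: mult_2)
      moreover have "ennreal (CARD('n) * (2 * A) * L powr (1 + q)) = of_nat CARD('n) * (2 * ennreal (A * L powr (1 + q)))"
        using A by (simp add: ennreal_mult ennreal_of_nat_eq_real_of_nat mult.assoc)
      ultimately show ?thesis by (simp add: mult.assoc)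
    qed
    finally have "ennreal C * (\<Sum>i\<in>UNIV.
        (\<integral>\<^sup>+x. \<integral>\<^sup>+h. ennreal (p_kernel i h * remainder p u k \<phi> B i x h) \<partial>lborel \<partial>lborel)
      + (\<integral>\<^sup>+x. \<integral>\<^sup>+h. ennreal (q_kernel i h * remainder q u k \<phi> B i x h) \<partial>lborel \<partial>lborel))
      \<le> ennreal C * (ennreal (CARD('n) * (2 * A) * L powr (1 + q)) * ?W)"
      by (intro mult_left_mono) auto
    also have "\<dots> = ennreal (C * (CARD('n) * (2 * A)) * L powr (1 + q)) * ?W"
      using C A by (simp add: mult.assoc[symmetric] ennreal_mult[symmetric])
    finally show "aniso_energy p s (level_test u k \<phi>) \<le> ennreal (C * (CARD('n) * (2 * A)) * L powr (1 + q)) * ?W"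
      using energy[OF sol k \<phi> B _ supp] \<open>B \<subseteq> B\<^sub>0\<close> B\<^sub>0 by (meson order_trans)
  qed
qed

end

section \<open>De Giorgi iteration\<close>

text \<open>
  The ratio \<open>\<mu> = b powr (- 1 / \<beta>)\<close> is the one for which \<open>b\<^sup>j (\<mu>\<^sup>j) powr \<beta> = 1\<close>.
\<close>

lemma fast_geometric_convergence:
  fixes Y :: "nat \<Rightarrow> real"
  assumes Y: "\<And>j. 0 \<le> Y j" and "0 \<le> A" "1 \<le> b" "0 < \<beta>"
    and step: "\<And>j. Y (Suc j) \<le> A * b ^ j * Y j powr (1 + \<beta>)"
    and start: "A * Y 0 powr \<beta> \<le> b powr (- 1 / \<beta>)"
  shows "Y j \<le> Y 0 * (b powr (- 1 / \<beta>)) ^ j"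
proof (induction j)
  case (Suc j)
  define \<mu> where "\<mu> = b powr (- 1 / \<beta>)"
  have \<mu>: "0 < \<mu>" unfolding \<mu>_def using \<open>1 \<le> b\<close> by simp
  have "\<mu> powr \<beta> = b powr (- 1 / \<beta> * \<beta>)"
    unfolding \<mu>_def by (rule powr_powr)
  also have "\<dots> = 1 / b"
    using \<open>1 \<le> b\<close> \<open>0 < \<beta>\<close> by (simp add: powr_minus_divide)
  finally have "\<mu> powr \<beta> = 1 / b" .
  moreover have "(\<mu> ^ j) powr \<beta> = (\<mu> powr \<beta>) ^ j"
    using \<mu> by (simp add: powr_realpow[symmetric] powr_powr mult.commute)
  ultimately have cancel: "b ^ j * (\<mu> ^ j) powr \<beta> = 1"
    using \<open>1 \<le> b\<close> by (simp add: power_one_over)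
  have "Y (Suc j) \<le> A * b ^ j * (Y 0 * \<mu> ^ j) powr (1 + \<beta>)"
    using Suc.IH Y \<open>0 \<le> A\<close> \<open>1 \<le> b\<close> \<open>0 < \<beta>\<close> unfolding \<mu>_def
    by (intro order_trans[OF step] mult_left_mono powr_mono2) auto
  also have "(Y 0 * \<mu> ^ j) powr (1 + \<beta>) = (Y 0 * \<mu> ^ j) * (Y 0 powr \<beta> * (\<mu> ^ j) powr \<beta>)"
    using Y[of 0] \<mu> by (cases "Y 0 = 0") (auto simp: powr_add powr_mult)
  also have "A * b ^ j * ((Y 0 * \<mu> ^ j) * (Y 0 powr \<beta> * (\<mu> ^ j) powr \<beta>))
      = (Y 0 * \<mu> ^ j) * (A * Y 0 powr \<beta>) * (b ^ j * (\<mu> ^ j) powr \<beta>)"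
    by (simp only: mult_ac)
  also have "\<dots> \<le> (Y 0 * \<mu> ^ j) * \<mu>"
    unfolding cancel using start Y[of 0] \<mu> unfolding \<mu>_def by (auto intro!: mult_left_mono)
  finally show ?case unfolding \<mu>_def by (simp add: mult_ac)
qed simp

text \<open>
  Equal to 1 up to distance \<open>r - 2 / L\<close> and to 0 from distance \<open>r - 1 / L\<close> on, which leaves a gap of
  width \<open>1 / L\<close> between its support and the complement of the ball of radius \<open>r\<close>.
\<close>

definition cutoff :: "'a::metric_space \<Rightarrow> real \<Rightarrow> real \<Rightarrow> 'a \<Rightarrow> real" where
  "cutoff x\<^sub>0 r L x = max 0 (min 1 (L * (r - dist x\<^sub>0 x) - 1))"

lemma cutoff_bounds: "0 \<le> cutoff x\<^sub>0 r L x" "cutoff x\<^sub>0 r L x \<le> 1"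
  by (auto simp: cutoff_def)

lemma cutoff_lipschitz:
  assumes "0 \<le> L"
  shows "L-lipschitz_on UNIV (cutoff x\<^sub>0 r L)"
proof (rule lipschitz_onI)
  fix x y
  have "dist (cutoff x\<^sub>0 r L x) (cutoff x\<^sub>0 r L y) \<le> \<bar>L * (r - dist x\<^sub>0 x) - L * (r - dist x\<^sub>0 y)\<bar>"
    unfolding cutoff_def dist_real_def by linarith
  also have "\<dots> = L * \<bar>dist x\<^sub>0 y - dist x\<^sub>0 x\<bar>"
    using assms by (simp add: abs_mult right_diff_distrib[symmetric])
  also have "\<dots> \<le> L * dist x y"
    using assms abs_dist_diff_le[of y x\<^sub>0 x] by (intro mult_left_mono) (auto simp: dist_commute abs_minus_commute)
  finally show "dist (cutoff x\<^sub>0 r L x) (cutoff x\<^sub>0 r L y) \<le> L * dist x y" .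
qed (rule assms)

lemma cutoff_eq_0: "0 \<le> L \<Longrightarrow> x \<notin> ball x\<^sub>0 r \<Longrightarrow> cutoff x\<^sub>0 r L x = 0"
  using mult_nonneg_nonpos[of L "r - dist x\<^sub>0 x"] by (auto simp: cutoff_def)

lemma cutoff_eq_1:
  assumes "0 < L" "dist x\<^sub>0 x \<le> r - 2 / L"
  shows "cutoff x\<^sub>0 r L x = 1"
proof -
  have "L * (2 / L) \<le> L * (r - dist x\<^sub>0 x)"
    using assms by (intro mult_left_mono) auto
  then show ?thesis using assms by (auto simp: cutoff_def)
qed

lemma cutoff_nonzero_dist:
  assumes "0 < L" "cutoff x\<^sub>0 r L x \<noteq> 0" "y \<notin> ball x\<^sub>0 r"
  shows "1 / L \<le> dist x y"
proof -
  have "1 < L * (r - dist x\<^sub>0 x)" using assms by (auto simp: cutoff_def split: if_splits)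
  then have "1 / L < r - dist x\<^sub>0 x" using assms by (simp add: field_simps)
  also have "\<dots> \<le> dist x y"
    using assms(3) dist_triangle[of x\<^sub>0 y x] by simp
  finally show ?thesis by simp
qed

text \<open>
  Where the truncation at the higher level is positive, the one at the lower level is at least
  \<open>1 / D\<close>, so lower powers of it are dominated by the power \<open>P\<close>.
\<close>

lemma truncation_powr_le_lower_truncation:
  fixes a k k' D :: real
  assumes "1 \<le> D" "1 / D \<le> k' - k" "1 \<le> m" "m \<le> P"
  shows "max (a - k') 0 powr m \<le> D powr P * max (a - k) 0 powr P"
proof (cases "a \<le> k'")
  case False
  moreover have "0 < 1 / D" using assms(1) by simp
  ultimately have w: "max (a - k') 0 \<le> max (a - k) 0" "1 / D \<le> max (a - k) 0"
    using assms(2) by linarith+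
  let ?w = "max (a - k) 0"
  have "D * (1 / D) \<le> D * ?w" using w(2) \<open>1 \<le> D\<close> by (intro mult_left_mono) auto
  then have one: "1 \<le> D * ?w" using \<open>1 \<le> D\<close> by simp
  have "max (a - k') 0 powr m \<le> ?w powr m"
    using w assms by (intro powr_mono2) auto
  also have "\<dots> \<le> (D * ?w) powr m"
  proof (rule powr_mono2)
    show "?w \<le> D * ?w" using mult_right_mono[OF \<open>1 \<le> D\<close>, of ?w] by simp
  qed (use assms in auto)
  also have "\<dots> \<le> (D * ?w) powr P"
    by (rule powr_mono[OF \<open>m \<le> P\<close> one])
  also have "\<dots> = D powr P * ?w powr P"
    using assms by (simp add: powr_mult)
  finally show ?thesis .
qed (use assms in simp)

context double_phase
begin

text \<open>
  The radii decrease from \<open>2 R\<close> to \<open>R\<close> and the levels increase from \<open>k\<close> to \<open>2 k\<close>. The slope \<open>L j\<close> of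
  the \<open>j\<close>-th cut-off is chosen with \<open>2 / L j\<close> equal to the \<open>j\<close>-th gap between the radii, so the
  cut-off equals 1 on the next ball. The requirement \<open>k \<ge> 1\<close> makes the recursion independent of
  \<open>k\<close>; therefore \<open>k\<close> can be chosen afterwards so large that the first integral is small.
\<close>

lemma locally_bounded_above:
  assumes sol: "weak_solution \<Omega> p q s t a u" and R: "0 < R" "R \<le> 1" and ball: "ball x\<^sub>0 (2 * R) \<subseteq> \<Omega>"
    and T: "AE x in lborel. x \<in> ball x\<^sub>0 (2 * R) \<longrightarrow> (\<Sum>i\<in>UNIV. tail u i x) \<le> ennreal T" "0 \<le> T"
  shows "\<exists>M. AE x in lborel. x \<in> ball x\<^sub>0 R \<longrightarrow> u x \<le> M"
proof (rule caccioppoli[OF sol ball _ _ T, of "norm x\<^sub>0 + 2 * R"])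
  show "\<bar>x $ i\<bar> \<le> norm x\<^sub>0 + 2 * R" if "x \<in> ball x\<^sub>0 (2 * R)" for x i
  proof -
    have "\<bar>x $ i\<bar> \<le> norm x" by (rule component_le_norm_cart)
    also have "\<dots> \<le> norm x\<^sub>0 + dist x\<^sub>0 x" using norm_triangle_ineq2[of x x\<^sub>0] by (simp add: dist_norm norm_minus_commute)
    finally show ?thesis using that by simp
  qed
  show "0 \<le> norm x\<^sub>0 + 2 * R" using R by simp
next
  fix C
  assume "0 \<le> C" and energy: "\<And>k \<phi> L B. 0 \<le> k \<Longrightarrow> (\<And>x. 0 \<le> \<phi> x) \<Longrightarrow> (\<And>x. \<phi> x \<le> 1) \<Longrightarrow> 1 \<le> L \<Longrightarrow> L-lipschitz_on UNIV \<phi> \<Longrightarrow>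
      B \<in> sets borel \<Longrightarrow> B \<subseteq> ball x\<^sub>0 (2 * R) \<Longrightarrow> (\<And>x. x \<notin> B \<Longrightarrow> \<phi> x = 0) \<Longrightarrow>
      (\<And>x i h. \<phi> x \<noteq> 0 \<Longrightarrow> x + h *\<^sub>R axis i 1 \<notin> B \<Longrightarrow> 1 / L \<le> \<bar>h\<bar>) \<Longrightarrow>
      aniso_energy p s (level_test u k \<phi>) \<le> ennreal (C * L powr (1 + q))
        * (\<integral>\<^sup>+x\<in>B. ennreal (max (u x - k) 0 powr p + max (u x - k) 0 powr q + max (u x - k) 0) \<partial>lborel)"
  have u: "u \<in> A_space p q s t a" using sol by (simp add: weak_solution_def)
  then have [measurable]: "u \<in> borel_measurable borel" and Lp: "(\<integral>\<^sup>+x. ennreal (\<bar>u x\<bar> powr p) \<partial>lborel) < \<infinity>"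
    by (auto simp: A_space_iff in_Lp_def)
  have LP: "(\<integral>\<^sup>+x. ennreal (\<bar>u x\<bar> powr P) \<partial>lborel) < \<infinity>"
    using exponents by (intro A_space_integrable_powers[OF u]) auto
  obtain K where "0 \<le> K" and sobolev: "\<And>(f :: real ^ 'n \<Rightarrow> real) c. f \<in> borel_measurable borel \<Longrightarrow> (\<And>x. 0 \<le> f x) \<Longrightarrow>
      (\<integral>\<^sup>+x. ennreal (f x powr p) \<partial>lborel) < \<infinity> \<Longrightarrow> 0 \<le> c \<Longrightarrow> aniso_energy p s f \<le> ennreal c \<Longrightarrow>
      (\<integral>\<^sup>+x. ennreal (f x powr P) \<partial>lborel) \<le> ennreal (K * c powr (1 / (1 - \<theta>)))"
    using aniso_sobolev[OF less_imp_le[OF one_less_p] s_pos \<theta> \<theta>_less_1 P] by metis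
  define \<beta> where "\<beta> = \<theta> / (1 - \<theta>)"
  have \<beta>: "0 < \<beta>" "1 / (1 - \<theta>) = 1 + \<beta>"
    unfolding \<beta>_def using exponents(2) \<theta>_less_1 by (auto simp: field_simps)
  define rad where "rad j = R * (1 + (1 / 2) ^ j)" for j :: nat
  have [measurable]: "ball x\<^sub>0 (rad j) \<in> sets borel" "ball x\<^sub>0 R \<in> sets borel" for j by simp_all
  define L where "L j = 4 / R * 2 ^ j" for j :: nat
  define lev where "lev k j = k * (2 - (1 / 2) ^ j)" for k :: real and j :: nat
  define w where "w k j x = max (u x - lev k j) 0" for k j x
  have [measurable]: "w k j \<in> borel_measurable borel" for k j unfolding w_def by measurable
  define Y where "Y k j = (\<integral>\<^sup>+x\<in>ball x\<^sub>0 (rad j). ennreal (w k j x powr P) \<partial>lborel)" for k j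
  define y where "y k j = enn2real (Y k j)" for k j
  have L: "1 \<le> L j" for j
  proof -
    have "1 * 1 \<le> 4 / R * (2 :: real) ^ j" using R by (intro mult_mono) auto
    then show ?thesis unfolding L_def by simp
  qed
  have lev0: "0 \<le> lev k j" if "0 \<le> k" for k j
  proof -
    have "(1 / 2 :: real) ^ j \<le> 1" by (intro power_le_one) auto
    then show ?thesis unfolding lev_def using that by (intro mult_nonneg_nonneg) linarith+
  qed
  have w_le: "w k j x \<le> \<bar>u x\<bar>" "0 \<le> w k j x" if "0 \<le> k" for k j x
    using lev0[OF that, of j] unfolding w_def by auto
  have Y_fin: "Y k j < \<infinity>" if "0 \<le> k" for k j
  proof -
    have "Y k j \<le> (\<integral>\<^sup>+x. ennreal (\<bar>u x\<bar> powr P) \<partial>lborel)"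
      unfolding Y_def using w_le[OF that, of j] exponents(4)
      by (intro nn_integral_mono) (auto simp: indicator_def intro!: ennreal_leI powr_mono2)
    with LP show ?thesis by (rule le_less_trans[rotated])
  qed
  then have Y_y: "Y k j = ennreal (y k j)" if "0 \<le> k" for k j
    unfolding y_def using that by simp
  define A where "A = K * (3 * C * (4 / R) powr (1 + q) * 2 powr P) powr (1 + \<beta>)"
  define b where "b = 2 powr ((1 + q + P) * (1 + \<beta>))"
  have A: "0 \<le> A" unfolding A_def using \<open>0 \<le> K\<close> by simp
  have b: "1 < b" unfolding b_def using exponents \<beta> by simp
  have step: "y k (Suc j) \<le> A * b ^ j * y k j powr (1 + \<beta>)" if "1 \<le> k" for k j
  proof -
    define \<phi> where "\<phi> = cutoff x\<^sub>0 (rad j) (L j)"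
    define \<eta> where "\<eta> = level_test u (lev k (Suc j)) \<phi>"
    define D where "D = (2 :: real) * 2 ^ j"
    have "0 \<le> k" using that by simp
    have "1 \<le> D" unfolding D_def by (simp add: mult_ge1_I)
    have \<phi>: "0 \<le> \<phi> x" "\<phi> x \<le> 1" for x unfolding \<phi>_def by (rule cutoff_bounds)+
    have \<phi>_lip: "(L j)-lipschitz_on UNIV \<phi>" unfolding \<phi>_def using L[of j] by (intro cutoff_lipschitz) simp
    have [measurable]: "\<phi> \<in> borel_measurable borel"
      using \<phi>_lip by (intro borel_measurable_continuous_onI lipschitz_on_continuous_on)
    have [measurable]: "\<eta> \<in> borel_measurable borel" unfolding \<eta>_def by measurable
    have \<eta>: "0 \<le> \<eta> x" "\<eta> x \<le> \<bar>u x\<bar>" for x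
      unfolding \<eta>_def using level_test_bounds[of "lev k (Suc j)" \<phi> x u] \<phi> lev0[OF \<open>0 \<le> k\<close>] by auto
    have "aniso_energy p s \<eta> \<le> ennreal (C * L j powr (1 + q)) * (\<integral>\<^sup>+x\<in>ball x\<^sub>0 (rad j).
        ennreal (w k (Suc j) x powr p + w k (Suc j) x powr q + w k (Suc j) x) \<partial>lborel)"
      unfolding \<eta>_def w_def
    proof (rule energy)
      show "ball x\<^sub>0 (rad j) \<subseteq> ball x\<^sub>0 (2 * R)"
        unfolding rad_def using R power_le_one[of "1 / 2 :: real" j] by (intro subset_ball) simp
      show "\<phi> x = 0" if "x \<notin> ball x\<^sub>0 (rad j)" for x
        unfolding \<phi>_def using that L[of j] by (intro cutoff_eq_0) auto
      show "1 / L j \<le> \<bar>h\<bar>" if "\<phi> x \<noteq> 0" "x + h *\<^sub>R axis i 1 \<notin> ball x\<^sub>0 (rad j)" for x i h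
        using cutoff_nonzero_dist[of "L j" x\<^sub>0 "rad j" x "x + h *\<^sub>R axis i 1"] L[of j] that
        unfolding \<phi>_def by (simp add: dist_norm)
    qed (use \<phi> L[of j] \<phi>_lip lev0[OF \<open>0 \<le> k\<close>] in auto)
    also have "\<dots> \<le> ennreal (C * L j powr (1 + q)) * (\<integral>\<^sup>+x\<in>ball x\<^sub>0 (rad j).
        ennreal (3 * D powr P) * ennreal (w k j x powr P) \<partial>lborel)"
    proof (intro mult_left_mono nn_integral_mono mult_right_mono)
      fix x
      have gap: "1 / D \<le> lev k (Suc j) - lev k j"
      proof -
        have "lev k (Suc j) - lev k j = k * (1 / D)"
          unfolding lev_def D_def by (simp add: power_one_over field_simps)
        then show ?thesis using \<open>1 \<le> k\<close> \<open>1 \<le> D\<close> by (simp add: divide_right_mono)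
      qed
      have "w k (Suc j) x powr m \<le> D powr P * w k j x powr P" if "1 \<le> m" "m \<le> P" for m
        unfolding w_def using \<open>1 \<le> D\<close> gap that by (rule truncation_powr_le_lower_truncation)
      from this[of p] this[of q] this[of 1] w_le(2)[OF \<open>0 \<le> k\<close>, of "Suc j" x]
      have "w k (Suc j) x powr p + w k (Suc j) x powr q + w k (Suc j) x \<le> 3 * D powr P * w k j x powr P"
        using exponents one_less_p q_le_P by simp
      then show "ennreal (w k (Suc j) x powr p + w k (Suc j) x powr q + w k (Suc j) x)
          \<le> ennreal (3 * D powr P) * ennreal (w k j x powr P)"
        by (simp add: ennreal_mult[symmetric] ennreal_leI)
    qed auto
    also have "\<dots> = ennreal (C * L j powr (1 + q)) * (ennreal (3 * D powr P) * Y k j)"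
      unfolding Y_def mult.assoc by (subst nn_integral_cmult) auto
    also have "\<dots> = ennreal (C * L j powr (1 + q) * (3 * D powr P) * y k j)"
      unfolding Y_y[OF \<open>0 \<le> k\<close>] using \<open>0 \<le> C\<close> by (simp add: ennreal_mult[symmetric] y_def mult.assoc)
    finally have "aniso_energy p s \<eta> \<le> ennreal (C * L j powr (1 + q) * (3 * D powr P) * y k j)" .
    moreover have "(\<integral>\<^sup>+x. ennreal (\<eta> x powr p) \<partial>lborel) < \<infinity>"
    proof -
      have "(\<integral>\<^sup>+x. ennreal (\<eta> x powr p) \<partial>lborel) \<le> (\<integral>\<^sup>+x. ennreal (\<bar>u x\<bar> powr p) \<partial>lborel)"
        using \<eta> one_less_p by (intro nn_integral_mono ennreal_leI powr_mono2) auto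
      with Lp show ?thesis by (rule le_less_trans[rotated])
    qed
    ultimately have sob: "(\<integral>\<^sup>+x. ennreal (\<eta> x powr P) \<partial>lborel)
        \<le> ennreal (K * (C * L j powr (1 + q) * (3 * D powr P) * y k j) powr (1 / (1 - \<theta>)))"
      using \<eta>(1) \<open>0 \<le> C\<close> by (intro sobolev) (auto simp: y_def)
    have "Y k (Suc j) \<le> (\<integral>\<^sup>+x. ennreal (\<eta> x powr P) \<partial>lborel)"
      unfolding Y_def
    proof (rule nn_integral_mono)
      fix x
      show "ennreal (w k (Suc j) x powr P) * indicator (ball x\<^sub>0 (rad (Suc j))) x \<le> ennreal (\<eta> x powr P)"
      proof (cases "x \<in> ball x\<^sub>0 (rad (Suc j))")
        case True
        have "rad (Suc j) = rad j - 2 / L j"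
          unfolding rad_def L_def using R by (simp add: power_one_over field_simps)
        then have "\<phi> x = 1"
          unfolding \<phi>_def using True L[of j] by (intro cutoff_eq_1) auto
        then show ?thesis using True by (simp add: \<eta>_def level_test_def w_def)
      qed simp
    qed
    also note sob
    also have "K * (C * L j powr (1 + q) * (3 * D powr P) * y k j) powr (1 / (1 - \<theta>))
        = A * b ^ j * y k j powr (1 + \<beta>)"
    proof -
      have two: "(2 ^ j :: real) powr e = (2 powr e) ^ j" for e
        by (simp add: powr_realpow[symmetric] powr_powr mult.commute)
      have "C * L j powr (1 + q) * (3 * D powr P) * y k j
          = (3 * C * (4 / R) powr (1 + q) * 2 powr P) * (2 ^ j) powr (1 + q + P) * y k j"
        unfolding L_def D_def powr_mult by (simp add: powr_add)
      then have "(C * L j powr (1 + q) * (3 * D powr P) * y k j) powr (1 + \<beta>)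
          = (3 * C * (4 / R) powr (1 + q) * 2 powr P) powr (1 + \<beta>) * ((2 ^ j) powr (1 + q + P)) powr (1 + \<beta>) * y k j powr (1 + \<beta>)"
        using \<open>0 \<le> C\<close> by (simp only:) (subst powr_mult; simp add: y_def powr_mult)
      also have "((2 ^ j) powr (1 + q + P)) powr (1 + \<beta>) = b ^ j"
        unfolding b_def powr_powr two[symmetric] by (simp only: powr_powr)
      finally show ?thesis unfolding A_def \<beta>(2) by simp
    qed
    finally show ?thesis
      unfolding Y_y[OF \<open>0 \<le> k\<close>] using A b by (subst (asm) ennreal_le_iff) (auto simp: y_def)
  qed
  \<comment> \<open>the starting integral becomes small for high levels, as \<open>\<bar>u\<bar> powr P\<close> is an integrable majorant\<close>
  have "(\<lambda>n. y (real n) 0) \<longlonglongrightarrow> 0"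
  proof -
    have "(\<lambda>n. Y (real n) 0) \<longlonglongrightarrow> (\<integral>\<^sup>+x. (0 :: ennreal) \<partial>(lborel :: (real ^ 'n) measure))"
      unfolding Y_def
    proof (rule nn_integral_dominated_convergence[where w = "\<lambda>x. ennreal (\<bar>u x\<bar> powr P)"])
      show "AE x in lborel. ennreal (w (real n) 0 x powr P) * indicator (ball x\<^sub>0 (rad 0)) x \<le> ennreal (\<bar>u x\<bar> powr P)" for n
        using w_le[of "real n"] exponents(4)
        by (intro AE_I2) (auto simp: indicator_def intro!: ennreal_leI powr_mono2)
      show "AE x in lborel. (\<lambda>n. ennreal (w (real n) 0 x powr P) * indicator (ball x\<^sub>0 (rad 0)) x) \<longlonglongrightarrow> 0"
      proof (rule AE_I2)
        fix x
        obtain n0 where "u x \<le> real n0" using real_arch_simple by blast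
        then have "eventually (\<lambda>n. ennreal (w (real n) 0 x powr P) * indicator (ball x\<^sub>0 (rad 0)) x = 0) sequentially"
          by (intro eventually_sequentiallyI[of n0]) (auto simp: w_def lev_def max_def)
        then show "(\<lambda>n. ennreal (w (real n) 0 x powr P) * indicator (ball x\<^sub>0 (rad 0)) x) \<longlonglongrightarrow> 0"
          by (rule tendsto_eventually)
      qed
    qed (use LP in auto)
    then show ?thesis unfolding y_def by (simp add: tendsto_enn2real[where l = 0, simplified])
  qed
  then have "(\<lambda>n. A * y (real n) 0 powr \<beta>) \<longlonglongrightarrow> A * 0"
    using \<beta>(1) by (intro tendsto_mult tendsto_const tendsto_zero_powrI[OF _ tendsto_const]) (auto simp: y_def)
  moreover have "A * 0 < b powr (- 1 / \<beta>)" using b by simp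
  ultimately have "eventually (\<lambda>n. A * y (real n) 0 powr \<beta> < b powr (- 1 / \<beta>)) sequentially"
    by (rule order_tendstoD)
  then obtain n where n: "A * y (real n) 0 powr \<beta> < b powr (- 1 / \<beta>)" "1 \<le> n"
    using eventually_conj[OF _ eventually_ge_at_top[of "1::nat"]] eventually_happens'[OF sequentially_bot] by blast
  define k where "k = real n"
  have k: "1 \<le> k" "0 \<le> k" unfolding k_def using n by auto
  define \<mu> where "\<mu> = b powr (- 1 / \<beta>)"
  have "b powr (- 1 / \<beta>) < b powr 0" using b \<beta> by (intro powr_less_mono) auto
  then have \<mu>: "0 < \<mu>" "\<mu> < 1" unfolding \<mu>_def using b by auto
  have geo: "y k j \<le> y k 0 * \<mu> ^ j" for j
    unfolding \<mu>_def using n A b \<beta>(1) step[OF k(1)]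
    by (intro fast_geometric_convergence) (auto simp: y_def k_def)
  have "(\<integral>\<^sup>+x. ennreal (max (u x - 2 * k) 0 powr P) * indicator (ball x\<^sub>0 R) x \<partial>lborel) \<le> ennreal (y k 0 * \<mu> ^ j)" for j
  proof -
    have "(\<integral>\<^sup>+x. ennreal (max (u x - 2 * k) 0 powr P) * indicator (ball x\<^sub>0 R) x \<partial>lborel) \<le> Y k j"
      unfolding Y_def
    proof (rule nn_integral_mono)
      fix x
      have "ball x\<^sub>0 R \<subseteq> ball x\<^sub>0 (rad j)"
        unfolding rad_def using R by (intro subset_ball) (simp add: mult_le_cancel_left1)
      moreover have "lev k j \<le> 2 * k" unfolding lev_def using k by (simp add: algebra_simps)
      then have "max (u x - 2 * k) 0 powr P \<le> w k j x powr P"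
        unfolding w_def using exponents(4) by (intro powr_mono2) auto
      ultimately show "ennreal (max (u x - 2 * k) 0 powr P) * indicator (ball x\<^sub>0 R) x
          \<le> ennreal (w k j x powr P) * indicator (ball x\<^sub>0 (rad j)) x"
        by (auto simp: indicator_def intro!: ennreal_leI)
    qed
    also have "\<dots> \<le> ennreal (y k 0 * \<mu> ^ j)"
      unfolding Y_y[OF k(2)] by (rule ennreal_leI[OF geo])
    finally show ?thesis .
  qed
  moreover have "(\<lambda>j. ennreal (y k 0 * \<mu> ^ j)) \<longlonglongrightarrow> ennreal (y k 0 * 0)"
    using \<mu> by (intro tendsto_ennrealI tendsto_mult tendsto_const LIMSEQ_power_zero) auto
  ultimately have "(\<integral>\<^sup>+x. ennreal (max (u x - 2 * k) 0 powr P) * indicator (ball x\<^sub>0 R) x \<partial>lborel) \<le> ennreal (y k 0 * 0)"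
    by (intro LIMSEQ_le_const[rotated]) auto
  then have "AE x in lborel. ennreal (max (u x - 2 * k) 0 powr P) * indicator (ball x\<^sub>0 R) x = 0"
    by (subst nn_integral_0_iff_AE[symmetric]) auto
  then have "AE x in lborel. x \<in> ball x\<^sub>0 R \<longrightarrow> u x \<le> 2 * k"
  proof eventually_elim
    case (elim x)
    then show ?case by (auto simp: max_def split: if_splits)
  qed
  then show ?thesis by blast
qed

lemma weak_solution_uminus:
  assumes "weak_solution \<Omega> p q s t a u"
  shows "weak_solution \<Omega> p q s t a (\<lambda>x. - u x)"
proof -
  have inc: "increment (\<lambda>x. - u x) i x h = - increment u i x h" for i x h
    unfolding increment_def by simp
  have "op_integrand p q s t a (\<lambda>x. - u x) i x h = - op_integrand p q s t a u i x h" for i x h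
    unfolding op_integrand_eq inc flux_minus by simp
  moreover have "(\<lambda>x. - u x) \<in> A_space p q s t a"
    using assms unfolding weak_solution_def A_space_iff in_Lp_def energy_density_def inc by simp
  ultimately show ?thesis
    using assms unfolding weak_solution_def by (simp add: sum_negf)
qed

lemma bounded_near:
  assumes sol: "weak_solution \<Omega> p q s t a u" and R: "0 < R" "R \<le> 1" and ball: "ball x\<^sub>0 (2 * R) \<subseteq> \<Omega>"
    and T: "AE x in lborel. x \<in> ball x\<^sub>0 (2 * R) \<longrightarrow> (\<Sum>i\<in>UNIV. tail u i x) \<le> ennreal T" "0 \<le> T"
  shows "\<exists>M. AE x in lborel. x \<in> ball x\<^sub>0 R \<longrightarrow> \<bar>u x\<bar> \<le> M"
proof -
  obtain M where M: "AE x in lborel. x \<in> ball x\<^sub>0 R \<longrightarrow> u x \<le> M"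
    using locally_bounded_above[OF assms] by blast
  have "tail (\<lambda>x. - u x) = tail u" unfolding tail_def by simp
  then obtain M' where M': "AE x in lborel. x \<in> ball x\<^sub>0 R \<longrightarrow> - u x \<le> M'"
    using locally_bounded_above[OF weak_solution_uminus[OF sol] R ball _ T(2)] T(1) by auto
  from M M' have "AE x in lborel. x \<in> ball x\<^sub>0 R \<longrightarrow> \<bar>u x\<bar> \<le> max M M'"
    by eventually_elim auto
  then show ?thesis by blast
qed

end

section \<open>Local boundedness\<close>

text \<open>
  For \<open>\<rho> \<le> 1\<close> the half sides \<open>\<rho> powr (s\<^sup>+ / s\<^sub>i)\<close> do not exceed \<open>\<rho>\<close>.
\<close>

lemma aniso_rect_small:
  fixes x\<^sub>0 :: "real ^ 'n::finite"
  assumes s: "\<And>i. 0 < s i" and "open \<Omega>" "x\<^sub>0 \<in> \<Omega>"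
  obtains \<rho> where "0 < \<rho>" "\<rho> \<le> 1" "aniso_rect s \<rho> x\<^sub>0 \<subseteq> \<Omega>"
proof -
  obtain e where e: "0 < e" "ball x\<^sub>0 e \<subseteq> \<Omega>"
    using \<open>open \<Omega>\<close> \<open>x\<^sub>0 \<in> \<Omega>\<close> by (meson open_contains_ball)
  define \<rho> where "\<rho> = min 1 (e / CARD('n))"
  have \<rho>: "0 < \<rho>" "\<rho> \<le> 1" "CARD('n) * \<rho> \<le> e"
    unfolding \<rho>_def using e by (auto simp: min_def field_simps)
  have "aniso_rect s \<rho> x\<^sub>0 \<subseteq> ball x\<^sub>0 e"
  proof
    fix y assume "y \<in> aniso_rect s \<rho> x\<^sub>0"
    then have y: "\<bar>(y - x\<^sub>0) $ i\<bar> < \<rho> powr (max_index s / s i)" for i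
      unfolding aniso_rect_def by (auto simp: mem_box_cart abs_less_iff) (smt (verit))+
    have "\<bar>(y - x\<^sub>0) $ i\<bar> < \<rho>" for i
    proof -
      have "s i \<le> max_index s" by (intro Max_ge) auto
      then have "\<rho> powr (max_index s / s i) \<le> \<rho> powr 1"
        using \<rho> s[of i] by (intro powr_mono') auto
      then show ?thesis using y[of i] \<rho> by simp
    qed
    then have "(\<Sum>i\<in>UNIV. \<bar>(y - x\<^sub>0) $ i\<bar>) < (\<Sum>i\<in>(UNIV :: 'n set). \<rho>)"
      by (intro sum_strict_mono) auto
    then have "norm (y - x\<^sub>0) < e"
      using norm_le_l1_cart[of "y - x\<^sub>0"] \<rho>(3) by simp
    then show "y \<in> ball x\<^sub>0 e" by (simp add: dist_norm norm_minus_commute)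
  qed
  with that \<rho> e show ?thesis by blast
qed

lemma locally_bounded_on_if_bounded_near:
  fixes u :: "'a::euclidean_space \<Rightarrow> real"
  assumes [measurable]: "u \<in> borel_measurable borel"
    and near: "\<And>x\<^sub>0. x\<^sub>0 \<in> \<Omega> \<Longrightarrow> \<exists>R M. 0 < R \<and> (AE x in lborel. x \<in> ball x\<^sub>0 R \<longrightarrow> \<bar>u x\<bar> \<le> M)"
  shows "locally_bounded_on \<Omega> u"
  unfolding locally_bounded_on_def
proof (intro conjI allI impI)
  fix K assume K: "compact K \<and> K \<subseteq> \<Omega>"
  then have [measurable]: "K \<in> sets borel" by (simp add: borel_closed compact_imp_closed)
  obtain R M where R: "\<And>x\<^sub>0. x\<^sub>0 \<in> K \<Longrightarrow> 0 < R x\<^sub>0"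
    and M: "\<And>x\<^sub>0. x\<^sub>0 \<in> K \<Longrightarrow> AE x in lborel. x \<in> ball x\<^sub>0 (R x\<^sub>0) \<longrightarrow> \<bar>u x\<bar> \<le> M x\<^sub>0"
    using near K by (metis subsetD)
  have "K \<subseteq> (\<Union>x\<^sub>0\<in>K. ball x\<^sub>0 (R x\<^sub>0))" using R by auto
  then obtain F where F: "F \<subseteq> K" "finite F" "K \<subseteq> (\<Union>x\<^sub>0\<in>F. ball x\<^sub>0 (R x\<^sub>0))"
    using K by (elim conjE compactE_image[of K K "\<lambda>x\<^sub>0. ball x\<^sub>0 (R x\<^sub>0)"]) auto
  define m where "m = (\<Sum>x\<^sub>0\<in>F. \<bar>M x\<^sub>0\<bar>)"
  have "AE x in lborel. \<forall>x\<^sub>0\<in>F. x \<in> ball x\<^sub>0 (R x\<^sub>0) \<longrightarrow> \<bar>u x\<bar> \<le> M x\<^sub>0"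
    using F M by (intro AE_finite_allI) auto
  then have "AE x in lborel. x \<in> K \<longrightarrow> ennreal \<bar>u x\<bar> \<le> ennreal m"
  proof eventually_elim
    case (elim x)
    show ?case
    proof
      assume "x \<in> K"
      then obtain x\<^sub>0 where "x\<^sub>0 \<in> F" "x \<in> ball x\<^sub>0 (R x\<^sub>0)" using F by blast
      with elim have "\<bar>u x\<bar> \<le> M x\<^sub>0" by blast
      also have "\<dots> \<le> \<bar>M x\<^sub>0\<bar>" by simp
      also have "\<dots> \<le> m" unfolding m_def using \<open>x\<^sub>0 \<in> F\<close> F by (intro member_le_sum) auto
      finally show "ennreal \<bar>u x\<bar> \<le> ennreal m" by (rule ennreal_leI)
    qed
  qed
  then have "AE x in restrict_space lborel K. ennreal \<bar>u x\<bar> \<le> ennreal m"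
    by (subst AE_restrict_space_iff) auto
  then have "esssup (restrict_space lborel K) (\<lambda>x. ennreal \<bar>u x\<bar>) \<le> ennreal m"
    by (intro esssup_I) (auto intro!: measurable_restrict_space1)
  then show "esssup (restrict_space lborel K) (\<lambda>x. ennreal \<bar>u x\<bar>) < \<infinity>"
    by (rule le_less_trans) simp
qed measurable

theorem theorem1p1:
  fixes \<Omega> :: "(real ^ 'n::finite) set"
    and p q :: real
    and s t :: "'n \<Rightarrow> real"
    and a :: "(real ^ 'n) \<times> (real ^ 'n) \<Rightarrow> real"
    and u :: "real ^ 'n \<Rightarrow> real"
  assumes "bounded \<Omega>" and "open \<Omega>"
    and "\<And>i. 0 < s i" and "\<And>i. s i \<le> t i" and "\<And>i. t i < 1"
    and "1 < p" and "p \<le> q"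
    and "a \<in> borel_measurable borel"
    and "\<And>x y. 0 \<le> a (x, y)" and "\<And>x y. ereal (a (x, y)) \<le> Linf_norm a"
    and "Linf_norm a < \<infinity>"
    and "harmonic_mean s * p < real CARD('n)"
    and "p < critical_exponent s p"
    and "max (1 / (1 - max_index t)) (1 + max_index s * p) \<le> q"
    and "q \<le> critical_exponent s p"
    and "u \<in> A_space p q s t a \<inter> tail_space \<Omega> p q s"
    and "weak_solution \<Omega> p q s t a u"
    and "\<And>x\<^sub>0 \<rho>. 0 < \<rho> \<Longrightarrow> \<rho> \<le> 1 \<Longrightarrow> aniso_rect s \<rho> x\<^sub>0 \<subseteq> \<Omega> \<Longrightarrow>
       (SUP x\<in>aniso_rect s \<rho> x\<^sub>0. \<Sum>i\<in>UNIV.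
          \<integral>\<^sup>+h\<in>{h. \<bar>x $ i + h - x\<^sub>0 $ i\<bar> < \<rho> powr (max_index s / s i)}.
            ennreal (\<bar>u (x + h *\<^sub>R axis i 1)\<bar> powr q) \<partial>lborel) < \<infinity>"
  shows "locally_bounded_on \<Omega> u"
proof -
  define \<Lambda> where "\<Lambda> = real_of_ereal (Linf_norm a)"
  have \<Lambda>: "a (x, y) \<le> \<Lambda>" for x y
    using assms(10)[of x y] assms(11) unfolding \<Lambda>_def by (cases "Linf_norm a") auto
  define \<theta> where "\<theta> = p / (\<Sum>i\<in>UNIV. 1 / s i)"
  have sum: "0 < (\<Sum>i\<in>UNIV. 1 / s i)" using assms(3) by (intro sum_pos) auto
  have hm: "harmonic_mean s * p = CARD('n) * \<theta>"
    unfolding harmonic_mean_def \<theta>_def using sum by (simp add: field_simps)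
  have "\<theta> < 1" using assms(12) unfolding hm by simp
  have crit: "critical_exponent s p = p / (1 - \<theta>)"
  proof -
    have "critical_exponent s p = (CARD('n) * p) / (CARD('n) * (1 - \<theta>))"
      unfolding critical_exponent_def hm by (simp add: right_diff_distrib)
    then show ?thesis by simp
  qed
  interpret double_phase p q \<theta> "p / (1 - \<theta>)" \<Lambda> s t a
    by standard (use assms \<Lambda> \<theta>_def \<open>\<theta> < 1\<close> crit in auto)
  note sol = \<open>weak_solution \<Omega> p q s t a u\<close>
  show ?thesis
  proof (rule locally_bounded_on_if_bounded_near)
    show "u \<in> borel_measurable borel" using assms(16) by (simp add: tail_space_def)
    fix x\<^sub>0 assume "x\<^sub>0 \<in> \<Omega>"
    with assms(3) \<open>open \<Omega>\<close> obtain \<rho> where \<rho>: "0 < \<rho>" "\<rho> \<le> 1" "aniso_rect s \<rho> x\<^sub>0 \<subseteq> \<Omega>"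
      by (rule aniso_rect_small)
    let ?Q = "aniso_rect s \<rho> x\<^sub>0"
    have "open ?Q" unfolding aniso_rect_def by (rule open_box)
    moreover have "x\<^sub>0 \<in> ?Q" unfolding aniso_rect_def using \<rho>(1) by (simp add: mem_box_cart)
    ultimately obtain e where e: "0 < e" "ball x\<^sub>0 e \<subseteq> ?Q" by (meson open_contains_ball)
    define R where "R = min 1 (e / 2)"
    have R: "0 < R" "R \<le> 1" "2 * R \<le> e" unfolding R_def using e by auto
    have in_Q: "ball x\<^sub>0 (2 * R) \<subseteq> ?Q" using e R(3) by (meson order_trans subset_ball)
    define S where "S = esssup (restrict_space lborel ?Q) (\<lambda>x. \<Sum>i\<in>UNIV. tail u i x)"
    have "S < \<infinity>"
      using assms(16) \<rho> unfolding S_def tail_space_def tail_def by blast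
    then obtain T where T: "S = ennreal T" "0 \<le> T" by (cases S) auto
    have "AE x in restrict_space lborel ?Q. (\<Sum>i\<in>UNIV. tail u i x) \<le> ennreal T"
      unfolding T(1)[symmetric] S_def by (rule esssup_AE)
    then have "AE x in lborel. x \<in> ?Q \<longrightarrow> (\<Sum>i\<in>UNIV. tail u i x) \<le> ennreal T"
      by (subst (asm) AE_restrict_space_iff) (auto simp: borel_open[OF \<open>open ?Q\<close>])
    then have "AE x in lborel. x \<in> ball x\<^sub>0 (2 * R) \<longrightarrow> (\<Sum>i\<in>UNIV. tail u i x) \<le> ennreal T"
      by eventually_elim (use in_Q in auto)
    then have "\<exists>M. AE x in lborel. x \<in> ball x\<^sub>0 R \<longrightarrow> \<bar>u x\<bar> \<le> M"
      using in_Q \<rho>(3) T(2) R by (intro bounded_near[OF sol]) auto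
    with R(1) show "\<exists>R M. 0 < R \<and> (AE x in lborel. x \<in> ball x\<^sub>0 R \<longrightarrow> \<bar>u x\<bar> \<le> M)" by blast
  qed
qed

end
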